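(* Let $\mathcal{G}$ be a hereditary graph class for which there exist nonnegative integers $k$ and $\ell$ such that for each $2$-connected graph in $\mathcal{G}$, with $n$ vertices and $m$ edges, one can compute in time $f(n,m)$ an $\ell$-refined tree decomposition with at most $g(n,m)$ nodes and residual independence number at most $k$, where $f$ and $g$ are superadditive functions. Then, for any graph $G$ in $\mathcal{G}$ with $n\ge 1$ vertices and $m$ edges, one can compute in time $\mathcal{O}(n+m+f(2n,m))$ an $\ell$-refined tree decomposition of $G$ with $\mathcal{O}(n+g(2n,m))$ nodes and residual independence number at most $\max\{2-\ell,k\}$.
   Context: All graphs are finite, simple and undirected. A graph class is hereditary if it is closed under induced subgraphs. A graph is $2$-connected if it has at least $3$ vertices and deleting any set of fewer than $2$ vertices leaves a connected graph. With $\mathbb{Z}_+$ the nonnegative integers, a function $f:\mathbb{Z}_+\times\mathbb{Z}_+\to\mathbb{Z}_+$ is superadditive if $f(x_1+x_2,y_1+y_2)\ge f(x_1,y_1)+f(x_2,y_2)$ for all $x_1,y_1,x_2,y_2\in\mathbb{Z}_+$. A tree decomposition of $G$ is a pair $(T,\{X_t\}_{t\in V(T)})$ with $T$ a tree and bags $X_t\subseteq V(G)$ such that every vertex is in some bag, both endpoints of every edge are in a common bag, and for every vertex $u$ the set $\{t:u\in X_t\}$ induces a connected subgraph of $T$. An $\ell$-refined tree decomposition of $G$ is a pair $(T,\{(X_t,U_t)\}_{t\in V(T)})$ such that $(T,\{X_t\}_{t\in V(T)})$ is a tree decomposition of $G$ and, for every $t\in V(T)$, $U_t\subseteq X_t$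 and $|U_t|\le\ell$. Its residual independence number is $\max_{t\in V(T)}\alpha(G[X_t\setminus U_t])$, where $\alpha$ is the maximum size of an independent set. *)

theory Defs
  imports Main
begin

section \<open>Finite simple graphs\<close>

type_synonym 'a graph = "'a set \<times> 'a set set"

abbreviation verts :: "'a graph \<Rightarrow> 'a set" where "verts \<equiv> fst"
abbreviation edges :: "'a graph \<Rightarrow> 'a set set" where "edges \<equiv> snd"

definition simple_graph :: "'a graph \<Rightarrow> bool" where
  "simple_graph G \<longleftrightarrow> finite (verts G) \<and> (\<forall>e\<in>edges G. e \<subseteq> verts G \<and> card e = 2)"

definition induced_subgraph :: "'a graph \<Rightarrow> 'a set \<Rightarrow> 'a graph" where
  "induced_subgraph G S = (S, {e \<in> edges G. e \<subseteq> S})"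

text \<open>
  The class lives on an arbitrary vertex type and is not required to be closed under isomorphism;
  isomorphism-closed classes are a special case.
\<close>
definition hereditary :: "'a graph set \<Rightarrow> bool" where
  "hereditary \<G> \<longleftrightarrow> (\<forall>G\<in>\<G>. \<forall>S. S \<subseteq> verts G \<longrightarrow> induced_subgraph G S \<in> \<G>)"

definition connected :: "'a graph \<Rightarrow> bool" where
  "connected G \<longleftrightarrow> verts G \<noteq> {} \<and>
     (\<forall>u\<in>verts G. \<forall>v\<in>verts G. (u, v) \<in> {(a, b). {a, b} \<in> edges G}\<^sup>*)"

definition two_connected :: "'a graph \<Rightarrow> bool" where
  "two_connected G \<longleftrightarrow> card (verts G) \<ge> 3 \<and>
     (\<forall>S. S \<subseteq> verts G \<and> card S < 2 \<longrightarrow> connected (induced_subgraph G (verts G - S)))"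

definition cycle :: "'a graph \<Rightarrow> 'a list \<Rightarrow> bool" where
  "cycle G p \<longleftrightarrow> length p \<ge> 3 \<and> distinct p \<and>
     (\<forall>i<length p. {p ! i, p ! (Suc i mod length p)} \<in> edges G)"

definition tree :: "'a graph \<Rightarrow> bool" where
  "tree T \<longleftrightarrow> simple_graph T \<and> connected T \<and> (\<nexists>p. cycle T p)"

definition independent :: "'a graph \<Rightarrow> 'a set \<Rightarrow> bool" where
  "independent G S \<longleftrightarrow> S \<subseteq> verts G \<and> (\<forall>u\<in>S. \<forall>v\<in>S. {u, v} \<notin> edges G)"

definition independence_number :: "'a graph \<Rightarrow> nat" where
  "independence_number G = Max (card ` {S. independent G S})"


section \<open>Refined tree decompositions\<close>

definition tree_decomposition :: "'a graph \<Rightarrow> 't graph \<Rightarrow> ('t \<Rightarrow> 'a set) \<Rightarrow> bool" where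
  "tree_decomposition G T X \<longleftrightarrow>
     tree T \<and>
     (\<forall>t\<in>verts T. X t \<subseteq> verts G) \<and>
     (\<forall>u\<in>verts G. \<exists>t\<in>verts T. u \<in> X t) \<and>
     (\<forall>e\<in>edges G. \<exists>t\<in>verts T. e \<subseteq> X t) \<and>
     (\<forall>u\<in>verts G. connected (induced_subgraph T {t \<in> verts T. u \<in> X t}))"

definition refined_tree_decomposition ::
    "nat \<Rightarrow> 'a graph \<Rightarrow> 't graph \<Rightarrow> ('t \<Rightarrow> 'a set) \<Rightarrow> ('t \<Rightarrow> 'a set) \<Rightarrow> bool" where
  "refined_tree_decomposition l G T X U \<longleftrightarrow>
     tree_decomposition G T X \<and> (\<forall>t\<in>verts T. U t \<subseteq> X t \<and> card (U t) \<le> l)"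

definition residual_independence_number ::
    "'a graph \<Rightarrow> 't graph \<Rightarrow> ('t \<Rightarrow> 'a set) \<Rightarrow> ('t \<Rightarrow> 'a set) \<Rightarrow> nat" where
  "residual_independence_number G T X U =
     Max ((\<lambda>t. independence_number (induced_subgraph G (X t - U t))) ` verts T)"


section \<open>Superadditive functions\<close>

definition superadditive :: "(nat \<Rightarrow> nat \<Rightarrow> nat) \<Rightarrow> bool" where
  "superadditive f \<longleftrightarrow> (\<forall>x1 y1 x2 y2. f (x1 + x2) (y1 + y2) \<ge> f x1 y1 + f x2 y2)"


section \<open>Random access machine with uniform cost\<close>

text \<open>
  Programs of a unit-cost random access machine in structured form (while-programs instead of
  jumps). The registers hold natural numbers, the arithmetic operations are addition and truncated
  subtraction, and addressing is indirect. A program can name only finitely many arrays; the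
  arrays of a fixed program can be interleaved in a single register sequence, so having several of
  them instead of one changes running times by a constant factor only. Scalar variables are arrays
  used at index 0. Results are appended to a write-only output tape.
\<close>

datatype exp =
    Const nat
  | Get nat exp          \<comment> \<open>array name, index\<close>
  | Plus exp exp
  | Minus exp exp

datatype com =
    Skip
  | Set nat exp exp      \<comment> \<open>array name, index, new value\<close>
  | Out exp
  | Seq com com
  | If exp com com
  | While exp com

type_synonym mem = "nat \<Rightarrow> nat \<Rightarrow> nat"
type_synonym state = "mem \<times> nat list"

fun val :: "mem \<Rightarrow> exp \<Rightarrow> nat" where
  "val M (Const c) = c"
| "val M (Get a e) = M a (val M e)"
| "val M (Plus e1 e2) = val M e1 + val M e2"
| "val M (Minus e1 e2) = val M e1 - val M e2"

fun cost :: "exp \<Rightarrow> nat" where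
  "cost (Const c) = 1"
| "cost (Get a e) = cost e + 1"
| "cost (Plus e1 e2) = cost e1 + cost e2 + 1"
| "cost (Minus e1 e2) = cost e1 + cost e2 + 1"

text \<open>
  \<open>exec p s t s'\<close>: started in state \<open>s\<close>, program \<open>p\<close> halts after exactly \<open>t\<close> steps in state \<open>s'\<close>.
  A condition is true iff its value is nonzero.
\<close>
inductive exec :: "com \<Rightarrow> state \<Rightarrow> nat \<Rightarrow> state \<Rightarrow> bool" where
  Skip: "exec Skip s 1 s"
| Set: "exec (Set a i e) (M, out)
          (cost i + cost e + 1) (M(a := (M a)(val M i := val M e)), out)"
| Out: "exec (Out e) (M, out) (cost e + 1) (M, out @ [val M e])"
| Seq: "exec p s t s' \<Longrightarrow> exec q s' t' s'' \<Longrightarrow> exec (Seq p q) s (t + t') s''"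
| IfTrue: "val (fst s) e \<noteq> 0 \<Longrightarrow> exec p s t s' \<Longrightarrow> exec (If e p q) s (cost e + 1 + t) s'"
| IfFalse: "val (fst s) e = 0 \<Longrightarrow> exec q s t s' \<Longrightarrow> exec (If e p q) s (cost e + 1 + t) s'"
| WhileFalse: "val (fst s) e = 0 \<Longrightarrow> exec (While e p) s (cost e + 1) s"
| WhileTrue: "val (fst s) e \<noteq> 0 \<Longrightarrow> exec p s t s' \<Longrightarrow> exec (While e p) s' t' s'' \<Longrightarrow>
    exec (While e p) s (cost e + 1 + t + t') s''"

inductive_cases exec_elims:
  "exec Skip s t s'" "exec (Set a i e) s t s'" "exec (Out e) s t s'" "exec (Seq p q) s t s'"
  "exec (If e p q) s t s'" "exec (While e p) s t s'"

lemma exec_deterministic: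
  "exec p s t s' \<Longrightarrow> exec p s u s'' \<Longrightarrow> t = u \<and> s' = s''"
proof (induction arbitrary: u s'' rule: exec.induct)
  case Seq
  from Seq.prems show ?case by (rule exec_elims) (metis Seq.IH)
next
  case IfTrue
  from IfTrue.prems show ?case by (rule exec_elims) (use IfTrue.hyps(1) in \<open>auto dest!: IfTrue.IH\<close>)
next
  case IfFalse
  from IfFalse.prems show ?case by (rule exec_elims) (use IfFalse.hyps(1) in \<open>auto dest!: IfFalse.IH\<close>)
next
  case WhileFalse
  from WhileFalse.prems show ?case by (rule exec_elims) (use WhileFalse.hyps(1) in auto)
next
  case WhileTrue
  from WhileTrue.prems show ?case
    by (rule exec_elims) (use WhileTrue.hyps(1) in simp, metis WhileTrue.IH Suc_eq_plus1 add.assoc add_Suc)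
qed (auto elim: exec_elims)

text \<open>The input is stored in array 0; all other registers are initially 0.\<close>
definition init_mem :: "nat list \<Rightarrow> mem" where
  "init_mem xs = (\<lambda>a i. if a = 0 \<and> i < length xs then xs ! i else 0)"

definition halts_with :: "com \<Rightarrow> nat list \<Rightarrow> nat \<Rightarrow> nat list \<Rightarrow> bool" where
  "halts_with p xs t ys \<longleftrightarrow> (\<exists>M. exec p (init_mem xs, []) t (M, ys))"


section \<open>Encodings\<close>

text \<open>
  \<open>encodes_graph vs xs G\<close>: the vertices of \<open>G\<close> are numbered \<open>0, \<dots>, n - 1\<close> according to their
  positions in \<open>vs\<close>, and \<open>xs\<close> represents \<open>G\<close> by adjacency lists, each in an arbitrary order:
  first \<open>n\<close> and \<open>m\<close>, then the \<open>n + 1\<close> start positions of the adjacency lists (the last one being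
  the end position \<open>2 m\<close>), then the concatenation of the adjacency lists.
\<close>
definition encodes_graph :: "'a list \<Rightarrow> nat list \<Rightarrow> 'a graph \<Rightarrow> bool" where
  "encodes_graph vs xs G \<longleftrightarrow>
     distinct vs \<and> set vs = verts G \<and>
     (\<exists>adj. length adj = length vs \<and>
        (\<forall>i<length vs. distinct (adj ! i) \<and>
           set (adj ! i) = {j. j < length vs \<and> {vs ! i, vs ! j} \<in> edges G}) \<and>
        xs = [length vs, card (edges G)]
             @ map (\<lambda>i. length (concat (take i adj))) [0..<Suc (length vs)]
             @ concat adj)"

text \<open>
  \<open>encodes_decomposition vs ys T X U\<close>: with vertices numbered according to \<open>vs\<close> and the \<open>N\<close> nodes
  of \<open>T\<close> being \<open>0, \<dots>, N - 1\<close>, the sequence \<open>ys\<close> consists of \<open>N\<close>, the \<open>N - 1\<close> edges of the tree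
  \<open>T\<close> (two entries each), and for each node \<open>t\<close> in turn the sets \<open>X t\<close> and \<open>U t\<close>, each as its
  cardinality followed by its elements.
\<close>
definition encodes_decomposition ::
    "'a list \<Rightarrow> nat list \<Rightarrow> nat graph \<Rightarrow> (nat \<Rightarrow> 'a set) \<Rightarrow> (nat \<Rightarrow> 'a set) \<Rightarrow> bool" where
  "encodes_decomposition vs ys T X U \<longleftrightarrow>
     (\<exists>N es xb ub.
        verts T = {..<N} \<and> edges T = (\<lambda>(a, b). {a, b}) ` set es \<and> length es = N - 1 \<and>
        length xb = N \<and> length ub = N \<and>
        (\<forall>t<N. distinct (xb ! t) \<and> set (xb ! t) \<subseteq> {..<length vs} \<and> X t = (!) vs ` set (xb ! t) \<and>
               distinct (ub ! t) \<and> set (ub ! t) \<subseteq> {..<length vs} \<and> U t = (!) vs ` set (ub ! t)) \<and>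
        ys = N # concat (map (\<lambda>(a, b). [a, b]) es)
             @ concat (map2 (\<lambda>x u. length x # x @ length u # u) xb ub))"


section \<open>Computing refined tree decompositions\<close>

text \<open>
  On every encoding of \<open>G\<close>, program \<open>p\<close> halts within \<open>t\<close> steps with an \<open>l\<close>-refined tree
  decomposition of \<open>G\<close> with at most \<open>N\<close> nodes and residual independence number at most \<open>r\<close>. The
  bound \<open>r\<close> is an integer because it is instantiated with a maximum over a possibly negative number.
\<close>
definition computes_refined_tree_decomposition ::
    "com \<Rightarrow> nat \<Rightarrow> 'a graph \<Rightarrow> nat \<Rightarrow> nat \<Rightarrow> int \<Rightarrow> bool" where
  "computes_refined_tree_decomposition p l G t N r \<longleftrightarrow>
     (\<forall>vs xs. encodes_graph vs xs G \<longrightarrow>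
        (\<exists>t' ys T X U.
           halts_with p xs t' ys \<and> t' \<le> t \<and>
           encodes_decomposition vs ys T X U \<and>
           refined_tree_decomposition l G T X U \<and>
           card (verts T) \<le> N \<and>
           int (residual_independence_number G T X U) \<le> r))"

end

theory Submission
  imports Defs
begin

text \<open>
  Number the vertices in the order of a depth-first search and let \<open>low i\<close> be the least number of a
  neighbour of a descendant of \<open>i\<close>. A vertex \<open>i\<close> is joined to its parent's block if
  \<open>low i < par i\<close>, and is the head of a new block otherwise; the block headed by \<open>w\<close> also contains
  \<open>par w\<close>. Every block has one or two vertices or is 2-connected, it meets the union of the blocks
  with smaller heads in at most the vertex \<open>par w\<close>, and distinct blocks share no edge. So the given
  program can be run on the large blocks, blocks of at most two vertices get a single bag, and the
  decompositions are glued by one tree edge each, between two nodes that contain \<open>par w\<close>.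
  Superadditivity bounds the total cost, as the block sizes sum to at most \<open>2 n\<close>. Since the
  construction must be carried out by a random access machine in linear time, all phases are loops
  over arrays, and the given program is relocated to fresh memory for each call.
\<close>


section \<open>Graphs and tree decompositions\<close>

text \<open>Each block is handed to the given program as an induced subgraph of \<open>G\<close>
  itself, with only its vertices renumbered, so heredity is exactly what puts it into the class. In
  the sense used here the root of each component also forms a block of its own. Linear time is the
  obstacle that shapes the programs. A call must not pay for clearing memory, although the given
  program expects zeros. The top vertex of a block may lie in many blocks, so its adjacency list
  must not be scanned once per block. The output format lists the tree edges before the bags and the
  tape is write-only, so both are collected in arrays until all blocks are done. Translating the
  output of a call is affordable because a program cannot print more numbers than it makes steps;
  this charges the copying to \<open>f\<close>. The numeric constants in the time bounds are credits
  rounded up generously; only their being constant matters.\<close>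

lemma verts_induced [simp]: "verts (induced_subgraph G S) = S"
  by (simp add: induced_subgraph_def)

lemma edges_induced [simp]: "edges (induced_subgraph G S) = {e \<in> edges G. e \<subseteq> S}"
  by (simp add: induced_subgraph_def)

lemma induced_induced: "S \<subseteq> A \<Longrightarrow> induced_subgraph (induced_subgraph G A) S = induced_subgraph G S"
  by (auto simp: induced_subgraph_def)

lemma induced_verts: "simple_graph G \<Longrightarrow> induced_subgraph G (verts G) = G"
  by (cases G) (auto simp: induced_subgraph_def simple_graph_def)

lemma simple_graph_induced: "simple_graph G \<Longrightarrow> S \<subseteq> verts G \<Longrightarrow> simple_graph (induced_subgraph G S)"
  by (auto simp: simple_graph_def intro: finite_subset)

lemma reach_sym: "sym ({(a, b). {a, b} \<in> E}\<^sup>*)"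
  by (rule sym_rtrancl) (auto simp: sym_def insert_commute)

lemma reach_mono: "E \<subseteq> F \<Longrightarrow> {(a, b). {a, b} \<in> E}\<^sup>* \<subseteq> {(a, b). {a, b} \<in> F}\<^sup>*"
  by (rule rtrancl_mono) auto

lemma connectedI:
  assumes "r \<in> verts G" and "\<And>u. u \<in> verts G \<Longrightarrow> (u, r) \<in> {(a, b). {a, b} \<in> edges G}\<^sup>*"
  shows "connected G"
  using assms reach_sym[of "edges G"] unfolding connected_def
  by (metis (no_types, lifting) empty_iff rtrancl_trans symD)

lemma connected_join:
  assumes H1: "connected H1" and H2: "connected H2" and ab: "a \<in> verts H1" "b \<in> verts H2" "{a, b} \<in> edges H"
    and V: "verts H = verts H1 \<union> verts H2" and E: "edges H1 \<subseteq> edges H" "edges H2 \<subseteq> edges H"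
  shows "connected H"
proof (rule connectedI)
  show "b \<in> verts H" using ab V by simp
next
  fix u assume "u \<in> verts H"
  then consider "u \<in> verts H1" | "u \<in> verts H2" using V by auto
  then show "(u, b) \<in> {(a, b). {a, b} \<in> edges H}\<^sup>*"
  proof cases
    case 1
    then have "(u, a) \<in> {(a, b). {a, b} \<in> edges H}\<^sup>*"
      using H1 ab(1) reach_mono[OF E(1)] unfolding connected_def by blast
    then show ?thesis using ab(3) by (auto intro: rtrancl_into_rtrancl)
  next
    case 2
    then show ?thesis using H2 ab(2) reach_mono[OF E(2)] unfolding connected_def by blast
  qed
qed

lemma connected_image:
  assumes C: "connected G" and V: "verts H = f ` verts G" and E: "\<And>e. e \<in> edges G \<Longrightarrow> f ` e \<in> edges H"
  shows "connected H"
proof -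
  obtain r where r: "r \<in> verts G" using C by (auto simp: connected_def)
  have step: "(f a, f b) \<in> {(a, b). {a, b} \<in> edges H}\<^sup>*" if "(a, b) \<in> {(a, b). {a, b} \<in> edges G}\<^sup>*" for a b
    using that
  proof induction
    case (step y z)
    then have "(f y, f z) \<in> {(a, b). {a, b} \<in> edges H}" using E[of "{y, z}"] by simp
    with step.IH show ?case by (rule rtrancl_into_rtrancl)
  qed simp
  show ?thesis
  proof (rule connectedI)
    show "f r \<in> verts H" using r V by simp
    show "(u, f r) \<in> {(a, b). {a, b} \<in> edges H}\<^sup>*" if "u \<in> verts H" for u
      using that V C r step by (auto simp: connected_def)
  qed
qed

section \<open>Gluing trees and tree decompositions along one edge\<close>

lemma cycle_crossing:
  assumes c: "i < length p" "p ! i \<in> S" "j < length p" "p ! j \<notin> S"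
  shows "\<exists>k < length p. p ! k \<in> S \<and> p ! (Suc k mod length p) \<notin> S"
proof (rule ccontr)
  assume neg: "\<not> ?thesis"
  have L: "length p > 0" using c by auto
  have "p ! ((i + d) mod length p) \<in> S" for d
  proof (induction d)
    case (Suc d)
    have "(i + d) mod length p < length p" using L by simp
    with neg Suc have "p ! (Suc ((i + d) mod length p) mod length p) \<in> S" by blast
    then show ?case by (simp add: mod_Suc_eq)
  qed (use c in simp)
  \<comment> \<open>The offset \<open>length p - i + j\<close> leads from position \<open>i\<close>
    past the end of the list to position \<open>j\<close>.\<close>
  from this[of "length p - i + j"] c show False by simp
qed

text \<open>A cycle inside one half contradicts acyclicity there. Any other cycle leaves
  \<open>verts T1\<close> and comes back, and both crossings use \<open>{a, b}\<close>, the only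
  edge between the halves. Distinctness of the cycle makes them consecutive steps in opposite
  directions, so \<open>k = Suc (Suc k) mod ?L\<close>, which is impossible for a length of at least
  3.\<close>

lemma tree_glue:
  assumes T1: "tree T1" and T2: "tree T2" and disj: "verts T1 \<inter> verts T2 = {}"
    and a: "a \<in> verts T1" and b: "b \<in> verts T2"
  shows "tree (verts T1 \<union> verts T2, insert {a, b} (edges T1 \<union> edges T2))" (is "tree ?T")
proof -
  have E1: "e \<subseteq> verts T1 \<and> card e = 2" if "e \<in> edges T1" for e using T1 that by (auto simp: tree_def simple_graph_def)
  have E2: "e \<subseteq> verts T2 \<and> card e = 2" if "e \<in> edges T2" for e using T2 that by (auto simp: tree_def simple_graph_def)
  have "a \<noteq> b" using disj a b by auto
  then have s: "simple_graph ?T"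
    using E1 E2 T1 T2 a b by (auto simp: simple_graph_def tree_def)
  have c: "connected ?T"
    by (rule connected_join[of T1 T2 a b]) (use T1 T2 a b in \<open>auto simp: tree_def\<close>)
  have "False" if cyc: "cycle ?T p" for p
  proof -
    let ?L = "length p"
    have L: "?L \<ge> 3" and d: "distinct p"
      and e: "\<And>i. i < ?L \<Longrightarrow> {p ! i, p ! (Suc i mod ?L)} \<in> edges ?T"
      using cyc by (auto simp: cycle_def)
    have vs: "p ! i \<in> verts T1 \<union> verts T2" if "i < ?L" for i
      using e[OF that] E1 E2 a b by (auto simp: doubleton_eq_iff)
    have sub: False if T: "tree T" and all: "\<forall>i<?L. p ! i \<in> verts T"
      and ed: "\<And>e. e \<in> edges ?T \<Longrightarrow> e \<subseteq> verts T \<Longrightarrow> e \<in> edges T" for T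
    proof -
      have "cycle T p" unfolding cycle_def
      proof (intro conjI allI impI L d)
        fix i assume i: "i < ?L"
        have "Suc i mod ?L < ?L" by (rule mod_less_divisor) (use L in linarith)
        then show "{p ! i, p ! (Suc i mod ?L)} \<in> edges T" using ed[OF e[OF i]] all i by auto
      qed
      then show False using T by (auto simp: tree_def)
    qed
    have in1: "e \<in> edges T1" if "e \<in> edges ?T" "e \<subseteq> verts T1" for e
      using that disj b E2[of e] by (cases "e = {}") auto
    have in2: "e \<in> edges T2" if "e \<in> edges ?T" "e \<subseteq> verts T2" for e
      using that disj a E1[of e] by (cases "e = {}") auto
    have "\<exists>i<?L. p ! i \<notin> verts T1" using sub[OF T1 _ in1] by blast
    moreover have "\<exists>i<?L. p ! i \<in> verts T1" using sub[OF T2 _ in2] vs by blast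
    ultimately obtain i j where ij: "i < ?L" "p ! i \<in> verts T1" "j < ?L" "p ! j \<notin> verts T1" by blast
    obtain k where k: "k < ?L" "p ! k \<in> verts T1" "p ! (Suc k mod ?L) \<notin> verts T1"
      using cycle_crossing[OF ij] by blast
    obtain k' where k': "k' < ?L" "p ! k' \<notin> verts T1" "p ! (Suc k' mod ?L) \<in> verts T1"
      using cycle_crossing[of j p "- verts T1" i] ij by auto
    let ?s = "Suc k mod ?L" and ?s' = "Suc k' mod ?L"
    have sl: "?s < ?L" "?s' < ?L" using L by (auto intro: mod_less_divisor)
    have cross: "x = a \<and> y = b" if "{x, y} \<in> edges ?T" "x \<in> verts T1" "y \<notin> verts T1" for x y
      using that E1[of "{x,y}"] E2[of "{x,y}"] disj a b by (auto simp: doubleton_eq_iff)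
    have A: "p ! k = a" "p ! ?s = b" using cross[OF e[OF k(1)] k(2,3)] by auto
    have B: "p ! ?s' = a" "p ! k' = b"
      using cross[of "p ! ?s'" "p ! k'"] e[OF k'(1)] k'(2,3) by (auto simp: insert_commute)
    have "k = ?s'" using A B d k(1) sl by (metis nth_eq_iff_index_eq)
    moreover have "k' = ?s" using A B d k'(1) sl by (metis nth_eq_iff_index_eq)
    ultimately have "k = Suc (Suc k) mod ?L" by (simp add: mod_Suc_eq)
    then show False using L k(1)
      by (cases "Suc (Suc k) < ?L") (auto simp: mod_if split: if_splits)
  qed
  with s c show ?thesis unfolding tree_def by blast
qed

text \<open>A cycle of the image is carried back by the inverse of \<open>f\<close>; injectivity
  makes every image edge return to the edge that it came from.\<close>

lemma tree_image:
  assumes T: "tree T" and inj: "inj_on f (verts T)"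
  shows "tree (f ` verts T, (`) f ` edges T)" (is "tree ?T")
proof -
  have E: "e \<subseteq> verts T \<and> card e = 2" if "e \<in> edges T" for e using T that by (auto simp: tree_def simple_graph_def)
  have s: "simple_graph ?T"
    using T inj E by (auto simp: simple_graph_def tree_def intro!: card_image[THEN trans] dest: inj_on_subset)
  have c: "connected ?T" by (rule connected_image[of T _ f]) (use T in \<open>auto simp: tree_def\<close>)
  have "False" if cyc: "cycle ?T p" for p
  proof -
    let ?g = "inv_into (verts T) f"
    have pv: "x \<in> f ` verts T" if "x \<in> set p" for x
    proof -
      obtain i where i: "i < length p" "p ! i = x" using \<open>x \<in> set p\<close> by (auto simp: in_set_conv_nth)
      then have "{x, p ! (Suc i mod length p)} \<in> (`) f ` edges T" using cyc by (auto simp: cycle_def)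
      then show ?thesis using E by fastforce
    qed
    have "cycle T (map ?g p)"
      unfolding cycle_def length_map
    proof (intro conjI allI impI)
      show "3 \<le> length p" using cyc by (simp add: cycle_def)
      show "distinct (map ?g p)"
        using cyc pv by (auto simp: cycle_def distinct_map intro: inj_on_inv_into inj_on_subset)
      fix i assume i: "i < length p"
      then have j: "Suc i mod length p < length p" by (auto intro: mod_less_divisor)
      obtain e where e: "e \<in> edges T" "f ` e = {p ! i, p ! (Suc i mod length p)}"
        using cyc i by (auto simp: cycle_def)
      have "?g ` f ` e = e" using E[OF e(1)] inj by (simp add: inv_into_image_cancel)
      then show "{map ?g p ! i, map ?g p ! (Suc i mod length p)} \<in> edges T" using e i j by simp
    qed
    then show False using T by (auto simp: tree_def)
  qed
  with s c show ?thesis unfolding tree_def by blast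
qed

definition glue :: "nat \<Rightarrow> (nat \<Rightarrow> 'b) \<Rightarrow> (nat \<Rightarrow> 'b) \<Rightarrow> nat \<Rightarrow> 'b" where
  "glue N X Y t = (if t < N then X t else Y (t - N))"

text \<open>The bags do not change, so the point is the subtree of nodes that contain a vertex
  \<open>u\<close>. If \<open>u\<close> lies on one side only, this subtree is an old one. If it
  lies on both, it is in the bags of \<open>h\<close> and \<open>h'\<close>, and the new edge joins
  its two subtrees. By \<open>cov\<close>, every edge lies on a side where it is already
  covered.\<close>

lemma refined_tree_decomposition_glue:
  assumes D: "refined_tree_decomposition l (induced_subgraph G A) T X U" and T: "verts T = {..<N}"
    and D': "refined_tree_decomposition l (induced_subgraph G B) T' X' U'" and T': "verts T' = {..<N'}"
    and h: "h < N" "h' < N'" "A \<inter> B \<subseteq> X h" "A \<inter> B \<subseteq> X' h'"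
    and cov: "\<And>e. e \<in> edges G \<Longrightarrow> e \<subseteq> A \<union> B \<Longrightarrow> e \<subseteq> A \<or> e \<subseteq> B"
  shows "refined_tree_decomposition l (induced_subgraph G (A \<union> B))
    ({..<N + N'}, insert {h, N + h'} (edges T \<union> (`) ((+) N) ` edges T')) (glue N X X') (glue N U U')"
    (is "refined_tree_decomposition l ?G ?T ?X ?U")
proof -
  let ?T2 = "((+) N ` verts T', (`) ((+) N) ` edges T')"
  have shift: "(+) N ` {..<N'} = {N..<N+N'}" using image_add_atLeastLessThan[of N 0 N'] by (simp add: lessThan_atLeast0 add.commute)
  have t1: "tree T" and t2: "tree T'"
    using D D' by (auto simp: refined_tree_decomposition_def tree_decomposition_def)
  have "tree ?T2" by (rule tree_image[OF t2]) simp
  with t1 have "tree (verts T \<union> verts ?T2, insert {h, N + h'} (edges T \<union> edges ?T2))"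
    by (rule tree_glue) (use T T' h in auto)
  moreover have "verts T \<union> verts ?T2 = {..<N+N'}" using T T' shift by auto
  ultimately have tr: "tree ?T" by simp
  have X: "X t \<subseteq> A" if "t < N" for t using D T that by (auto simp: refined_tree_decomposition_def tree_decomposition_def)
  have X': "X' t \<subseteq> B" if "t < N'" for t using D' T' that by (auto simp: refined_tree_decomposition_def tree_decomposition_def)
  have l1: "\<exists>t<N+N'. S \<subseteq> ?X t" if ex: "\<exists>t<N. S \<subseteq> X t" for S
  proof -
    obtain t where "t < N" "S \<subseteq> X t" using ex by auto
    then have "t < N + N' \<and> S \<subseteq> ?X t" by (auto simp: glue_def)
    then show ?thesis by blast
  qed
  have l2: "\<exists>t<N+N'. S \<subseteq> ?X t" if ex: "\<exists>t<N'. S \<subseteq> X' t" for S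
  proof -
    obtain t where "t < N'" "S \<subseteq> X' t" using ex by auto
    then have "N + t < N + N' \<and> S \<subseteq> ?X (N + t)" by (auto simp: glue_def)
    then show ?thesis by blast
  qed
  have c1: "\<exists>t<N. {u} \<subseteq> X t" if "u \<in> A" for u
    using D T that by (auto simp: refined_tree_decomposition_def tree_decomposition_def)
  have c2: "\<exists>t<N'. {u} \<subseteq> X' t" if "u \<in> B" for u
    using D' T' that by (auto simp: refined_tree_decomposition_def tree_decomposition_def)
  have e1: "\<exists>t<N. e \<subseteq> X t" if "e \<in> edges G" "e \<subseteq> A" for e
    using D T that by (auto simp: refined_tree_decomposition_def tree_decomposition_def)
  have e2: "\<exists>t<N'. e \<subseteq> X' t" if "e \<in> edges G" "e \<subseteq> B" for e
    using D' T' that by (auto simp: refined_tree_decomposition_def tree_decomposition_def)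
  have con: "connected (induced_subgraph ?T {t \<in> verts ?T. u \<in> ?X t})" if u: "u \<in> A \<union> B" for u
  proof -
    let ?S1 = "{t \<in> verts T. u \<in> X t}" and ?S2 = "{t \<in> verts T'. u \<in> X' t}"
    let ?H = "induced_subgraph ?T {t \<in> verts ?T. u \<in> ?X t}"
    let ?H2 = "((+) N ` ?S2, (`) ((+) N) ` edges (induced_subgraph T' ?S2))"
    have Hv: "verts ?H = ?S1 \<union> (+) N ` ?S2"
    proof -
      have "x \<in> (+) N ` ?S2" if "x < N + N'" "\<not> x < N" "u \<in> X' (x - N)" for x
      proof -
        have "x = N + (x - N)" "x - N < N'" using that by linarith+
        then show ?thesis using that T' by (intro image_eqI[of _ _ "x - N"]) auto
      qed
      then show ?thesis using T T' by (auto simp: glue_def split: if_splits)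
    qed
    have H1: "connected (induced_subgraph T ?S1)" if "u \<in> A"
      using D that by (auto simp: refined_tree_decomposition_def tree_decomposition_def)
    have H2: "connected ?H2" if "u \<in> B"
    proof (rule connected_image[of "induced_subgraph T' ?S2" _ "(+) N"])
      show "connected (induced_subgraph T' ?S2)"
        using D' that by (auto simp: refined_tree_decomposition_def tree_decomposition_def)
    qed auto
    have E1: "edges (induced_subgraph T ?S1) \<subseteq> edges ?H" using T by (auto simp: glue_def)
    have E2: "edges ?H2 \<subseteq> edges ?H" using T' by (auto simp: glue_def)
    consider "u \<in> A" "u \<in> B" | "u \<in> A" "u \<notin> B" | "u \<notin> A" "u \<in> B" using u by auto
    then show ?thesis
    proof cases
      case 1
      have "connected ?H"
        by (rule connected_join[OF H1[OF 1(1)] H2[OF 1(2)], of h "N + h'"])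
          (use 1 h T T' E1 E2 Hv in \<open>auto simp: glue_def\<close>)
      then show ?thesis .
    next
      case 2
      then have S2: "?S2 = {}" using X' T' by auto
      have "verts ?H = id ` verts (induced_subgraph T ?S1)" using Hv unfolding S2 by simp
      then show ?thesis
        by (rule connected_image[OF H1[OF 2(1)]]) (use E1 in auto)
    next
      case 3
      then have S1: "?S1 = {}" using X T by auto
      have "verts ?H = id ` verts ?H2" using Hv unfolding S1 by simp
      then show ?thesis
        by (rule connected_image[OF H2[OF 3(2)]]) (use E2 in auto)
    qed
  qed
  have "?X t \<subseteq> A \<union> B" if "t < N + N'" for t
  proof (cases "t < N")
    case False
    then have "t - N < N'" using that by linarith
    then show ?thesis using X' False by (auto simp: glue_def)
  qed (use X in \<open>auto simp: glue_def\<close>)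
  moreover have "?U t \<subseteq> ?X t \<and> card (?U t) \<le> l" if "t < N + N'" for t
  proof (cases "t < N")
    case False
    then have "t - N < N'" using that by linarith
    then show ?thesis using D' T' False by (auto simp: refined_tree_decomposition_def glue_def)
  qed (use D T in \<open>auto simp: refined_tree_decomposition_def glue_def\<close>)
  moreover have "\<exists>t<N+N'. u \<in> ?X t" if "u \<in> A \<union> B" for u
    using that l1[of "{u}"] l2[of "{u}"] c1[of u] c2[of u] by auto
  moreover have "\<exists>t<N+N'. e \<subseteq> ?X t" if "e \<in> edges G" "e \<subseteq> A \<union> B" for e
    using cov[OF that] e1[OF that(1)] e2[OF that(1)] l1 l2 by blast
  ultimately show ?thesis
    unfolding refined_tree_decomposition_def tree_decomposition_def using tr con by (auto simp: Bex_def)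
qed

section \<open>Independence numbers and superadditive functions\<close>

lemma independence_number_le_iff:
  assumes "finite (verts G)"
  shows "independence_number G \<le> r \<longleftrightarrow> (\<forall>S. independent G S \<longrightarrow> card S \<le> r)"
proof -
  have "finite {S. independent G S}"
    by (rule finite_subset[of _ "Pow (verts G)"]) (use assms in \<open>auto simp: independent_def\<close>)
  moreover have "independent G {}" by (simp add: independent_def)
  ultimately show ?thesis unfolding independence_number_def by (subst Max_le_iff) auto
qed

lemma independence_number_le_card: "finite S \<Longrightarrow> independence_number (induced_subgraph G S) \<le> card S"
  by (subst independence_number_le_iff) (auto simp: independent_def intro: card_mono)

lemma residual_le_iff:
  assumes "finite (verts T)" "verts T \<noteq> {}"
  shows "residual_independence_number G T X U \<le> r \<longleftrightarrow>
    (\<forall>t\<in>verts T. independence_number (induced_subgraph G (X t - U t)) \<le> r)"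
  using assms unfolding residual_independence_number_def by (subst Max_le_iff) auto

lemma superadditive_sum:
  assumes "superadditive f" "finite S"
  shows "(\<Sum>w\<in>S. f (a w) (b w)) \<le> f (\<Sum>w\<in>S. a w) (\<Sum>w\<in>S. b w)"
  using assms(2)
proof induction
  case (insert x F)
  then show ?case
    using assms(1) by (simp add: superadditive_def) (metis add_mono_thms_linordered_semiring(2) le_trans)
qed simp

text \<open>The value at the increment is nonnegative, so superadditivity entails monotonicity. This
  is needed because the block sizes and edge numbers are only bounded by \<open>2 * n\<close> and
  the number of edges and need not add up to them.\<close>

lemma superadditive_mono:
  assumes "superadditive f" "a \<le> c" "b \<le> d"
  shows "f a b \<le> f c d"
proof -
  have "f a b + f (c - a) (d - b) \<le> f (a + (c - a)) (b + (d - b))" using assms(1) unfolding superadditive_def by blast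
  then show ?thesis using assms(2,3) by simp
qed

section \<open>Blocks of a depth-first search forest\<close>

text \<open>What the block argument needs from a depth-first search, detached from any program. The
  vertices are the numbers from 1 to \<open>n\<close>, and 0 is the parent of the roots. Assumption
  \<open>dfs\<close> says that when \<open>i\<close> is reached, \<open>par i\<close> is the latest
  candidate: every earlier \<open>a\<close> with a neighbour numbered \<open>i\<close> or later is
  at most \<open>par i\<close>. In \<open>hd_eq\<close> the later notions \<open>up\<close> and
  \<open>joined\<close> are unfolded, as they are defined only inside the locale.\<close>

locale normal_tree =
  fixes n :: nat and par hd :: "nat \<Rightarrow> nat" and adj :: "nat \<Rightarrow> nat \<Rightarrow> bool"
  assumes par_less: "\<And>i. 1 \<le> i \<Longrightarrow> i \<le> n \<Longrightarrow> par i < i"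
    and adj_sym: "\<And>i j. adj i j \<Longrightarrow> adj j i"
    and adj_irrefl: "\<And>i. \<not> adj i i"
    and adj_range: "\<And>i j. adj i j \<Longrightarrow> 1 \<le> i \<and> i \<le> n"
    and par_adj: "\<And>i. 1 \<le> i \<Longrightarrow> i \<le> n \<Longrightarrow> par i \<noteq> 0 \<Longrightarrow> adj (par i) i"
    and dfs: "\<And>a i u. a < i \<Longrightarrow> i \<le> u \<Longrightarrow> adj a u \<Longrightarrow> a \<le> par i"
    and hd_eq: "\<And>i. 1 \<le> i \<Longrightarrow> i \<le> n \<Longrightarrow>
      hd i =
        (if \<exists>z a. (z, i) \<in> {(y, par y) |y. 1 \<le> y \<and> y \<le> n}\<^sup>* \<and> adj z a \<and> a < par i then hd (par i) else i)"
begin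

definition up :: "nat \<Rightarrow> nat \<Rightarrow> bool" where
  "up z i \<longleftrightarrow> (z, i) \<in> {(y, par y) |y. 1 \<le> y \<and> y \<le> n}\<^sup>*"

definition joined :: "nat \<Rightarrow> bool" where
  "joined i \<longleftrightarrow> (\<exists>z a. up z i \<and> adj z a \<and> a < par i)"

lemma hd_eq': "1 \<le> i \<Longrightarrow> i \<le> n \<Longrightarrow> hd i = (if joined i then hd (par i) else i)"
  unfolding joined_def up_def by (rule hd_eq)

lemma up_refl: "up z z"
  by (simp add: up_def)

lemma up_step: "up z y \<Longrightarrow> 1 \<le> y \<Longrightarrow> y \<le> n \<Longrightarrow> up z (par y)"
  unfolding up_def by (erule rtrancl_into_rtrancl) auto

lemma up_step_left: "1 \<le> y \<Longrightarrow> y \<le> n \<Longrightarrow> up (par y) i \<Longrightarrow> up y i"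
  unfolding up_def by (rule converse_rtrancl_into_rtrancl) auto

lemma up_cases:
  assumes "up z i"
  obtains "z = i" | c where "up z c" "1 \<le> c" "c \<le> n" "i = par c"
  using assms unfolding up_def by (cases rule: rtranclE) auto

lemma up_induct [consumes 1, case_names base step]:
  assumes "up z i" and "P z"
    and "\<And>y. up z y \<Longrightarrow> 1 \<le> y \<Longrightarrow> y \<le> n \<Longrightarrow> P y \<Longrightarrow> P (par y)"
  shows "P i"
  using assms(1) unfolding up_def
proof (induction rule: rtrancl_induct)
  case (step y z')
  have "1 \<le> y" "y \<le> n" "z' = par y" using step.hyps(2) by auto
  with step.IH step.hyps(1) show ?case using assms(3) unfolding up_def by simp
qed (fact assms(2))

lemma up_le: "up z i \<Longrightarrow> i \<le> z"
proof (induction rule: up_induct)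
  case (step y)
  then show ?case using par_less[of y] by linarith
qed simp

text \<open>The difference applies to the whole union; it removes the 0 that stands for the missing
  parent of a root.\<close>

definition block :: "nat \<Rightarrow> nat set" where
  "block w = {i. 1 \<le> i \<and> i \<le> n \<and> hd i = w} \<union> {par w} - {0}"

lemma up_of_edge:
  assumes "adj a u" "a < i" "i \<le> u"
  shows "up i a"
  using assms(2,3)
proof (induction i rule: less_induct)
  case (less i)
  have i: "1 \<le> i" "i \<le> n" using less.prems adj_range[OF adj_sym[OF assms(1)]] by auto
  have le: "a \<le> par i" by (rule dfs[OF less.prems assms(1)])
  show ?case
  proof (cases "a = par i")
    case True
    then show ?thesis using up_step[OF up_refl i] by simp
  next
    case False
    then have "a < par i" "par i \<le> u" using le par_less[OF i] less.prems by simp_all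
    then have "up (par i) a" using less.IH par_less[OF i] by blast
    then show ?thesis by (rule up_step_left[OF i])
  qed
qed

lemma joinedI: "adj u a \<Longrightarrow> up u i \<Longrightarrow> a < par i \<Longrightarrow> joined i"
  unfolding joined_def by blast

text \<open>For every \<open>y\<close> on the tree path whose parent is still later than
  \<open>a\<close>, the edge from \<open>u\<close> to \<open>a\<close> leads above
  \<open>par y\<close>. So \<open>y\<close> is joined and shares the head of its parent.\<close>

lemma hd_on_path:
  assumes "adj a u" "up u i" "a < i"
  shows "hd i = hd u"
  using assms(2,3)
proof (induction rule: up_induct)
  case (step y)
  have "joined y" using joinedI[OF adj_sym[OF assms(1)] step.hyps(1) step.prems] .
  then have "hd y = hd (par y)" using hd_eq'[OF step.hyps(2,3)] by simp
  moreover have "hd y = hd u" using step.IH step.prems par_less[OF step.hyps(2,3)] by linarith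
  ultimately show ?case by simp
qed simp

text \<open>Let \<open>c\<close> be the child of \<open>a\<close> on the tree path to
  \<open>u\<close>; it has the head of \<open>u\<close>. Either \<open>c\<close> is joined and
  \<open>a\<close> has this head as well, or \<open>c\<close> is the head and \<open>a\<close> is
  its parent, the top vertex of the block.\<close>

lemma edge_in_block:
  assumes "adj a u" "a < u"
  shows "a \<in> block (hd u)" "u \<in> block (hd u)"
proof -
  have a: "1 \<le> a" "a \<le> n" using adj_range[OF assms(1)] by auto
  have u: "1 \<le> u" "u \<le> n" using adj_range[OF adj_sym[OF assms(1)]] by auto
  then show "u \<in> block (hd u)" by (auto simp: block_def)
  have "up u a" using up_of_edge assms by blast
  then obtain c where c: "up u c" "1 \<le> c" "c \<le> n" "a = par c"
    using assms(2) by (cases rule: up_cases) auto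
  have ac: "a < c" using par_less c by simp
  have hc: "hd c = hd u" using hd_on_path[OF assms(1) c(1) ac] .
  show "a \<in> block (hd u)"
  proof (cases "joined c")
    case True
    then have "hd a = hd u" using hd_eq'[OF c(2,3)] c(4) hc by simp
    then show ?thesis using a by (auto simp: block_def)
  next
    case False
    then have "hd u = c" using hd_eq'[OF c(2,3)] hc by simp
    then show ?thesis using a c(4) by (auto simp: block_def)
  qed
qed

lemma joined_par: "joined i \<Longrightarrow> 1 \<le> i \<Longrightarrow> i \<le> n \<Longrightarrow> 1 \<le> par i \<and> par i \<le> n"
proof (intro conjI)
  assume "joined i" "1 \<le> i" "i \<le> n"
  then obtain a z where "adj z a" "a < par i" by (auto simp: joined_def)
  then have "1 \<le> a" using adj_range adj_sym by blast
  then show "1 \<le> par i" using \<open>a < par i\<close> by simp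
next
  assume "1 \<le> i" "i \<le> n"
  then show "par i \<le> n" using par_less[of i] by simp
qed

lemma hd_bounds: "1 \<le> i \<Longrightarrow> i \<le> n \<Longrightarrow> 1 \<le> hd i \<and> hd i \<le> i \<and> hd (hd i) = hd i"
proof (induction i rule: less_induct)
  case (less i)
  show ?case
  proof (cases "joined i")
    case True
    then have "hd i = hd (par i)" using hd_eq' less.prems by simp
    moreover have "1 \<le> hd (par i) \<and> hd (par i) \<le> par i \<and> hd (hd (par i)) = hd (par i)"
      using joined_par[OF True less.prems] less.IH[of "par i"] par_less[OF less.prems] by blast
    ultimately show ?thesis using par_less[OF less.prems] by simp
  qed (use hd_eq' less.prems in simp)
qed

lemma joined_iff_hd: "1 \<le> i \<Longrightarrow> i \<le> n \<Longrightarrow> joined i \<longleftrightarrow> hd i \<noteq> i"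
proof
  assume i: "1 \<le> i" "i \<le> n" and "joined i"
  then have "hd i = hd (par i)" "1 \<le> par i \<and> par i \<le> n" using hd_eq' joined_par by simp_all
  then show "hd i \<noteq> i" using hd_bounds[of "par i"] par_less[OF i] by linarith
next
  assume "1 \<le> i" "i \<le> n" "hd i \<noteq> i"
  then show "joined i" using hd_eq'[of i] by metis
qed

text \<open>A root shares its block with no descendant. Joining a child of the root would take an
  edge to a vertex numbered below the root, and \<open>dfs\<close> would force its number to be at
  most 0, the parent of the root.\<close>

lemma hd_root: "1 \<le> i \<Longrightarrow> i \<le> n \<Longrightarrow> par (hd i) = 0 \<Longrightarrow> hd i = i"
proof (induction i rule: less_induct)
  case (less i)
  show ?case
  proof (rule ccontr)
    assume ne: "hd i \<noteq> i"
    then have j: "joined i" using joined_iff_hd less.prems by blast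
    then have p: "hd i = hd (par i)" "1 \<le> par i" "par i \<le> n" using hd_eq' joined_par less.prems by simp_all
    then have "hd (par i) = par i" using less.IH[of "par i"] par_less less.prems by simp
    then have pp: "par (par i) = 0" using p less.prems by simp
    obtain z a where za: "up z i" "adj z a" "a < par i" using j by (auto simp: joined_def)
    have "par i \<le> z" using up_le[OF za(1)] par_less[of i] less.prems by simp
    then have "a \<le> par (par i)" using dfs[of a "par i" z] adj_sym za by blast
    then show False using pp adj_range[OF adj_sym[OF za(2)]] by simp
  qed
qed

section \<open>Connectivity of a block after deletion of one vertex\<close>

definition conn :: "nat set \<Rightarrow> (nat \<times> nat) set" where
  "conn S = {(i, j). i \<in> S \<and> j \<in> S \<and> adj i j}\<^sup>*"

lemma conn_trans: "(i, j) \<in> conn S \<Longrightarrow> (j, k) \<in> conn S \<Longrightarrow> (i, k) \<in> conn S"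
  unfolding conn_def by (rule rtrancl_trans)

lemma conn_edge: "adj i j \<Longrightarrow> i \<in> S \<Longrightarrow> j \<in> S \<Longrightarrow> (i, j) \<in> conn S"
  unfolding conn_def by auto

lemma conn_sym: "(i, j) \<in> conn S \<Longrightarrow> (j, i) \<in> conn S"
  unfolding conn_def using sym_rtrancl[of "{(i, j). i \<in> S \<and> j \<in> S \<and> adj i j}"] adj_sym
  by (auto simp: sym_def)

lemma par_in_block:
  assumes "i \<in> block w" "i \<noteq> par w" "par i \<noteq> 0" "hd w = w" "1 \<le> w" "w \<le> n"
  shows "par i \<in> block w"
proof -
  have i: "1 \<le> i" "i \<le> n" "hd i = w" using assms by (auto simp: block_def)
  show ?thesis
  proof (cases "joined i")
    case True
    then have "hd (par i) = w" "1 \<le> par i \<and> par i \<le> n" using hd_eq'[OF i(1,2)] joined_par[OF True i(1,2)] i by auto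
    then show ?thesis by (auto simp: block_def)
  next
    case False
    then show ?thesis using hd_eq'[OF i(1,2)] i assms by (auto simp: block_def)
  qed
qed

text \<open>Deleting a vertex \<open>x\<close> below the top of a block leaves a detour from every child \<open>y\<close> of \<open>x\<close>:
  as \<open>y\<close> is joined, an edge leads from its subtree to above \<open>x\<close>, and it lies in the same block.\<close>
lemma block_connected:
  assumes w: "1 \<le> w" "w \<le> n" "hd w = w" and ne: "block w - {x} \<noteq> {}"
  shows "\<exists>r \<in> block w - {x}. \<forall>y \<in> block w - {x}. (y, r) \<in> conn (block w - {x})"
\<comment> \<open>If the top vertex is deleted or absent, the tree paths inside the block all lead
  to \<open>w\<close>. Otherwise they lead to \<open>par w\<close>, and only those through
  \<open>x\<close> have to be replaced.\<close>
proof (cases "x = par w \<or> par w = 0")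
  case True
  let ?S = "block w - {x}"
  have xw: "x \<noteq> w" if "par w \<noteq> 0" using True that par_less[OF w(1,2)] by auto
  have "(y, w) \<in> conn ?S \<and> w \<in> ?S" if "y \<in> ?S" for y
    using that
  proof (induction y rule: less_induct)
    case (less y)
    have y: "1 \<le> y" "y \<le> n" "hd y = w" using less.prems True by (auto simp: block_def)
    show ?case
    proof (cases "y = w")
      case True
      then show ?thesis using less.prems by (auto simp: conn_def)
    next
      case False
      then have j: "joined y" using joined_iff_hd y by simp
      have p: "1 \<le> par y" "par y \<le> n" "hd (par y) = w" using hd_eq'[OF y(1,2)] joined_par[OF j] y j by auto
      have "par w \<noteq> 0" using hd_root[OF y(1,2)] y(3) False by auto
      then have "w \<le> par y" "x = par w" using hd_bounds[OF p(1,2)] p(3) True by auto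
      then have pS: "par y \<in> ?S" using p par_less[OF w(1,2)] by (auto simp: block_def)
      have "(y, par y) \<in> conn ?S"
        using adj_sym[OF par_adj[OF y(1,2)]] p(1) pS less.prems by (intro conn_edge) simp_all
      then show ?thesis using less.IH[OF par_less[OF y(1,2)] pS] conn_trans[of y "par y"] by blast
    qed
  qed
  then show ?thesis using ne by blast
next
  case False
  let ?S = "block w - {x}" and ?r = "par w"
  have r: "?r \<in> ?S" using False by (auto simp: block_def)
  have "(y, ?r) \<in> conn ?S" if "y \<in> ?S" for y
    using that
  proof (induction y rule: less_induct)
    case (less y)
    show ?case
    proof (cases "y = ?r")
      case True
      then show ?thesis by (auto simp: conn_def)
    next
      case yr: False
      then have y: "1 \<le> y" "y \<le> n" "hd y = w" using less.prems by (auto simp: block_def)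
      have pn: "par y \<noteq> 0"
      proof
        assume "par y = 0"
        then have "\<not> joined y" using joined_par y by fastforce
        then show False using joined_iff_hd[OF y(1,2)] y(3) False \<open>par y = 0\<close> by auto
      qed
      have pb: "par y \<in> block w" by (rule par_in_block) (use less.prems yr pn w in simp_all)
      show ?thesis
      proof (cases "par y = x")
        case neq: False
        then have pS: "par y \<in> ?S" using pb by simp
        have "(y, par y) \<in> conn ?S"
          using adj_sym[OF par_adj[OF y(1,2) pn]] pS less.prems by (intro conn_edge)
        then show ?thesis using less.IH[OF par_less[OF y(1,2)] pS] conn_trans[of y "par y"] by blast
      next
        case True
        then have "y \<noteq> w" using False by auto
        then have "joined y" using joined_iff_hd y by simp
        then obtain z a where za: "up z y" "adj z a" "a < par y" by (auto simp: joined_def)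
        have z: "y \<le> z" "1 \<le> z" "z \<le> n" using up_le[OF za(1)] adj_range[OF za(2)] by auto
        have ay: "a < y" using za par_less y by fastforce
        have az: "adj a z" using za adj_sym by blast
        \<comment> \<open>The path from \<open>z\<close> up to \<open>y\<close> consists of numbers
          at least \<open>y\<close>, which differ from \<open>x = par y\<close>, and
          \<open>hd_on_path\<close> keeps it inside the block.\<close>
        have path: "u \<in> ?S \<and> (z, u) \<in> conn ?S" if "up z u" "y \<le> u" for u
          using that
        proof (induction rule: up_induct)
          case base
          have "hd z = w" using hd_on_path[OF az za(1) ay] y by simp
          then show ?case using z par_less[OF y(1,2)] True by (auto simp: block_def conn_def)
        next
          case (step b)
          have yb: "y \<le> b" using step.prems par_less[OF step.hyps(2,3)] by simp
          then have IH: "b \<in> ?S" "(z, b) \<in> conn ?S" using step.IH by auto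
          have c: "1 \<le> par b" "par b \<le> n" using step.prems y step.hyps par_less[OF step.hyps(2,3)] by linarith+
          have "hd (par b) = w"
            using hd_on_path[OF az up_step[OF step.hyps(1-3)]] hd_on_path[OF az za(1) ay] y step.prems ay by simp
          then have cS: "par b \<in> ?S" using c True par_less[OF y(1,2)] step.prems by (auto simp: block_def)
          have "(b, par b) \<in> conn ?S" using adj_sym[OF par_adj[OF step.hyps(2,3)]] c IH(1) cS by (intro conn_edge) auto
          then show ?case using conn_trans[OF IH(2)] cS by blast
        qed
        have zS: "z \<in> ?S" using path[OF up_refl z(1)] by (rule conjunct1)
        have "hd z = w" using hd_on_path[OF az za(1) ay] y by simp
        then have "a \<in> block w" using edge_in_block[OF az] z ay by simp
        then have aS: "a \<in> ?S" using za True by auto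
        have 1: "(y, z) \<in> conn ?S" using conn_sym path[OF za(1)] by simp
        have 2: "(z, a) \<in> conn ?S" using conn_edge[OF za(2) zS aS] .
        have 3: "(a, ?r) \<in> conn ?S" using less.IH[OF ay aS] .
        show ?thesis using conn_trans[OF 1 conn_trans[OF 2 3]] .
      qed
    qed
  qed
  then show ?thesis using r by blast
qed

section \<open>Blocks in the order of their heads\<close>

lemma par_hd_less: "1 \<le> w \<Longrightarrow> w \<le> n \<Longrightarrow> par w \<noteq> 0 \<Longrightarrow> hd (par w) < w"
  using hd_bounds[of "par w"] par_less[of w] by simp

text \<open>The union of the blocks with heads below \<open>w\<close>. Considering only the assigned
  vertices loses nothing: by \<open>par_hd_less\<close> the top vertex of an earlier block has an
  even earlier head.\<close>

definition before :: "nat \<Rightarrow> nat set" where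
  "before w = {i. 1 \<le> i \<and> i \<le> n \<and> hd i < w}"

lemma block_subset: "1 \<le> w \<Longrightarrow> w \<le> n \<Longrightarrow> block w \<subseteq> {1..n}"
  using par_less[of w] by (auto simp: block_def)

lemma before_Suc:
  assumes w: "1 \<le> w" "w \<le> n" "hd w = w"
  shows "before (Suc w) = before w \<union> block w"
  using par_less[OF w(1,2)] par_hd_less[OF w(1,2)] w
  by (auto simp: before_def block_def less_Suc_eq)

lemma before_Suc_nohd:
  assumes w: "1 \<le> w" "w \<le> n" "hd w \<noteq> w"
  shows "before (Suc w) = before w"
proof -
  have "hd i \<noteq> w" if "1 \<le> i" "i \<le> n" for i using hd_bounds[OF that] w by auto
  then show ?thesis by (auto simp: before_def less_Suc_eq)
qed

lemma before_Int_block: "1 \<le> w \<Longrightarrow> w \<le> n \<Longrightarrow> before w \<inter> block w = {par w} - {0}"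
  using par_hd_less[of w] par_less[of w] by (auto simp: before_def block_def)

lemma before_all: "before (Suc n) = {1..n}"
proof -
  have "hd i \<le> n" if "1 \<le> i" "i \<le> n" for i using hd_bounds[OF that] that by linarith
  then show ?thesis by (auto simp: before_def less_Suc_eq_le)
qed

text \<open>The edge lies in the block headed by the head of its later end. If this is not
  \<open>w\<close>, it is smaller than \<open>w\<close>, and then the heads of both ends are
  smaller, by \<open>par_hd_less\<close> also in the case of a top vertex.\<close>

lemma before_edge:
  assumes w: "1 \<le> w" "w \<le> n" and ij: "adj i j" "i \<in> before w \<union> block w" "j \<in> before w \<union> block w"
  shows "{i, j} \<subseteq> before w \<or> {i, j} \<subseteq> block w"
proof -
  have *: "{i, j} \<subseteq> before w \<or> {i, j} \<subseteq> block w"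
    if "adj i j" "i \<in> before w \<union> block w" "j \<in> before w \<union> block w" "i < j" for i j
  proof -
    have B: "i \<in> block (hd j)" "j \<in> block (hd j)" using edge_in_block that by auto
    have j: "1 \<le> j" "j \<le> n" using adj_range adj_sym that by blast+
    show ?thesis
    proof (cases "hd j = w")
      case False
      then have hj: "hd j < w" using that(3) j par_hd_less[OF w] by (auto simp: before_def block_def)
      have i: "1 \<le> i" "i \<le> n" using adj_range that by blast+
      have "hd i = hd j \<or> (i = par (hd j) \<and> i \<noteq> 0)" using B i by (auto simp: block_def)
      then have "hd i < w" using hj par_hd_less[of "hd j"] hd_bounds[OF j] j by auto
      then show ?thesis using i j hj by (auto simp: before_def)
    qed (use B in auto)
  qed
  have "i \<noteq> j" using adj_irrefl ij(1) by blast
  then consider "i < j" | "j < i" by linarith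
  then show ?thesis
  proof cases
    case 1
    then show ?thesis using *[OF ij] by blast
  next
    case 2
    then show ?thesis using *[OF adj_sym[OF ij(1)] ij(3,2)] by blast
  qed
qed

text \<open>A vertex has only one head, so a common vertex is the parent of one of the two heads.
  The parent of \<open>w\<close> has a head below \<open>w\<close> and cannot be assigned to the
  later head \<open>w'\<close>.\<close>

lemma block_Int:
  assumes "1 \<le> w" "w < w'" "w' \<le> n" "i \<in> block w" "i \<in> block w'"
  shows "i = par w'"
proof (rule ccontr)
  assume ne: "i \<noteq> par w'"
  then have i: "hd i = w'" "1 \<le> i" "i \<le> n" using assms by (auto simp: block_def)
  then have "i = par w" "i \<noteq> 0" using assms by (auto simp: block_def)
  then show False using par_hd_less[of w] i assms by auto
qed

abbreviation heads :: "nat set" where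
  "heads \<equiv> {w. 1 \<le> w \<and> w \<le> n \<and> hd w = w}"

text \<open>The assigned vertices are counted once each, and each of the at most \<open>n\<close>
  blocks adds at most one more, its top vertex. This is the origin of the factor 2 in
  \<open>f (2 * n)\<close> and \<open>g (2 * n)\<close>.\<close>

lemma sum_card_block: "(\<Sum>w\<in>heads. card (block w)) \<le> 2 * n"
proof -
  have "(\<Sum>w\<in>heads. card {i. 1 \<le> i \<and> i \<le> n \<and> hd i = w}) = card (\<Union>w\<in>heads. {i. 1 \<le> i \<and> i \<le> n \<and> hd i = w})"
    by (rule card_UN_disjoint[symmetric]) auto
  also have "\<dots> \<le> card {1..n}" by (rule card_mono) auto
  finally have 1: "(\<Sum>w\<in>heads. card {i. 1 \<le> i \<and> i \<le> n \<and> hd i = w}) \<le> n" by simp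
  have "card heads \<le> card {1..n}" by (rule card_mono) auto
  then have 2: "card heads \<le> n" by simp
  have "card (block w) \<le> card {i. 1 \<le> i \<and> i \<le> n \<and> hd i = w} + 1" for w
  proof -
    have "card (block w) \<le> card ({i. 1 \<le> i \<and> i \<le> n \<and> hd i = w} \<union> {par w})"
      by (rule card_mono) (auto simp: block_def)
    also have "\<dots> \<le> card {i. 1 \<le> i \<and> i \<le> n \<and> hd i = w} + 1"
      by (rule order_trans[OF card_Un_le]) simp
    finally show ?thesis .
  qed
  then have "(\<Sum>w\<in>heads. card (block w)) \<le> (\<Sum>w\<in>heads. card {i. 1 \<le> i \<and> i \<le> n \<and> hd i = w} + 1)"
    by (rule sum_mono)
  also have "\<dots> = (\<Sum>w\<in>heads. card {i. 1 \<le> i \<and> i \<le> n \<and> hd i = w}) + card heads"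
    by (subst sum.distrib) simp
  finally show ?thesis using 1 2 by linarith
qed

end

section \<open>Blocks as induced subgraphs of \<open>G\<close>\<close>

locale numbered_graph = normal_tree n par hd "\<lambda>i j. i \<in> {1..n} \<and> j \<in> {1..n} \<and> {v i, v j} \<in> edges G"
  for n par hd and v :: "nat \<Rightarrow> 'a" and G :: "'a graph" +
  assumes v: "bij_betw v {1..n} (verts G)" and G: "simple_graph G"
begin

lemma inj_v: "S \<subseteq> {1..n} \<Longrightarrow> inj_on v S"
  using v bij_betw_imp_inj_on inj_on_subset by blast

lemma v_in: "S \<subseteq> {1..n} \<Longrightarrow> v ` S \<subseteq> verts G"
  using v by (auto simp: bij_betw_def)

lemma block_induced_connected:
  assumes w: "w \<in> heads" and ne: "block w - {x} \<noteq> {}"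
  shows "connected (induced_subgraph G (v ` (block w - {x})))"
proof -
  let ?S = "block w - {x}"
  let ?H = "induced_subgraph G (v ` ?S)"
  obtain r where r: "r \<in> ?S" "\<And>y. y \<in> ?S \<Longrightarrow> (y, r) \<in> conn ?S"
    using block_connected[OF _ _ _ ne] w by blast
  have lift: "(v i, v j) \<in> {(a, b). {a, b} \<in> edges ?H}\<^sup>*" if "(i, j) \<in> conn ?S" for i j
    using that unfolding conn_def
  proof (induction rule: rtrancl_induct)
    case (step y z)
    then have "(v y, v z) \<in> {(a, b). {a, b} \<in> edges ?H}" by auto
    with step.IH show ?case by (rule rtrancl_into_rtrancl)
  qed simp
  show ?thesis
    by (rule connectedI[of "v r"]) (use r lift in auto)
qed

lemma block_two_connected:
  assumes w: "w \<in> heads" and c: "card (block w) \<ge> 3"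
  shows "two_connected (induced_subgraph G (v ` block w))"
  unfolding two_connected_def verts_induced
proof (intro conjI allI impI)
  have sub: "block w \<subseteq> {1..n}" using block_subset w by simp
  then have cv: "card (v ` block w) = card (block w)" using card_image inj_v by blast
  then show "3 \<le> card (v ` block w)" using c by simp
  fix S assume S: "S \<subseteq> v ` block w \<and> card S < 2"
  have "finite (v ` block w)" using finite_subset[OF sub] by simp
  then have "finite S" using S by (blast intro: finite_subset)
  then have "S = {} \<or> (\<exists>y. S = {y})"
    using S card_1_singleton_iff[of S] less_2_cases[of "card S"] by auto
  then consider "S = {}" | y where "S = {y}" by blast
  then obtain x where x: "v ` block w - S = v ` (block w - {x})"
  proof cases
    case 1
    \<comment> \<open>Deleting nothing is the same as deleting 0, which is no vertex, so one
      connectivity lemma covers both kinds of \<open>S\<close>.\<close>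
    have "0 \<notin> block w" by (simp add: block_def)
    then show ?thesis using 1 that[of 0] by simp
  next
    case 2
    then obtain x where "x \<in> block w" "y = v x" using S by auto
    then show ?thesis using 2 that[of x] inj_on_image_set_diff[OF inj_v[OF sub], of "block w" "{x}"] by simp
  qed
  have "card (block w - {x}) \<noteq> 0" using c card_Diff1_le[of "block w" x] by (simp add: card_Diff_singleton_if)
  then have "block w - {x} \<noteq> {}" by (metis card.empty)
  then have "connected (induced_subgraph G (v ` (block w - {x})))" using block_induced_connected w by blast
  then show "connected (induced_subgraph (induced_subgraph G (v ` block w)) (v ` block w - S))"
    unfolding x by (subst induced_induced) auto
qed

lemma edge_ends:
  assumes "e \<in> edges G" "e \<subseteq> v ` S"
  obtains i j where "i \<in> S" "j \<in> S" "e = {v i, v j}" "i \<noteq> j"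
proof -
  have "card e = 2" using G assms by (auto simp: simple_graph_def)
  then obtain a b where "e = {a, b}" "a \<noteq> b" by (meson card_2_iff)
  then show thesis using assms(2) that by blast
qed

lemma edge_split:
  assumes w: "1 \<le> w" "w \<le> n" and e: "e \<in> edges G" "e \<subseteq> v ` before w \<union> v ` block w"
  shows "e \<subseteq> v ` before w \<or> e \<subseteq> v ` block w"
proof -
  have S: "before w \<union> block w \<subseteq> {1..n}" using block_subset[OF w] by (auto simp: before_def)
  obtain i j where ij: "i \<in> before w \<union> block w" "j \<in> before w \<union> block w" "e = {v i, v j}"
    using edge_ends[OF e(1), of "before w \<union> block w"] e(2) unfolding image_Un by metis
  then have "{i, j} \<subseteq> before w \<or> {i, j} \<subseteq> block w"
    by (intro before_edge[OF w]) (use S e in auto)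
  then show ?thesis using ij by auto
qed

lemma v_before_Int_block:
  assumes "1 \<le> w" "w \<le> n"
  shows "v ` before w \<inter> v ` block w = (if par w = 0 then {} else {v (par w)})"
proof -
  have "v ` before w \<inter> v ` block w = v ` (before w \<inter> block w)"
    by (rule inj_on_image_Int[symmetric, of v "{1..n}"]) (use inj_v block_subset[OF assms] in \<open>auto simp: before_def\<close>)
  then show ?thesis using before_Int_block[OF assms] by simp
qed

lemma finite_edges: "finite (edges G)"
  using G by (auto simp: simple_graph_def intro: finite_subset[of _ "Pow (verts G)"])

text \<open>The two distinct ends of an edge common to two blocks would both be common vertices, but
  by \<open>block_Int\<close> there is at most one such vertex. So the edge sets are
  disjoint.\<close>

lemma sum_edges_block: "(\<Sum>w\<in>heads. card (edges (induced_subgraph G (v ` block w)))) \<le> card (edges G)"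
proof -
  have *: False if w: "w \<in> heads" "w' \<in> heads" "w < w'" and e: "e \<in> edges G" "e \<subseteq> v ` block w" "e \<subseteq> v ` block w'" for w w' e
  proof -
    have s: "block w \<subseteq> {1..n}" "block w' \<subseteq> {1..n}" using block_subset w by auto
    obtain i j where ij: "i \<in> block w" "j \<in> block w" "e = {v i, v j}" "i \<noteq> j"
      using edge_ends[OF e(1,2)] by blast
    have "k \<in> block w'" if k: "k \<in> block w" "v k \<in> v ` block w'" for k
    proof -
      obtain k' where "k' \<in> block w'" "v k = v k'" using k by auto
      moreover have "k \<in> {1..n}" "k' \<in> {1..n}" using s k(1) calculation by blast+
      ultimately show ?thesis using inj_onD[OF inj_v[OF order_refl], of k k'] by simp
    qed
    then have "i \<in> block w'" "j \<in> block w'" using ij e(3) by auto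
    then show False using block_Int[of w w' i] block_Int[of w w' j] ij w by auto
  qed
  have "(\<Sum>w\<in>heads. card (edges (induced_subgraph G (v ` block w))))
    = card (\<Union>w\<in>heads. edges (induced_subgraph G (v ` block w)))"
  proof (rule card_UN_disjoint[symmetric])
    show "\<forall>w\<in>heads. finite (edges (induced_subgraph G (v ` block w)))" using finite_edges by simp
    show "\<forall>i\<in>heads. \<forall>j\<in>heads. i \<noteq> j \<longrightarrow>
        edges (induced_subgraph G (v ` block i)) \<inter> edges (induced_subgraph G (v ` block j)) = {}"
    proof (intro ballI impI equals0I)
      fix i j e assume ij: "i \<in> heads" "j \<in> heads" "i \<noteq> j"
        and "e \<in> edges (induced_subgraph G (v ` block i)) \<inter> edges (induced_subgraph G (v ` block j))"
      then have e: "e \<in> edges G" "e \<subseteq> v ` block i" "e \<subseteq> v ` block j" by auto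
      show False using *[OF ij(1,2) _ e] *[OF ij(2,1) _ e(1,3,2)] ij(3) by linarith
    qed
  qed simp
  also have "\<dots> \<le> card (edges G)" by (rule card_mono[OF finite_edges]) auto
  finally show ?thesis .
qed

end

section \<open>Programs with time credits\<close>

text \<open>The number \<open>c\<close> is a supply of time credits. Since every round of a loop consumes some of them,
  a loop invariant that speaks about the credits proves termination as well.\<close>
definition wp :: "com \<Rightarrow> mem \<Rightarrow> nat \<Rightarrow> (mem \<Rightarrow> nat \<Rightarrow> bool) \<Rightarrow> bool" where
  "wp p M c Q \<longleftrightarrow> (\<forall>out. \<exists>t M'. exec p (M, out) t (M', out) \<and> t \<le> c \<and> Q M' (c - t))"

lemma wp_Skip: "1 \<le> c \<Longrightarrow> Q M (c - 1) \<Longrightarrow> wp Skip M c Q"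
  unfolding wp_def using exec.Skip by blast

lemma wp_Set:
  "cost i + cost e + 1 \<le> c \<Longrightarrow> Q (M(a := (M a)(val M i := val M e))) (c - (cost i + cost e + 1)) \<Longrightarrow>
    wp (Set a i e) M c Q"
  unfolding wp_def using exec.Set by blast

text \<open>As a congruence rule this keeps the simplifier away from programs and postconditions.\<close>
lemma wp_cong: "M = M' \<Longrightarrow> c = c' \<Longrightarrow> wp p M c Q = wp p M' c' Q"
  by simp

lemma wp_Seq:
  assumes "wp p M c (\<lambda>M' c'. wp q M' c' Q)"
  shows "wp (Seq p q) M c Q"
  unfolding wp_def
proof
  fix out
  obtain t M' where 1: "exec p (M, out) t (M', out)" "t \<le> c" "wp q M' (c - t) Q"
    using assms unfolding wp_def by blast
  obtain t' M'' where 2: "exec q (M', out) t' (M'', out)" "t' \<le> c - t" "Q M'' (c - t - t')"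
    using 1(3) unfolding wp_def by blast
  have "exec (Seq p q) (M, out) (t + t') (M'', out)" using exec.Seq 1 2 by blast
  then show "\<exists>t M'. exec (Seq p q) (M, out) t (M', out) \<and> t \<le> c \<and> Q M' (c - t)"
    using 1 2 by (intro exI[of _ "t + t'"] exI[of _ M'']) simp
qed

lemma wp_Set_Seq:
  "cost i + cost e + 1 \<le> c \<Longrightarrow> wp q (M(a := (M a)(val M i := val M e))) (c - (cost i + cost e + 1)) Q \<Longrightarrow>
    wp (Seq (Set a i e) q) M c Q"
  by (rule wp_Seq, rule wp_Set)

lemma wp_If:
  assumes "cost e + 1 \<le> c"
    and "val M e \<noteq> 0 \<Longrightarrow> wp p M (c - (cost e + 1)) Q"
    and "val M e = 0 \<Longrightarrow> wp q M (c - (cost e + 1)) Q"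
  shows "wp (If e p q) M c Q"
  unfolding wp_def
proof
  fix out
  let ?r = "if val M e \<noteq> 0 then p else q"
  have "wp ?r M (c - (cost e + 1)) Q" using assms by simp
  then obtain t M' where 1: "exec ?r (M, out) t (M', out)" "t \<le> c - (cost e + 1)" "Q M' (c - (cost e + 1) - t)"
    unfolding wp_def by blast
  have "exec (If e p q) (M, out) (cost e + 1 + t) (M', out)"
    using 1(1) exec.IfTrue[of "(M, out)" e p t "(M', out)" q] exec.IfFalse[of "(M, out)" e q t "(M', out)" p]
    by (cases "val M e = 0") simp_all
  then show "\<exists>t M'. exec (If e p q) (M, out) t (M', out) \<and> t \<le> c \<and> Q M' (c - t)"
    using 1 assms(1) by (intro exI[of _ "cost e + 1 + t"] exI[of _ M']) simp
qed

lemma wp_While: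
  assumes "I M c"
    and "\<And>M c. I M c \<Longrightarrow> cost e + 1 \<le> c"
    and "\<And>M c. I M c \<Longrightarrow> val M e \<noteq> 0 \<Longrightarrow> wp p M (c - (cost e + 1)) I"
    and "\<And>M c. I M c \<Longrightarrow> val M e = 0 \<Longrightarrow> Q M (c - (cost e + 1))"
  shows "wp (While e p) M c Q"
  using assms(1)
proof (induction c arbitrary: M rule: less_induct)
  case (less c)
  note c = assms(2)[OF less.prems]
  show ?case unfolding wp_def
  proof
    fix out
    show "\<exists>t M'. exec (While e p) (M, out) t (M', out) \<and> t \<le> c \<and> Q M' (c - t)"
    proof (cases "val M e = 0")
      case True
      then show ?thesis using assms(4)[OF less.prems] c
        by (intro exI[of _ "cost e + 1"] exI[of _ M]) (use exec.WhileFalse[of "(M, out)" e] in simp)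
    next
      case False
      obtain t M' where 1: "exec p (M, out) t (M', out)" "t \<le> c - (cost e + 1)" "I M' (c - (cost e + 1) - t)"
        using assms(3)[OF less.prems False] unfolding wp_def by blast
      have "c - (cost e + 1) - t < c" using c by simp
      then obtain t' M'' where 2: "exec (While e p) (M', out) t' (M'', out)" "t' \<le> c - (cost e + 1) - t"
        "Q M'' (c - (cost e + 1) - t - t')"
        using less.IH[OF _ 1(3)] unfolding wp_def by blast
      have "exec (While e p) (M, out) (cost e + 1 + t + t') (M'', out)"
        using exec.WhileTrue[of "(M, out)" e] False 1 2 by simp
      then show ?thesis using 1 2 c
        by (intro exI[of _ "cost e + 1 + t + t'"] exI[of _ M'']) simp
    qed
  qed
qed

text \<open>A frame rule for credits: the caller sets aside the full budget \<open>T\<close> and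
  keeps at least \<open>c - T\<close>, whatever the call really consumes. So specifications of
  subprograms do not have to mention the remaining credits.\<close>

lemma wp_call:
  assumes "wp p M T (\<lambda>M' _. Q M')" "T \<le> c" "\<And>M' c'. Q M' \<Longrightarrow> c - T \<le> c' \<Longrightarrow> R M' c'"
  shows "wp p M c R"
  unfolding wp_def
proof
  fix out
  obtain t M' where 1: "exec p (M, out) t (M', out)" "t \<le> T" "Q M'"
    using assms(1) unfolding wp_def by blast
  then show "\<exists>t M'. exec p (M, out) t (M', out) \<and> t \<le> c \<and> R M' (c - t)"
    using assms(2) assms(3)[OF 1(3), of "c - t"] by (intro exI[of _ t] exI[of _ M']) simp
qed

abbreviation V :: "nat \<Rightarrow> exp" where "V x \<equiv> Get x (Const 0)"
abbreviation Assign :: "nat \<Rightarrow> exp \<Rightarrow> com" (infix "::=" 75) where "x ::= e \<equiv> Set x (Const 0) e"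
abbreviation Inc :: "nat \<Rightarrow> com" where "Inc x \<equiv> x ::= Plus (V x) (Const 1)"
text \<open>With truncated subtraction at most one summand is positive, so the value is nonzero
  exactly if the two values differ. Likewise a single \<open>Minus\<close> serves as a test for
  strictly greater.\<close>

abbreviation Differ :: "exp \<Rightarrow> exp \<Rightarrow> exp" where "Differ e e' \<equiv> Plus (Minus e e') (Minus e' e)"
notation Seq (infixr ";;" 70)

section \<open>Lists stored in arrays\<close>

definition seg :: "(nat \<Rightarrow> nat) \<Rightarrow> nat \<Rightarrow> nat list \<Rightarrow> bool" where
  "seg A b xs \<longleftrightarrow> (\<forall>j<length xs. A (b + j) = xs ! j)"

lemma seg_Nil [simp]: "seg A b []"
  by (simp add: seg_def)

lemma seg_append: "seg A b (xs @ ys) \<longleftrightarrow> seg A b xs \<and> seg A (b + length xs) ys"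
proof
  assume *: "seg A b (xs @ ys)"
  show "seg A b xs \<and> seg A (b + length xs) ys"
    unfolding seg_def
  proof (intro conjI allI impI)
    show "A (b + j) = xs ! j" if "j < length xs" for j
      using * that by (auto simp: seg_def nth_append dest: spec[of _ j])
    show "A (b + length xs + j) = ys ! j" if "j < length ys" for j
      using * that unfolding seg_def by (auto simp: nth_append add.assoc dest: spec[of _ "length xs + j"])
  qed
next
  assume *: "seg A b xs \<and> seg A (b + length xs) ys"
  show "seg A b (xs @ ys)" unfolding seg_def
  proof (intro allI impI)
    fix j assume j: "j < length (xs @ ys)"
    show "A (b + j) = (xs @ ys) ! j"
    proof (cases "j < length xs")
      case False
      then obtain i where "j = length xs + i" using le_Suc_ex[of "length xs" j] by auto
      then show ?thesis using * j by (simp add: seg_def nth_append add.assoc)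
    qed (use * in \<open>auto simp: seg_def nth_append\<close>)
  qed
qed

lemma seg_Cons: "seg A b (x # xs) \<longleftrightarrow> A b = x \<and> seg A (Suc b) xs"
  using seg_append[of A b "[x]" xs] by (simp add: seg_def)

lemma seg_upd_other: "i < b \<or> b + length xs \<le> i \<Longrightarrow> seg (A(i := y)) b xs \<longleftrightarrow> seg A b xs"
proof -
  assume "i < b \<or> b + length xs \<le> i"
  then have "(A(i := y)) (b + j) = A (b + j)" if "j < length xs" for j using that by auto
  then show ?thesis unfolding seg_def by simp
qed

lemma seg_snoc: "seg A b xs \<Longrightarrow> i = b + length xs \<Longrightarrow> seg (A(i := y)) b (xs @ [y])"
  by (simp add: seg_append seg_upd_other seg_Cons)

section \<open>Depth-first search\<close>

text \<open>
  The vertex with number \<open>i\<close>, \<open>1 \<le> i \<le> n\<close>, is \<open>ORD i\<close>, and \<open>NUM\<close> is the inverse, with 0 for an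
  unvisited vertex. \<open>PAR\<close> is 0 at the roots. \<open>SV\<close> and \<open>SP\<close> hold the stack of the search, \<open>HD\<close> the
  head of the block a vertex is assigned to, \<open>LOC\<close> its position among the vertices assigned to that
  block, and \<open>MB\<close>, from \<open>BS w\<close> on, the \<open>SZ w\<close> vertices assigned to the block of \<open>w\<close>. \<open>HOME\<close> maps a
  vertex to a tree node whose bag contains it. \<open>EA\<close> and \<open>BA\<close> collect the tree edges and the bags,
  \<open>OA\<close> receives the output of a call. Names that start with \<open>x\<close> are scalars.
\<close>
abbreviation (input) "IN \<equiv> 0::nat"
abbreviation (input) "NUM \<equiv> 2::nat"
abbreviation (input) "ORD \<equiv> 3::nat"
abbreviation (input) "PAR \<equiv> 4::nat"
abbreviation (input) "SV \<equiv> 5::nat"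
abbreviation (input) "SP \<equiv> 6::nat"
abbreviation (input) "LOW \<equiv> 7::nat"
abbreviation (input) "HD \<equiv> 8::nat"
abbreviation (input) "LOC \<equiv> 9::nat"
abbreviation (input) "SZ \<equiv> 10::nat"
abbreviation (input) "BS \<equiv> 11::nat"
abbreviation (input) "MB \<equiv> 12::nat"
abbreviation (input) "HOME \<equiv> 13::nat"
abbreviation (input) "EA \<equiv> 14::nat"
abbreviation (input) "BA \<equiv> 15::nat"
abbreviation (input) "OA \<equiv> 16::nat"
abbreviation (input) "TP \<equiv> 17::nat"
abbreviation (input) "xSC \<equiv> 20::nat"
abbreviation (input) "xCNT \<equiv> 21::nat"
abbreviation (input) "xK \<equiv> 22::nat"
abbreviation (input) "xE \<equiv> 23::nat"
abbreviation (input) "xX \<equiv> 24::nat"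
abbreviation (input) "xJ \<equiv> 25::nat"
abbreviation (input) "xACC \<equiv> 26::nat"
abbreviation (input) "xS \<equiv> 27::nat"
abbreviation (input) "xP \<equiv> 28::nat"
abbreviation (input) "xQ \<equiv> 29::nat"
abbreviation (input) "xEC \<equiv> 30::nat"
abbreviation (input) "xTC \<equiv> 31::nat"
abbreviation (input) "xI \<equiv> 32::nat"
abbreviation (input) "xU \<equiv> 33::nat"
abbreviation (input) "xOP \<equiv> 34::nat"
abbreviation (input) "xBASE \<equiv> 35::nat"
abbreviation (input) "xHI \<equiv> 36::nat"
abbreviation (input) "xNN \<equiv> 37::nat"
abbreviation (input) "xEN \<equiv> 38::nat"
abbreviation (input) "xBN \<equiv> 39::nat"
abbreviation (input) "xH \<equiv> 40::nat"
abbreviation (input) "xT \<equiv> 41::nat"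
abbreviation (input) "xL \<equiv> 42::nat"
abbreviation (input) "xW \<equiv> 43::nat"

abbreviation (input) "eN \<equiv> Get IN (Const 0)"
text \<open>The start positions begin at index 2, after the numbers of vertices and edges; the
  adjacency entries begin at \<open>3 + n\<close>, after the \<open>n + 1\<close> start positions. A
  list ends where the next one starts, hence the offset 3 in \<open>eTo\<close>.\<close>

abbreviation (input) "eFrom e \<equiv> Get IN (Plus (Const 2) e)"
abbreviation (input) "eTo e \<equiv> Get IN (Plus (Const 3) e)"
abbreviation (input) "eTgt e \<equiv> Get IN (Plus (Plus (Const 3) (Get IN (Const 0))) e)"

definition push_nbrs :: com where
  "push_nbrs = While (Minus (V xE) (V xK))
    (Set SV (V xSC) (eTgt (V xK)) ;; Set SP (V xSC) (V xCNT) ;; Inc xSC ;; Inc xK)"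

locale input =
  fixes A :: "nat \<Rightarrow> nat" and n :: nat
  assumes A0: "A 0 = n"
    and start_mono: "\<And>v. v < n \<Longrightarrow> A (2 + v) \<le> A (3 + v)"
    and start_0: "A 2 = 0"
    and tgt_less: "\<And>k. k < A (2 + n) \<Longrightarrow> A (3 + n + k) < n"
begin

definition st :: "nat \<Rightarrow> nat" where "st v = A (2 + v)"
definition tgt :: "nat \<Rightarrow> nat" where "tgt k = A (3 + n + k)"
definition nbr :: "nat \<Rightarrow> nat \<Rightarrow> bool" where
  "nbr v u \<longleftrightarrow> (\<exists>k. st v \<le> k \<and> k < st (Suc v) \<and> tgt k = u)"

lemma nbrI: "st v \<le> k \<Longrightarrow> k < st (Suc v) \<Longrightarrow> nbr v (tgt k)"
  by (auto simp: nbr_def)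

lemma eFrom_val: "A (Suc (Suc v)) = st v" "A (2 + v) = st v" by (simp_all add: st_def)
lemma eTo_val: "A (Suc (Suc (Suc v))) = st (Suc v)" "A (3 + v) = st (Suc v)" by (simp_all add: st_def numeral_3_eq_3)
lemma eTgt_val: "A (Suc (Suc (Suc (n + k)))) = tgt k" "A (3 + n + k) = tgt k" by (simp_all add: tgt_def numeral_3_eq_3)

lemma st_step: "v < n \<Longrightarrow> st v \<le> st (Suc v)"
  using start_mono[of v] eTo_val(2)[of v] by (simp add: st_def)

lemma st_mono: "v \<le> w \<Longrightarrow> w \<le> n \<Longrightarrow> st v \<le> st w"
  by (induction w rule: dec_induct) (use st_step in \<open>auto intro: order_trans\<close>)

lemma tgt_lt: "v < n \<Longrightarrow> k < st (Suc v) \<Longrightarrow> tgt k < n"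
  using st_mono[of "Suc v" n] tgt_less[of k] by (simp add: st_def tgt_def)

lemma sum_deg: "w \<le> n \<Longrightarrow> (\<Sum>v<w. st (Suc v) - st v) = st w"
  by (induction w) (use st_step start_0 in \<open>auto simp: st_def\<close>)

text \<open>
  A stack entry consists of a vertex and the number of the visited neighbour that pushed it, 0 for
  the entries pushed at the start. The stack is sorted by the second component, so a vertex is
  popped with its latest visited neighbour, and no unvisited vertex has a later one.
\<close>
definition dfs_inv :: "(nat \<Rightarrow> nat) \<Rightarrow> (nat \<Rightarrow> nat) \<Rightarrow> (nat \<Rightarrow> nat) \<Rightarrow> (nat \<Rightarrow> nat) \<Rightarrow>
    (nat \<Rightarrow> nat) \<Rightarrow> (nat \<Rightarrow> nat) \<Rightarrow> nat \<Rightarrow> nat \<Rightarrow> bool" where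
  "dfs_inv num ord par low sv sp cnt sc \<longleftrightarrow>
    (\<forall>v<n. num v \<le> cnt \<and> (num v \<noteq> 0 \<longrightarrow> ord (num v) = v)) \<and>
    (\<forall>i. 1 \<le> i \<and> i \<le> cnt \<longrightarrow> ord i < n \<and> num (ord i) = i \<and> par i < i \<and> low i = i \<and>
       (par i \<noteq> 0 \<longrightarrow> nbr (ord (par i)) (ord i))) \<and>
    (\<forall>a i u. 1 \<le> a \<and> a < i \<and> i \<le> cnt \<and> u < n \<and> (num u = 0 \<or> i \<le> num u) \<and> nbr (ord a) u \<longrightarrow> a \<le> par i) \<and>
    (\<forall>j<sc. sv j < n \<and> sp j \<le> cnt \<and> (sp j \<noteq> 0 \<longrightarrow> nbr (ord (sp j)) (sv j))) \<and>
    (\<forall>j j'. j \<le> j' \<and> j' < sc \<longrightarrow> sp j \<le> sp j') \<and>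
    (\<forall>u<n. num u = 0 \<longrightarrow> (\<exists>j<sc. sv j = u \<and> sp j = 0) \<and>
       (\<forall>a. 1 \<le> a \<and> a \<le> cnt \<and> nbr (ord a) u \<longrightarrow> (\<exists>j<sc. sv j = u \<and> sp j = a)))"

lemma dfs_inv_pop:
  assumes I: "dfs_inv num ord par low sv sp cnt (Suc sc)" and v: "num (sv sc) \<noteq> 0"
  shows "dfs_inv num ord par low sv sp cnt sc"
proof -
  have "\<exists>j<sc. sv j = u \<and> sp j = a" if "num u = 0" "\<exists>j<Suc sc. sv j = u \<and> sp j = a" for u a
    using that v less_Suc_eq by metis
  then show ?thesis using I unfolding dfs_inv_def by simp
qed

text \<open>No older entry has a stamp above \<open>cnt\<close>, so the pushed entries with stamp
  \<open>Suc cnt\<close> keep the stack sorted. They are also the entries that the invariant demands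
  for the new vertex in its role as a visited neighbour.\<close>

lemma dfs_inv_visit:
  assumes I: "dfs_inv num ord par low sv sp cnt (Suc sc)" and v: "num (sv sc) = 0"
    and x: "x = sv sc" and p: "p = sp sc"
    and keep: "\<And>j. j < sc \<Longrightarrow> sv' j = sv j \<and> sp' j = sp j"
    and push: "\<And>d. d < st (Suc x) - st x \<Longrightarrow> sv' (sc + d) = tgt (st x + d) \<and> sp' (sc + d) = Suc cnt"
  shows "dfs_inv (num(x := Suc cnt)) (ord(Suc cnt := x)) (par(Suc cnt := p)) (low(Suc cnt := Suc cnt))
     sv' sp' (Suc cnt) (sc + (st (Suc x) - st x))"
proof -
  let ?num = "num(x := Suc cnt)" and ?ord = "ord(Suc cnt := x)" and ?par = "par(Suc cnt := p)"
  let ?sc = "sc + (st (Suc x) - st x)"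
  note D1 = I[unfolded dfs_inv_def]
  note D2 = conjunct2[OF D1] note D3 = conjunct2[OF D2] note D4 = conjunct2[OF D3]
  note D5 = conjunct2[OF D4] note D6 = conjunct2[OF D5]
  have num: "num v \<le> cnt" "num v \<noteq> 0 \<Longrightarrow> ord (num v) = v" if "v < n" for v
    using conjunct1[OF D1] that by simp_all
  have ord: "ord i < n" "num (ord i) = i" "par i < i" "low i = i" "par i \<noteq> 0 \<Longrightarrow> nbr (ord (par i)) (ord i)"
    if "1 \<le> i" "i \<le> cnt" for i
    using conjunct1[OF D2] that by simp_all
  have D: "a \<le> par i" if "1 \<le> a" "a < i" "i \<le> cnt" "u < n" "num u = 0 \<or> i \<le> num u" "nbr (ord a) u" for a i u
    using conjunct1[OF D3] that by blast
  have st: "sv j < n" "sp j \<le> cnt" "sp j \<noteq> 0 \<Longrightarrow> nbr (ord (sp j)) (sv j)" if "j < Suc sc" for j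
    using conjunct1[OF D4] that by simp_all
  have sorted: "sp j \<le> sp j'" if "j \<le> j'" "j' < Suc sc" for j j'
    using conjunct1[OF D5] that by blast
  have F0: "\<exists>j<Suc sc. sv j = u \<and> sp j = 0" if "u < n" "num u = 0" for u
    using D6 that by simp
  have F: "\<exists>j<Suc sc. sv j = u \<and> sp j = a" if "u < n" "num u = 0" "1 \<le> a" "a \<le> cnt" "nbr (ord a) u" for u a
    using D6 that by simp
  have xn: "x < n" and pc: "p \<le> cnt" and pn: "p \<noteq> 0 \<Longrightarrow> nbr (ord p) x"
    using st[of sc] x p by auto
  have "x \<noteq> ord i" if "1 \<le> i" "i \<le> cnt" for i using ord(2)[OF that] v x that by auto
  note ordx = this
  have new: "sv' j = tgt (st x + (j - sc)) \<and> sp' j = Suc cnt" if "sc \<le> j" "j < ?sc" for j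
    using push[of "j - sc"] that by auto
  have newnbr: "nbr x (sv' j)" "sv' j < n" if "sc \<le> j" "j < ?sc" for j
  proof -
    have "st x + (j - sc) < st (Suc x)" using that by linarith
    then show "nbr x (sv' j)" "sv' j < n" using new[OF that] tgt_lt[OF xn] nbrI[of x "st x + (j - sc)"] by auto
  qed
  have 1: "?num v \<le> Suc cnt \<and> (?num v \<noteq> 0 \<longrightarrow> ?ord (?num v) = v)" if "v < n" for v
    using num[OF that] by auto
  have 2: "?ord i < n \<and> ?num (?ord i) = i \<and> ?par i < i \<and> (low(Suc cnt := Suc cnt)) i = i \<and>
      (?par i \<noteq> 0 \<longrightarrow> nbr (?ord (?par i)) (?ord i))" if "1 \<le> i" "i \<le> Suc cnt" for i
  proof (cases "i = Suc cnt")
    case True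
    then show ?thesis using xn pc pn by auto
  next
    case False
    then have i: "i \<le> cnt" using that by simp
    show ?thesis using ord[OF that(1) i] ordx[OF that(1) i] i by auto
  qed
  \<comment> \<open>For the new number: a vertex that was unvisited so far and is a neighbour of
    \<open>ord a\<close> has an entry stamped \<open>a\<close>, and the popped stamp
    \<open>p\<close> is the largest on the stack.\<close>
  have 3: "a \<le> ?par i" if h: "1 \<le> a" "a < i" "i \<le> Suc cnt" "u < n" "?num u = 0 \<or> i \<le> ?num u" "nbr (?ord a) u" for a i u
  proof (cases "i = Suc cnt")
    case True
    then have a: "a \<le> cnt" "nbr (ord a) u" using h by auto
    have "num u = 0" using h(5) True num(1)[OF h(4)] v x by (auto split: if_splits)
    then obtain j where "j < Suc sc" "sp j = a" using F[OF h(4) _ h(1) a] by blast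
    then show ?thesis using sorted[of j sc] True p by auto
  next
    case False
    then have "num u = 0 \<or> i \<le> num u" using h v x by (auto split: if_splits)
    then show ?thesis using D[of a i u] h False by auto
  qed
  have 4: "sv' j < n \<and> sp' j \<le> Suc cnt \<and> (sp' j \<noteq> 0 \<longrightarrow> nbr (?ord (sp' j)) (sv' j))" if "j < ?sc" for j
  proof (cases "j < sc")
    case True
    then show ?thesis using keep[OF True] st[of j] by auto
  next
    case False
    then show ?thesis using new[of j] newnbr[of j] that by auto
  qed
  have 5: "sp' j \<le> sp' j'" if "j \<le> j'" "j' < ?sc" for j j'
  proof (cases "j' < sc")
    case True
    then show ?thesis using keep[of j] keep[of j'] sorted[of j j'] that by auto
  next
    case False
    then have "sp' j' = Suc cnt" using new that by auto
    then show ?thesis using 4[of j] that by auto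
  qed
  have old: "\<exists>j<?sc. sv' j = u \<and> sp' j = a" if h: "\<exists>j<Suc sc. sv j = u \<and> sp j = a" "u \<noteq> x" for u a
  proof -
    obtain j where j: "j < Suc sc" "sv j = u" "sp j = a" using h by blast
    then have "j < sc" using h(2) x by (cases "j = sc") auto
    then show ?thesis using keep[of j] j by (intro exI[of _ j]) auto
  qed
  have 6: "(\<exists>j<?sc. sv' j = u \<and> sp' j = 0) \<and>
       (\<forall>a. 1 \<le> a \<and> a \<le> Suc cnt \<and> nbr (?ord a) u \<longrightarrow> (\<exists>j<?sc. sv' j = u \<and> sp' j = a))"
    if u: "u < n" "?num u = 0" for u
  proof (intro conjI allI impI)
    have u': "num u = 0" "u \<noteq> x" using u by (auto split: if_splits)
    show "\<exists>j<?sc. sv' j = u \<and> sp' j = 0" using old F0 u u' by blast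
    fix a assume a: "1 \<le> a \<and> a \<le> Suc cnt \<and> nbr (?ord a) u"
    show "\<exists>j<?sc. sv' j = u \<and> sp' j = a"
    proof (cases "a = Suc cnt")
      case True
      then obtain k where k: "st x \<le> k" "k < st (Suc x)" "tgt k = u" using a by (auto simp: nbr_def)
      have "k - st x < st (Suc x) - st x" using k by linarith
      then show ?thesis using push[of "k - st x"] k True by (intro exI[of _ "sc + (k - st x)"]) auto
    next
      case False
      then have "nbr (ord a) u" "a \<le> cnt" "1 \<le> a" using a by auto
      then show ?thesis using old F[OF u(1) u'(1)] u' by blast
    qed
  qed
  show ?thesis unfolding dfs_inv_def using 1 2 3 4 5 6 by blast
qed

lemma wp_push_nbrs:
  assumes M: "M IN = A"
  shows "wp push_nbrs M (60 * (M xE 0 - M xK 0) + 10) (\<lambda>M' _.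
    M' xSC 0 = M xSC 0 + (M xE 0 - M xK 0) \<and>
    (\<forall>j<M xSC 0. M' SV j = M SV j \<and> M' SP j = M SP j) \<and>
    (\<forall>d<M xE 0 - M xK 0. M' SV (M xSC 0 + d) = tgt (M xK 0 + d) \<and> M' SP (M xSC 0 + d) = M xCNT 0) \<and>
    (\<forall>a. a \<notin> {SV, SP, xSC, xK} \<longrightarrow> M' a = M a))"
  unfolding push_nbrs_def
proof (rule wp_While[where I = "\<lambda>M' c. M xK 0 \<le> M' xK 0 \<and> M' xK 0 - M xK 0 \<le> M xE 0 - M xK 0 \<and>
    M' xSC 0 = M xSC 0 + (M' xK 0 - M xK 0) \<and>
    (\<forall>j<M xSC 0. M' SV j = M SV j \<and> M' SP j = M SP j) \<and>
    (\<forall>d<M' xK 0 - M xK 0. M' SV (M xSC 0 + d) = tgt (M xK 0 + d) \<and> M' SP (M xSC 0 + d) = M xCNT 0) \<and>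
    (\<forall>a. a \<notin> {SV, SP, xSC, xK} \<longrightarrow> M' a = M a) \<and> 60 * (M xE 0 - M' xK 0) + 10 \<le> c"], goal_cases)
  case 1
  show ?case by simp
next
  case (2 M' c)
  then show ?case by simp
next
  case (3 M' c)
  then have fr: "M' xE = M xE" "M' IN = A" "M' xCNT = M xCNT" using M by simp_all
  have lt: "M' xK 0 < M xE 0" using 3(2) fr by simp
  then have c: "c \<ge> 60 + 60 * (M xE 0 - Suc (M' xK 0)) + 10" using 3(1) by linarith
  define k where "k = M' xK 0 - M xK 0"
  have K: "M' xK 0 = M xK 0 + k" "M' xSC 0 = M xSC 0 + k" using 3(1) k_def by auto
  show ?case
    apply (intro wp_Seq wp_Set)
    using c 3(1) lt by (auto simp: fr K eTgt_val[unfolded add.assoc] eTgt_val A0 less_Suc_eq)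
next
  case (4 M' c)
  then have "M' xE = M xE" by simp
  then show ?case using 4 by (auto simp: le_antisym)
qed

end

definition dfs_loop :: com where
  "dfs_loop = While (V xSC) (
     xSC ::= Minus (V xSC) (Const 1) ;;
     xX ::= Get SV (V xSC) ;;
     If (Get NUM (V xX)) Skip (
       Inc xCNT ;;
       Set NUM (V xX) (V xCNT) ;;
       Set ORD (V xCNT) (V xX) ;;
       Set PAR (V xCNT) (Get SP (V xSC)) ;;
       Set LOW (V xCNT) (V xCNT) ;;
       xK ::= eFrom (V xX) ;;
       xE ::= eTo (V xX) ;;
       push_nbrs))"

text \<open>\<open>SP\<close> is still zero, so these entries carry stamp 0. A vertex first reached
  through one of them becomes a root, which takes care of disconnected graphs.\<close>

definition push_all :: com where
  "push_all = While (Minus eN (V xX)) (Set SV (V xX) (V xX) ;; Inc xX)"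

definition dfs :: com where
  "dfs = (push_all ;; xSC ::= eN ;; dfs_loop)"

definition min_loop :: com where
  "min_loop = While (Minus (V xE) (V xK)) (
     Set LOW (V xJ) (Minus (Get LOW (V xJ)) (Minus (Get LOW (V xJ)) (Get NUM (eTgt (V xK))))) ;;
     Inc xK)"

text \<open>Children have larger numbers than their parents, so running downwards finishes them
  first. At a root the update of the parent goes to cell 0, which belongs to no vertex.\<close>

definition low_loop :: com where
  "low_loop = While (V xJ) (
     xX ::= Get ORD (V xJ) ;;
     xK ::= eFrom (V xX) ;;
     xE ::= eTo (V xX) ;;
     min_loop ;;
     xP ::= Get PAR (V xJ) ;;
     Set LOW (V xP) (Minus (Get LOW (V xP)) (Minus (Get LOW (V xP)) (Get LOW (V xJ)))) ;;
     xJ ::= Minus (V xJ) (Const 1))"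

text \<open>Running upwards, the head of the parent is already known; the test succeeds exactly if
  the low value is below the parent. The machine cannot multiply, so \<open>xACC\<close> steps
  through the multiples of \<open>n + 1\<close>.\<close>

definition block_loop :: com where
  "block_loop = While (Minus eN (V xJ)) (
     Inc xJ ;;
     xACC ::= Plus (V xACC) (Plus eN (Const 1)) ;;
     Set BS (V xJ) (V xACC) ;;
     xP ::= Get PAR (V xJ) ;;
     If (Minus (V xP) (Get LOW (V xJ))) (xX ::= Get HD (V xP)) (xX ::= V xJ) ;;
     Set HD (V xJ) (V xX) ;;
     Set LOC (V xJ) (Get SZ (V xX)) ;;
     Set MB (Plus (Get BS (V xX)) (Get SZ (V xX))) (V xJ) ;;
     Set SZ (V xX) (Plus (Get SZ (V xX)) (Const 1)))"

lemma wp_push_all: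
  assumes "M 0 0 = n" "M xX 0 = 0"
  shows "wp push_all M (40 * n + 10) (\<lambda>M' _. (\<forall>v<n. M' SV v = v) \<and> (\<forall>a. a \<notin> {SV, xX} \<longrightarrow> M' a = M a))"
  unfolding push_all_def
proof (rule wp_While[where I = "\<lambda>M' c. M' xX 0 \<le> n \<and> (\<forall>v<M' xX 0. M' SV v = v) \<and>
    (\<forall>a. a \<notin> {SV, xX} \<longrightarrow> M' a = M a) \<and> 40 * (n - M' xX 0) + 10 \<le> c"], goal_cases)
  case (3 M' c)
  then have lt: "M' xX 0 < n" using assms by simp
  then have "c \<ge> 40 + 40 * (n - Suc (M' xX 0)) + 10" using 3(1) by linarith
  then show ?case using 3(1) lt by (intro wp_Seq wp_Set) (auto simp: less_Suc_eq)
qed (use assms in auto)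

section \<open>Cost and correctness of the search\<close>

context input begin

text \<open>The number of entries that can still be pushed, as a vertex pushes its list only when it
  is visited. It is the potential that pays for the search.\<close>

definition unvisited_deg :: "(nat \<Rightarrow> nat) \<Rightarrow> nat" where
  "unvisited_deg num = (\<Sum>v | v < n \<and> num v = 0. st (Suc v) - st v)"

lemma unvisited_deg_upd:
  assumes "x < n" "num x = 0"
  shows "unvisited_deg num = (st (Suc x) - st x) + unvisited_deg (num(x := Suc c))"
proof -
  have "{v. v < n \<and> num v = 0} = insert x {v. v < n \<and> (num(x := Suc c)) v = 0}" using assms by auto
  then show ?thesis unfolding unvisited_deg_def by (subst sum.insert[symmetric]) auto
qed

text \<open>Every stack entry holds 120 credits, enough for popping it and for the constant part of
  a visit. Every list entry of an unvisited vertex holds 200, of which 60 pay for pushing it and 120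
  stay with it on the stack.\<close>

lemma wp_dfs_loop:
  assumes M: "M IN = A"
    and inv: "dfs_inv (M NUM) (M ORD) (M PAR) (M LOW) (M SV) (M SP) (M xCNT 0) (M xSC 0)"
  shows "wp dfs_loop M (120 * M xSC 0 + 200 * unvisited_deg (M NUM) + 10)
    (\<lambda>M' _. dfs_inv (M' NUM) (M' ORD) (M' PAR) (M' LOW) (M' SV) (M' SP) (M' xCNT 0) 0 \<and>
      (\<forall>a. a \<notin> {NUM, ORD, PAR, LOW, SV, SP, xSC, xCNT, xX, xK, xE} \<longrightarrow> M' a = M a))"
  unfolding dfs_loop_def
proof (rule wp_While[where I = "\<lambda>M' c.
    dfs_inv (M' NUM) (M' ORD) (M' PAR) (M' LOW) (M' SV) (M' SP) (M' xCNT 0) (M' xSC 0) \<and>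
    (\<forall>a. a \<notin> {NUM, ORD, PAR, LOW, SV, SP, xSC, xCNT, xX, xK, xE} \<longrightarrow> M' a = M a) \<and>
    120 * M' xSC 0 + 200 * unvisited_deg (M' NUM) + 10 \<le> c"], goal_cases)
  case 1
  then show ?case using inv by simp
next
  case (2 M' c)
  then show ?case by simp
next
  case (3 M' c)
  then obtain sc where sc: "M' xSC 0 = Suc sc" using not0_implies_Suc by auto
  have A: "M' IN = A" using 3 M by simp
  let ?U = "unvisited_deg (M' NUM)"
  have I: "dfs_inv (M' NUM) (M' ORD) (M' PAR) (M' LOW) (M' SV) (M' SP) (M' xCNT 0) (Suc sc)"
    and c: "120 * sc + 120 + 200 * ?U + 10 \<le> c"
    and fr: "\<And>a. a \<notin> {NUM, ORD, PAR, LOW, SV, SP, xSC, xCNT, xX, xK, xE} \<Longrightarrow> M' a = M a"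
    using 3 sc by auto
  define x where "x = M' SV sc"
  have xn: "x < n" using conjunct1[OF conjunct2[OF conjunct2[OF conjunct2[OF I[unfolded dfs_inv_def]]]]]
    by (auto simp: x_def)
  show ?case
  proof (cases "M' NUM x = 0")
    case False
    have "dfs_inv (M' NUM) (M' ORD) (M' PAR) (M' LOW) (M' SV) (M' SP) (M' xCNT 0) sc"
      using dfs_inv_pop[OF I] False unfolding x_def by simp
    then show ?thesis
      using sc c
      apply -
      apply (rule wp_Set_Seq, simp, simp cong: wp_cong)+
      apply (rule wp_If, simp)
       apply (rule wp_Skip, simp)
       apply (use fr in simp)
      using False apply (simp add: x_def)
      done
  next
    case True
    have U: "?U = (st (Suc x) - st x) + unvisited_deg ((M' NUM)(x := Suc (M' xCNT 0)))"
      by (rule unvisited_deg_upd) (use xn True in auto)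
    note visit = dfs_inv_visit[OF I, folded x_def, OF True refl refl]
    show ?thesis
      using sc c U
      apply -
      apply (rule wp_Set_Seq, simp, simp add: x_def[symmetric] True cong: wp_cong)+
      apply (rule wp_If, simp)
       apply (simp add: True)
      apply (rule wp_Set_Seq, simp, simp add: x_def[symmetric] True A eFrom_val eTo_val cong: wp_cong)+
      apply (rule wp_call[OF wp_push_nbrs])
        apply (simp add: A)
       apply simp
      subgoal premises p for M'' c'
      proof -
        have "M'' NUM = (M' NUM)(x := Suc (M' xCNT 0))" "M'' ORD = (M' ORD)(Suc (M' xCNT 0) := x)"
          "M'' PAR = (M' PAR)(Suc (M' xCNT 0) := M' SP sc)"
          "M'' LOW = (M' LOW)(Suc (M' xCNT 0) := Suc (M' xCNT 0))"
          "M'' xCNT 0 = Suc (M' xCNT 0)" "M'' xSC 0 = sc + (st (Suc x) - st x)"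
          using p(4) by (simp_all add: fun_eq_iff)
        moreover have "M'' a = M a" if "a \<notin> {NUM, ORD, PAR, LOW, SV, SP, xSC, xCNT, xX, xK, xE}" for a
          using p(4) that fr[of a] by simp
        moreover have "dfs_inv ((M' NUM)(x := Suc (M' xCNT 0))) ((M' ORD)(Suc (M' xCNT 0) := x))
          ((M' PAR)(Suc (M' xCNT 0) := M' SP sc)) ((M' LOW)(Suc (M' xCNT 0) := Suc (M' xCNT 0)))
          (M'' SV) (M'' SP) (Suc (M' xCNT 0)) (sc + (st (Suc x) - st x))"
          by (rule visit) (use p in simp_all)
        moreover have "120 * (sc + (st (Suc x) - st x)) +
            200 * unvisited_deg ((M' NUM)(x := Suc (M' xCNT 0))) + 10 \<le> c'"
          using p(1-3,5) by simp
        ultimately show ?thesis by simp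
      qed
      done
  qed
next
  case (4 M' c)
  then show ?case by simp
qed

definition dfs_done :: "(nat \<Rightarrow> nat) \<Rightarrow> (nat \<Rightarrow> nat) \<Rightarrow> (nat \<Rightarrow> nat) \<Rightarrow> bool" where
  "dfs_done num ord par \<longleftrightarrow>
    (\<forall>v<n. 1 \<le> num v \<and> num v \<le> n \<and> ord (num v) = v) \<and>
    (\<forall>i. 1 \<le> i \<and> i \<le> n \<longrightarrow> ord i < n \<and> num (ord i) = i \<and> par i < i \<and> (par i \<noteq> 0 \<longrightarrow> nbr (ord (par i)) (ord i))) \<and>
    (\<forall>a i u. 1 \<le> a \<and> a < i \<and> i \<le> u \<and> u \<le> n \<and> nbr (ord a) (ord u) \<longrightarrow> a \<le> par i)"

lemma dfs_done_num: "dfs_done num ord par \<Longrightarrow> v < n \<Longrightarrow> 1 \<le> num v \<and> num v \<le> n \<and> ord (num v) = v"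
  by (simp add: dfs_done_def)

lemma dfs_done_ord: "dfs_done num ord par \<Longrightarrow> 1 \<le> i \<Longrightarrow> i \<le> n \<Longrightarrow>
   ord i < n \<and> num (ord i) = i \<and> par i < i \<and> (par i \<noteq> 0 \<longrightarrow> nbr (ord (par i)) (ord i))"
  by (simp add: dfs_done_def)

text \<open>An unvisited vertex would still have an entry, but the stack is empty. So all vertices
  are numbered, and as \<open>num\<close> and \<open>ord\<close> are inverse to each other,
  \<open>cnt\<close> equals \<open>n\<close>.\<close>

lemma dfs_inv_done:
  assumes I: "dfs_inv num ord par low sv sp cnt 0"
  shows "dfs_done num ord par \<and> (\<forall>i. 1 \<le> i \<and> i \<le> n \<longrightarrow> low i = i)"
proof -
  note D1 = I[unfolded dfs_inv_def]
  note D2 = conjunct2[OF D1] note D3 = conjunct2[OF D2] note D4 = conjunct2[OF D3]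
  note D5 = conjunct2[OF D4] note D6 = conjunct2[OF D5]
  have ne: "num v \<noteq> 0" if "v < n" for v using D6 that by auto
  have num: "1 \<le> num v" "num v \<le> cnt" "ord (num v) = v" if "v < n" for v
    using conjunct1[OF D1] ne[OF that] that by auto
  have ord: "ord i < n" "num (ord i) = i" "par i < i" "low i = i" "par i \<noteq> 0 \<Longrightarrow> nbr (ord (par i)) (ord i)"
    if "1 \<le> i" "i \<le> cnt" for i
    using conjunct1[OF D2] that by simp_all
  have D: "a \<le> par i" if "1 \<le> a" "a < i" "i \<le> cnt" "u < n" "i \<le> num u" "nbr (ord a) u" for a i u
    using conjunct1[OF D3] that by blast
  have "bij_betw num {..<n} {1..cnt}"
    by (rule bij_betw_byWitness[where f' = ord]) (use num ord in auto)
  then have cnt: "cnt = n" using bij_betw_same_card by fastforce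
  have "a \<le> par i" if "1 \<le> a \<and> a < i \<and> i \<le> u \<and> u \<le> n \<and> nbr (ord a) (ord u)" for a i u
    using D[of a i "ord u"] ord[of u] that cnt by auto
  then show ?thesis unfolding dfs_done_def using num ord cnt by auto
qed

lemma wp_dfs:
  assumes M: "M IN = A" and z: "\<And>a i. a \<noteq> 0 \<Longrightarrow> M a i = 0"
  shows "wp dfs M (160 * n + 200 * st n + 40)
    (\<lambda>M' _. dfs_done (M' NUM) (M' ORD) (M' PAR) \<and> (\<forall>i. 1 \<le> i \<and> i \<le> n \<longrightarrow> M' LOW i = i) \<and>
      (\<forall>a. a \<notin> {NUM, ORD, PAR, LOW, SV, SP, xSC, xCNT, xX, xK, xE} \<longrightarrow> M' a = M a))"
  unfolding dfs_def
  apply (rule wp_Seq)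
  apply (rule wp_call[OF wp_push_all])
     apply (use M A0 in simp)
    apply (use z in simp)
   apply simp
  subgoal premises p for M1 c1
  proof -
    note p = p(1,2)
    have fr: "M1 a = M a" if "a \<notin> {SV, xX}" for a using p that by simp
    have M1: "M1 IN = A" "A 0 = n" "M1 NUM = (\<lambda>_. 0)" "M1 xCNT = (\<lambda>_. 0)" "M1 SP = (\<lambda>_. 0)"
      using fr M A0 z by auto
    have U: "unvisited_deg (\<lambda>_. 0) = st n"
      using sum_deg[of n] by (simp add: unvisited_deg_def lessThan_def)
    have inv: "dfs_inv (M1 NUM) (M1 ORD) (M1 PAR) (M1 LOW) (M1 SV) (M1 SP) (M1 xCNT 0) n"
      unfolding dfs_inv_def using p by (auto simp: M1)
    show ?thesis
      using p(2)
      apply -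
      apply (rule wp_Set_Seq, simp, simp add: M1 cong: wp_cong)
      apply (rule wp_call[OF wp_dfs_loop])
         apply (simp add: M1)
        apply (use inv in simp)
       apply (simp add: M1 U)
      subgoal premises q for M2 c2
        using dfs_inv_done[OF conjunct1[OF q(2)]] q(2) fr by (simp add: M1)
      done
  qed
  done

section \<open>Computation of the low values\<close>

definition deg_upto :: "(nat \<Rightarrow> nat) \<Rightarrow> nat \<Rightarrow> nat" where
  "deg_upto ord j = (\<Sum>i\<in>{1..j}. st (Suc (ord i)) - st (ord i))"

lemma deg_upto_Suc: "deg_upto ord (Suc j) = deg_upto ord j + (st (Suc (ord (Suc j))) - st (ord (Suc j)))"
  by (simp add: deg_upto_def)

lemma deg_upto_n:
  assumes "dfs_done num ord par"
  shows "deg_upto ord n = st n"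
proof -
  have "bij_betw ord {1..n} {..<n}"
    by (rule bij_betw_byWitness[where f' = num])
      (use dfs_done_num[OF assms] dfs_done_ord[OF assms] in auto)
  then show ?thesis
    using sum.reindex_bij_betw[of ord "{1..n}" "{..<n}" "\<lambda>v. st (Suc v) - st v"] sum_deg[of n]
    by (simp add: deg_upto_def)
qed

lemma min_le_iff: "(a::nat) - (a - b) \<le> c \<longleftrightarrow> a \<le> c \<or> b \<le> c"
  by auto

lemma wp_min_loop:
  assumes M: "M IN = A"
  shows "wp min_loop M (60 * (M xE 0 - M xK 0) + 10) (\<lambda>M' _.
    (\<forall>i. i \<noteq> M xJ 0 \<longrightarrow> M' LOW i = M LOW i) \<and>
    (\<forall>b. M' LOW (M xJ 0) \<le> b \<longleftrightarrow> M LOW (M xJ 0) \<le> b \<or> (\<exists>k. M xK 0 \<le> k \<and> k < M xE 0 \<and> M NUM (tgt k) \<le> b)) \<and>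
    (\<forall>a. a \<notin> {LOW, xK} \<longrightarrow> M' a = M a))"
  unfolding min_loop_def
proof (rule wp_While[where I = "\<lambda>M' c. M xK 0 \<le> M' xK 0 \<and>
    (\<forall>i. i \<noteq> M xJ 0 \<longrightarrow> M' LOW i = M LOW i) \<and>
    (\<forall>b. M' LOW (M xJ 0) \<le> b \<longleftrightarrow> M LOW (M xJ 0) \<le> b \<or> (\<exists>k. M xK 0 \<le> k \<and> k < M' xK 0 \<and> M NUM (tgt k) \<le> b)) \<and>
    (M' xK 0 \<le> M xE 0 \<or> M' xK 0 = M xK 0) \<and>
    (\<forall>a. a \<notin> {LOW, xK} \<longrightarrow> M' a = M a) \<and> 60 * (M xE 0 - M' xK 0) + 10 \<le> c"], goal_cases)
  case 1
  show ?case by auto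
next
  case (2 M' c)
  then show ?case by simp
next
  case (3 M' c)
  then have fr: "M' xE = M xE" "M' IN = A" "M' NUM = M NUM" "M' xJ = M xJ" using M by simp_all
  have lt: "M' xK 0 < M xE 0" using 3(2) fr by simp
  then have c: "c \<ge> 60 + 60 * (M xE 0 - Suc (M' xK 0)) + 10" using 3(1) by linarith
  have ex: "(\<exists>k. M xK 0 \<le> k \<and> k < Suc (M' xK 0) \<and> P k) \<longleftrightarrow> (\<exists>k. M xK 0 \<le> k \<and> k < M' xK 0 \<and> P k) \<or> P (M' xK 0)" for P
    using 3(1) by (auto simp: less_Suc_eq)
  have low: "M' LOW (M xJ 0) \<le> b \<longleftrightarrow> M LOW (M xJ 0) \<le> b \<or> (\<exists>k. M xK 0 \<le> k \<and> k < M' xK 0 \<and> M NUM (tgt k) \<le> b)" for b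
    using 3(1) by blast
  show ?case
    using c
    apply -
    apply (rule wp_Set_Seq, simp, simp add: fr eTgt_val A0 cong: wp_cong)
    apply (rule wp_Set, simp)
    using 3(1) lt by (auto simp: ex min_le_iff low fr)
next
  case (4 M' c)
  then have "M' xE = M xE" by simp
  with 4 have "M xE 0 \<le> M' xK 0" "M' xK 0 \<le> M xE 0 \<or> M' xK 0 = M xK 0" by auto
  then have "k < M' xK 0 \<longleftrightarrow> k < M xE 0" if "M xK 0 \<le> k" for k using that by linarith
  then show ?case using 4 by (simp add: conj_commute cong: conj_cong)
qed

text \<open>Specifying a minimum by the bounds \<open>b\<close> above it makes updates by \<open>min\<close>, computed as
  \<open>a - (a - b)\<close> with truncated subtraction, into disjunctions.\<close>
definition low_inv :: "(nat \<Rightarrow> nat) \<Rightarrow> (nat \<Rightarrow> nat) \<Rightarrow> (nat \<Rightarrow> nat) \<Rightarrow> (nat \<Rightarrow> nat) \<Rightarrow> nat \<Rightarrow> bool" where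
  "low_inv num ord par low j \<longleftrightarrow> (\<forall>i b. 1 \<le> i \<and> i \<le> n \<longrightarrow>
     (low i \<le> b \<longleftrightarrow> i \<le> b \<or> (j < i \<and> (\<exists>u. nbr (ord i) u \<and> num u \<le> b)) \<or>
        (\<exists>c. j < c \<and> c \<le> n \<and> par c = i \<and> low c \<le> b)))"

text \<open>Number \<open>Suc j\<close> has received the values of all its children, so including
  its own neighbours makes its entry \<open>x\<close> final. The only other change is at its parent,
  which has a smaller number, so no finished entry is touched.\<close>

lemma low_inv_step:
  assumes I: "low_inv num ord par low (Suc j)" and j: "Suc j \<le> n"
    and x: "\<And>b. x \<le> b \<longleftrightarrow> low (Suc j) \<le> b \<or> (\<exists>u. nbr (ord (Suc j)) u \<and> num u \<le> b)"
    and par: "\<And>i. 1 \<le> i \<Longrightarrow> i \<le> n \<Longrightarrow> par i < i"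
    and low': "low' (Suc j) = x" "low' (par (Suc j)) = low (par (Suc j)) - (low (par (Suc j)) - x)"
       "\<And>i. i \<noteq> Suc j \<Longrightarrow> i \<noteq> par (Suc j) \<Longrightarrow> low' i = low i"
  shows "low_inv num ord par low' j"
  unfolding low_inv_def
proof (intro allI impI)
  fix i b assume i: "1 \<le> i \<and> i \<le> n"
  have same: "low' c = low c" if "Suc j < c" for c using low'(3)[of c] that par[of "Suc j"] j by auto
  have ex: "(\<exists>c. j < c \<and> c \<le> n \<and> par c = i \<and> low' c \<le> b) \<longleftrightarrow>
      (\<exists>c. Suc j < c \<and> c \<le> n \<and> par c = i \<and> low c \<le> b) \<or> (par (Suc j) = i \<and> x \<le> b)"
    (is "?L \<longleftrightarrow> ?R")
  proof
    assume ?L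
    then obtain c where c: "j < c" "c \<le> n" "par c = i" "low' c \<le> b" by blast
    show ?R
    proof (cases "c = Suc j")
      case True then show ?thesis using c low'(1) by simp
    next
      case False
      then have "Suc j < c" using c by simp
      then show ?thesis using c same by metis
    qed
  next
    assume ?R
    then show ?L
    proof
      assume "\<exists>c. Suc j < c \<and> c \<le> n \<and> par c = i \<and> low c \<le> b"
      then obtain c where "Suc j < c \<and> c \<le> n \<and> par c = i \<and> low c \<le> b" by blast
      then show ?L using same[of c] by (intro exI[of _ c]) simp
    next
      assume "par (Suc j) = i \<and> x \<le> b"
      then show ?L using low'(1) j by (intro exI[of _ "Suc j"]) simp
    qed
  qed
  have old: "low i \<le> b \<longleftrightarrow> i \<le> b \<or> (Suc j < i \<and> (\<exists>u. nbr (ord i) u \<and> num u \<le> b)) \<or>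
        (\<exists>c. Suc j < c \<and> c \<le> n \<and> par c = i \<and> low c \<le> b)"
    using I i unfolding low_inv_def by blast
  have pj: "par (Suc j) < Suc j" using par j by simp
  have "low' i \<le> b \<longleftrightarrow> low i \<le> b \<or> (i = Suc j \<and> (\<exists>u. nbr (ord i) u \<and> num u \<le> b)) \<or> (par (Suc j) = i \<and> x \<le> b)"
  proof -
    consider "i = Suc j" | "i = par (Suc j)" | "i \<noteq> Suc j" "i \<noteq> par (Suc j)" by blast
    then show ?thesis
    proof cases
      case 1
      then show ?thesis using low'(1) x[of b] pj by auto
    next
      case 2
      then have "low' i \<le> b \<longleftrightarrow> low i \<le> b \<or> x \<le> b" using low'(2) min_le_iff by simp
      then show ?thesis using 2 pj by simp
    next
      case 3
      then show ?thesis using low'(3)[of i] by simp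
    qed
  qed
  then show "low' i \<le> b \<longleftrightarrow> i \<le> b \<or> (j < i \<and> (\<exists>u. nbr (ord i) u \<and> num u \<le> b)) \<or>
        (\<exists>c. j < c \<and> c \<le> n \<and> par c = i \<and> low' c \<le> b)"
    unfolding ex old using less_Suc_eq[of j i] Suc_lessI[of j i] by auto
qed

lemma wp_low_loop:
  assumes M: "M IN = A" and d: "dfs_done (M NUM) (M ORD) (M PAR)" and J: "M xJ 0 = n"
    and low: "\<And>i. 1 \<le> i \<Longrightarrow> i \<le> n \<Longrightarrow> M LOW i = i"
  shows "wp low_loop M (100 * n + 60 * st n + 20)
    (\<lambda>M' _. low_inv (M NUM) (M ORD) (M PAR) (M' LOW) 0 \<and> M' xJ 0 = 0 \<and>
      (\<forall>a. a \<notin> {LOW, xJ, xK, xE, xX, xP} \<longrightarrow> M' a = M a))"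
  unfolding low_loop_def
proof (rule wp_While[where I = "\<lambda>M' c. M' xJ 0 \<le> n \<and> low_inv (M NUM) (M ORD) (M PAR) (M' LOW) (M' xJ 0) \<and>
    (\<forall>a. a \<notin> {LOW, xJ, xK, xE, xX, xP} \<longrightarrow> M' a = M a) \<and>
    100 * M' xJ 0 + 60 * deg_upto (M ORD) (M' xJ 0) + 20 \<le> c"], goal_cases)
  case 1
  show ?case using J low deg_upto_n[OF d] by (auto simp: low_inv_def)
next
  case (2 M' c)
  then show ?case by simp
next
  case (3 M' c)
  then obtain j where j: "M' xJ 0 = Suc j" using not0_implies_Suc by auto
  have fr: "\<And>a. a \<notin> {LOW, xJ, xK, xE, xX, xP} \<Longrightarrow> M' a = M a"
    and I: "low_inv (M NUM) (M ORD) (M PAR) (M' LOW) (Suc j)" and jn: "Suc j \<le> n"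
    using 3(1) j by auto
  have fr': "M' IN = A" "M' NUM = M NUM" "M' ORD = M ORD" "M' PAR = M PAR" using fr M by auto
  define x where "x = M ORD (Suc j)"
  define p where "p = M PAR (Suc j)"
  have par: "M PAR i < i" if "1 \<le> i" "i \<le> n" for i using dfs_done_ord[OF d that] by simp
  then have pj: "p < Suc j" using jn by (simp add: p_def)
  have c: "100 * j + 100 + 60 * deg_upto (M ORD) j + 60 * (st (Suc x) - st x) + 20 \<le> c"
    using 3(1) by (simp add: j deg_upto_Suc x_def)
  show ?case
    using c
    apply -
    apply (rule wp_Set_Seq, simp, simp add: fr' j x_def[symmetric] eFrom_val eTo_val cong: wp_cong)+
    apply (rule wp_Seq)
    apply (rule wp_call[OF wp_min_loop])
      apply (simp add: fr')
     apply simp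
    subgoal premises q for M1 c1
    proof -
      have M1: "M1 xJ 0 = Suc j" "M1 PAR = M PAR" "M1 IN = A"
        "\<And>a. a \<notin> {LOW, xJ, xK, xE, xX, xP} \<Longrightarrow> M1 a = M a"
        using q(2) j fr M by simp_all
      have L1: "\<And>i. i \<noteq> Suc j \<Longrightarrow> M1 LOW i = M' LOW i" using q(2) j by simp
      have L2: "M1 LOW (Suc j) \<le> b \<longleftrightarrow> M' LOW (Suc j) \<le> b \<or> (\<exists>u. nbr x u \<and> M NUM u \<le> b)" for b
      proof -
        have "M1 LOW (Suc j) \<le> b \<longleftrightarrow> M' LOW (Suc j) \<le> b \<or> (\<exists>k. st x \<le> k \<and> k < st (Suc x) \<and> M NUM (tgt k) \<le> b)"
          using q(2) j fr' by simp
        then show ?thesis unfolding nbr_def by blast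
      qed
      have c1: "c1 \<ge> 100 * j + 60 * deg_upto (M ORD) j + 70" using q(1,3) by simp
      show ?thesis
        using c1
        apply -
        apply (rule wp_Set_Seq, simp, simp add: M1 p_def[symmetric] cong: wp_cong)+
        apply (rule wp_Set, simp)
        subgoal premises r
        proof -
          have "low_inv (M NUM) (M ORD) (M PAR) ((M1 LOW)(p := M1 LOW p - (M1 LOW p - M1 LOW (Suc j)))) j"
            by (rule low_inv_step[OF I jn, where x = "M1 LOW (Suc j)"])
              (use L2 L1 par pj in \<open>auto simp: x_def p_def\<close>)
          then show ?thesis using r M1 jn by simp
        qed
        done
    qed
    done
next
  case (4 M' c)
  then show ?case by simp
qed

end

section \<open>Block membership\<close>

definition members :: "(nat \<Rightarrow> nat) \<Rightarrow> nat \<Rightarrow> nat \<Rightarrow> nat list" where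
  "members h j w = filter (\<lambda>i. h i = w) [1..<Suc j]"

lemma members_upd: "members (h(Suc j := x)) (Suc j) w = members h j w @ (if x = w then [Suc j] else [])"
proof -
  have "filter (\<lambda>i. (h(Suc j := x)) i = w) [1..<Suc j] = filter (\<lambda>i. h i = w) [1..<Suc j]"
    by (rule filter_cong) auto
  then show ?thesis unfolding members_def by simp
qed

lemma length_members: "length (members h j w) \<le> j"
  unfolding members_def by (rule order_trans[OF length_filter_le]) simp

text \<open>The members of block \<open>w\<close> are stored from \<open>w * (n + 1)\<close> on: memory is unbounded, so no
  preceding pass has to compute the block sizes.\<close>
definition hd_spec :: "nat \<Rightarrow> (nat \<Rightarrow> nat) \<Rightarrow> (nat \<Rightarrow> nat) \<Rightarrow> mem \<Rightarrow> nat \<Rightarrow> bool" where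
  "hd_spec n par low M j \<longleftrightarrow>
    (\<forall>i. 1 \<le> i \<and> i \<le> j \<longrightarrow> M BS i = i * Suc n \<and> M HD i = (if low i < par i then M HD (par i) else i) \<and>
       1 \<le> M HD i \<and> M HD i \<le> i \<and> M LOC i = length (members (M HD) (i - 1) (M HD i))) \<and>
    (\<forall>w. M SZ w = length (members (M HD) j w) \<and> seg (M MB) (w * Suc n) (members (M HD) j w))"

lemma hd_specD:
  assumes "hd_spec n par low M j" "1 \<le> i" "i \<le> j"
  shows "M BS i = i * Suc n" "M HD i = (if low i < par i then M HD (par i) else i)"
    "1 \<le> M HD i" "M HD i \<le> i" "M LOC i = length (members (M HD) (i - 1) (M HD i))"
proof -
  have "M BS i = i * Suc n \<and> M HD i = (if low i < par i then M HD (par i) else i) \<and>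
      1 \<le> M HD i \<and> M HD i \<le> i \<and> M LOC i = length (members (M HD) (i - 1) (M HD i))"
    using assms unfolding hd_spec_def by blast
  then show "M BS i = i * Suc n" "M HD i = (if low i < par i then M HD (par i) else i)"
    "1 \<le> M HD i" "M HD i \<le> i" "M LOC i = length (members (M HD) (i - 1) (M HD i))"
    by blast+
qed

text \<open>The parent has a smaller number, so its head is final. The new number goes behind the
  members of block \<open>x\<close> found so far, hence its position is the old size of that
  block.\<close>

lemma hd_spec_step:
  assumes I: "hd_spec n par low M j" and j: "j < n" and par: "\<And>i. 1 \<le> i \<Longrightarrow> i \<le> n \<Longrightarrow> par i < i"
    and x: "x = (if low (Suc j) < par (Suc j) then M HD (par (Suc j)) else Suc j)"
    and M': "M' BS = (M BS)(Suc j := Suc j * Suc n)" "M' HD = (M HD)(Suc j := x)" "M' LOC = (M LOC)(Suc j := M SZ x)"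
      "M' SZ = (M SZ)(x := Suc (M SZ x))" "M' MB = (M MB)(x * Suc n + M SZ x := Suc j)"
  shows "hd_spec n par low M' (Suc j)"
proof -
  note a = hd_specD[OF I]
  have b: "M SZ w = length (members (M HD) j w)" "seg (M MB) (w * Suc n) (members (M HD) j w)" for w
    using conjunct2[OF I[unfolded hd_spec_def]] by simp_all
  have x1: "1 \<le> x" "x \<le> Suc j" using a(3,4)[of "par (Suc j)"] x par[of "Suc j"] j by (auto split: if_splits)
  have mem': "members (M' HD) (Suc j) w = members (M HD) j w @ (if x = w then [Suc j] else [])" for w
    unfolding M' by (rule members_upd)
  have memold: "members (M' HD) i w = members (M HD) i w" if "i \<le> j" for i w
    unfolding M' members_def by (rule filter_cong) (use that in auto)
  have "M' BS i = i * Suc n \<and> M' HD i = (if low i < par i then M' HD (par i) else i) \<and>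
       1 \<le> M' HD i \<and> M' HD i \<le> i \<and> M' LOC i = length (members (M' HD) (i - 1) (M' HD i))"
    if i: "1 \<le> i" "i \<le> Suc j" for i
  proof (cases "i = Suc j")
    case True
    have "M' HD (par (Suc j)) = M HD (par (Suc j))" using par[of "Suc j"] j by (simp add: M')
    then show ?thesis using True x x1 b(1)[of x] memold[of j] by (simp add: M')
  next
    case False
    then have ij: "i \<le> j" using i by simp
    have p: "M' HD (par i) = M HD (par i)" if "low i < par i"
    proof -
      have "par i \<noteq> Suc j" using par[of i] i ij j by simp
      then show ?thesis by (simp add: M')
    qed
    show ?thesis using a[OF i(1) ij] p memold[of "i - 1"] ij False by (simp add: M')
  qed
  moreover have "M' SZ w = length (members (M' HD) (Suc j) w) \<and> seg (M' MB) (w * Suc n) (members (M' HD) (Suc j) w)" for w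
  proof (cases "w = x")
    case True
    then show ?thesis using b[of x] unfolding mem' by (simp add: M' seg_snoc)
  next
    case False
    have len: "length (members (M HD) j u) \<le> n" for u using length_members[of "M HD" j u] j by simp
    \<comment> \<open>Each head owns a stretch of \<open>Suc n\<close> cells and has at most
      \<open>n\<close> members, so stretches do not interfere. The spare cell is where the top
      vertex will be put later.\<close>
    have "x * Suc n + M SZ x < w * Suc n \<or> w * Suc n + length (members (M HD) j w) \<le> x * Suc n + M SZ x"
    proof (cases "x < w")
      case True
      then have "Suc x * Suc n \<le> w * Suc n" by (intro mult_le_mono1) simp
      then show ?thesis using len[of x] b(1)[of x] by simp
    next
      case False
      then have "Suc w * Suc n \<le> x * Suc n" using \<open>w \<noteq> x\<close> by (intro mult_le_mono1) simp
      then show ?thesis using len[of w] by simp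
    qed
    then show ?thesis using b[of w] False unfolding mem' by (simp add: M' seg_upd_other)
  qed
  ultimately show ?thesis unfolding hd_spec_def by blast
qed

lemma wp_block_loop:
  assumes n: "M IN 0 = n" and J: "M xJ 0 = 0" and acc: "M xACC 0 = 0" and SZ: "\<And>w. M SZ w = 0"
    and par: "\<And>i. 1 \<le> i \<Longrightarrow> i \<le> n \<Longrightarrow> M PAR i < i"
  shows "wp block_loop M (100 * n + 20) (\<lambda>M' _. hd_spec n (M PAR) (M LOW) M' n \<and>
      (\<forall>a. a \<notin> {HD, LOC, SZ, BS, MB, xJ, xACC, xP, xX} \<longrightarrow> M' a = M a))"
  unfolding block_loop_def
proof (rule wp_While[where I = "\<lambda>M' c. M' xJ 0 \<le> n \<and> M' xACC 0 = M' xJ 0 * Suc n \<and>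
    hd_spec n (M PAR) (M LOW) M' (M' xJ 0) \<and>
    (\<forall>a. a \<notin> {HD, LOC, SZ, BS, MB, xJ, xACC, xP, xX} \<longrightarrow> M' a = M a) \<and>
    100 * (n - M' xJ 0) + 20 \<le> c"], goal_cases)
  case 1
  show ?case using J acc SZ by (simp add: hd_spec_def members_def)
next
  case (2 M' c)
  then show ?case by simp
next
  case (3 M' c)
  define j where "j = M' xJ 0"
  have fr: "\<And>a. a \<notin> {HD, LOC, SZ, BS, MB, xJ, xACC, xP, xX} \<Longrightarrow> M' a = M a"
    and I: "hd_spec n (M PAR) (M LOW) M' j" and acc': "M' xACC 0 = j * Suc n"
    using 3(1) j_def by auto
  have fr': "M' IN 0 = n" "M' LOW = M LOW" "M' PAR = M PAR" using fr n by auto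
  have jn: "j < n" using 3(2) fr' by (simp add: j_def)
  then have c: "100 * (n - Suc j) + 100 + 20 \<le> c" using 3(1) unfolding j_def by linarith
  have p: "M PAR (Suc j) < Suc j" using par jn by simp
  define x where "x = (if M LOW (Suc j) < M PAR (Suc j) then M' HD (M PAR (Suc j)) else Suc j)"
  have x1: "1 \<le> x \<and> x \<le> Suc j"
    using p hd_specD(3,4)[OF I, of "M PAR (Suc j)"] unfolding x_def by auto
  have bs: "((M' BS)(Suc j := Suc j * Suc n)) x = x * Suc n"
    using x1 hd_specD(1)[OF I, of x] by auto
  let ?rest = "Set HD (V xJ) (V xX) ;;
     Set LOC (V xJ) (Get SZ (V xX)) ;;
     Set MB (Plus (Get BS (V xX)) (Get SZ (V xX))) (V xJ) ;;
     Set SZ (V xX) (Plus (Get SZ (V xX)) (Const 1))"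
  have rest: "wp ?rest N d (\<lambda>M' c. M' xJ 0 \<le> n \<and> M' xACC 0 = M' xJ 0 * Suc n \<and>
    hd_spec n (M PAR) (M LOW) M' (M' xJ 0) \<and>
    (\<forall>a. a \<notin> {HD, LOC, SZ, BS, MB, xJ, xACC, xP, xX} \<longrightarrow> M' a = M a) \<and>
    100 * (n - M' xJ 0) + 20 \<le> c)"
    if N: "N xX 0 = x" "N xJ 0 = Suc j" "N xACC 0 = Suc j * Suc n" "N BS = (M' BS)(Suc j := Suc j * Suc n)"
      "\<And>a. a \<notin> {xX, xJ, xACC, BS, xP} \<Longrightarrow> N a = M' a" and d: "100 * (n - Suc j) + 20 + 50 \<le> d" for N d
  proof -
    have N': "N HD = M' HD" "N SZ = M' SZ" "N LOC = M' LOC" "N MB = M' MB" using N by auto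
    have bsN: "N BS x = x * Suc n" using bs N(4) by simp
    have "hd_spec n (M PAR) (M LOW) N' (Suc j)"
      if "N' BS = (M' BS)(Suc j := Suc j * Suc n)" "N' HD = (M' HD)(Suc j := x)" "N' LOC = (M' LOC)(Suc j := M' SZ x)"
      "N' SZ = (M' SZ)(x := Suc (M' SZ x))" "N' MB = (M' MB)(x * Suc n + M' SZ x := Suc j)" for N'
      using hd_spec_step[OF I jn par x_def that] .
    note step = this
    show ?thesis
      using d
      apply -
      apply (rule wp_Set_Seq, simp, simp add: N(1-3) N' bsN del: mult_Suc_right cong: wp_cong)+
      apply (rule wp_Set, simp)
      subgoal premises p
      proof -
        let ?N = "N(HD := (M' HD)(Suc j := x), LOC := (M' LOC)(Suc j := M' SZ x),
          MB := (M' MB)(x * Suc n + M' SZ x := Suc j), SZ := (M' SZ)(x := Suc (M' SZ x)))"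
        have "hd_spec n (M PAR) (M LOW) ?N (Suc j)" by (rule step) (simp_all add: N)
        moreover have "?N a = M a" if "a \<notin> {HD, LOC, SZ, BS, MB, xJ, xACC, xP, xX}" for a
          using that N(5)[of a] fr[of a] by simp
        ultimately show ?thesis using p jn by (simp add: N(1-3) N' bsN del: mult_Suc_right)
      qed
      done
  qed
  show ?case
    using c
    apply -
    apply (rule wp_Set_Seq, simp, simp add: fr' j_def[symmetric] acc' cong: wp_cong)+
    apply (rule wp_Seq)
    apply (rule wp_If)
    subgoal by simp
    subgoal by (rule wp_Set, simp, rule rest) (simp_all add: x_def fr' acc' j_def[symmetric] ac_simps)
    subgoal by (rule wp_Set, simp, rule rest) (simp_all add: x_def fr' acc' j_def[symmetric] ac_simps)
    done
next
  case (4 M' c)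
  then show ?case using n by auto
qed

definition analyse :: com where
  "analyse = (dfs ;; xJ ::= eN ;; low_loop ;; block_loop)"

section \<open>From low values to heads\<close>

context input begin

text \<open>This resolves the recursion over children into a statement on all descendants
  \<open>z\<close>. One direction is an induction on \<open>n - i\<close>, as children have larger
  numbers; the other follows the path from \<open>z\<close> up to \<open>i\<close>. The alternative
  \<open>z \<le> b\<close> stems from the initial value of an entry, its own number.\<close>

lemma low_char:
  assumes L: "low_inv num ord par low 0" and i: "1 \<le> i" "i \<le> n"
    and par: "\<And>i. 1 \<le> i \<Longrightarrow> i \<le> n \<Longrightarrow> par i < i"
  shows "low i \<le> b \<longleftrightarrow> (\<exists>z. (z, i) \<in> {(y, par y) |y. 1 \<le> y \<and> y \<le> n}\<^sup>* \<and> 1 \<le> z \<and> z \<le> n \<and>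
    (z \<le> b \<or> (\<exists>u. nbr (ord z) u \<and> num u \<le> b)))" (is "_ \<longleftrightarrow> (\<exists>z. (z, i) \<in> ?R\<^sup>* \<and> ?P z)")
proof
  have low: "low i \<le> b \<longleftrightarrow> i \<le> b \<or> (\<exists>u. nbr (ord i) u \<and> num u \<le> b) \<or> (\<exists>c. 0 < c \<and> c \<le> n \<and> par c = i \<and> low c \<le> b)"
    if "1 \<le> i" "i \<le> n" for i
    using L that unfolding low_inv_def by auto
  {
    assume "low i \<le> b"
    then show "\<exists>z. (z, i) \<in> ?R\<^sup>* \<and> ?P z"
      using i
    proof (induction "n - i" arbitrary: i rule: less_induct)
      case less
      from low[OF less.prems(2,3)] less.prems(1)
      consider "i \<le> b \<or> (\<exists>u. nbr (ord i) u \<and> num u \<le> b)" | c where "0 < c" "c \<le> n" "par c = i" "low c \<le> b"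
        by blast
      then show ?case
      proof cases
        case 1
        then have "(i, i) \<in> ?R\<^sup>* \<and> ?P i" using less.prems by simp
        then show ?thesis by (rule exI)
      next
        case 2
        then have c: "i < c" "1 \<le> c" using par[of c] by auto
        then have "n - c < n - i" using 2(2) by linarith
        from less.hyps[OF this 2(4) c(2) 2(2)] obtain z where "(z, c) \<in> ?R\<^sup>* \<and> ?P z" ..
        then have z: "(z, c) \<in> ?R\<^sup>*" "?P z" by (rule conjunct1) (use \<open>(z, c) \<in> ?R\<^sup>* \<and> ?P z\<close> in \<open>rule conjunct2\<close>)
        have "(c, i) \<in> ?R" using 2 by auto
        with z(1) have "(z, i) \<in> ?R\<^sup>*" by (rule rtrancl_into_rtrancl)
        then show ?thesis using z(2) by (intro exI[of _ z] conjI) simp_all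
      qed
    qed
  }
  assume "\<exists>z. (z, i) \<in> ?R\<^sup>* \<and> ?P z"
  then obtain z where z: "(z, i) \<in> ?R\<^sup>*" "?P z" by (elim exE conjE) simp
  from z(1) have "1 \<le> i \<longrightarrow> i \<le> n \<longrightarrow> low i \<le> b"
  proof (induction rule: rtrancl_induct)
    case base
    then show ?case using low[of z] z(2) by blast
  next
    case (step y x)
    then have y: "1 \<le> y" "y \<le> n" "x = par y" by auto
    then have "low y \<le> b" using step.IH by simp
    then show ?case using low[of x] y by auto
  qed
  then show "low i \<le> b" using i by simp
qed

definition analysed :: "mem \<Rightarrow> bool" where
  "analysed M \<longleftrightarrow> dfs_done (M NUM) (M ORD) (M PAR) \<and>
    (\<forall>i. 1 \<le> i \<and> i \<le> n \<longrightarrow> M HD i = (if \<exists>z a. (z, i) \<in> {(y, M PAR y) |y. 1 \<le> y \<and> y \<le> n}\<^sup>* \<and>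
        (1 \<le> z \<and> z \<le> n \<and> 1 \<le> a \<and> a \<le> n \<and> nbr (M ORD z) (M ORD a)) \<and> a < M PAR i then
      M HD (M PAR i) else i)) \<and>
    (\<forall>i. 1 \<le> i \<and> i \<le> n \<longrightarrow> M BS i = i * Suc n \<and> M LOC i = length (members (M HD) (i - 1) (M HD i))) \<and>
    (\<forall>w. M SZ w = length (members (M HD) n w) \<and> seg (M MB) (w * Suc n) (members (M HD) n w))"

lemma nbr_less: "nbr v u \<Longrightarrow> v < n \<Longrightarrow> u < n"
  unfolding nbr_def using tgt_lt by auto

text \<open>Comparing the low value with the parent decides whether \<open>i\<close> is joined:
  descendants of \<open>i\<close> have numbers at least \<open>i\<close>, above
  \<open>par i\<close>, so only an edge out of the subtree can make the value smaller than
  \<open>par i\<close>.\<close>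

lemma analysedI:
  assumes d: "dfs_done (M NUM) (M ORD) (M PAR)" and L: "low_inv (M NUM) (M ORD) (M PAR) low 0"
    and h: "hd_spec n (M PAR) low M n"
  shows "analysed M"
proof -
  have par: "M PAR i < i" if "1 \<le> i" "i \<le> n" for i using dfs_done_ord[OF d that] by simp
  have "low i < M PAR i \<longleftrightarrow> (\<exists>z a. (z, i) \<in> {(y, M PAR y) |y. 1 \<le> y \<and> y \<le> n}\<^sup>* \<and>
        (1 \<le> z \<and> z \<le> n \<and> 1 \<le> a \<and> a \<le> n \<and> nbr (M ORD z) (M ORD a)) \<and> a < M PAR i)" (is "_ \<longleftrightarrow> ?R")
    if i: "1 \<le> i" "i \<le> n" for i
  \<comment> \<open>With \<open>par i = Suc b\<close>, being less than \<open>par i\<close> means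
    being at most \<open>b\<close>, the form in which low values are specified.\<close>
  proof (cases "M PAR i")
    case 0
    then show ?thesis by simp
  next
    case (Suc b)
    have up: "i \<le> z" if "(z, i) \<in> {(y, M PAR y) |y. 1 \<le> y \<and> y \<le> n}\<^sup>*" for z i
      using that
    proof (induction rule: rtrancl_induct)
      case (step y x)
      then have "1 \<le> y" "y \<le> n" "x = M PAR y" by auto
      then show ?case using step.IH par[of y] by simp
    qed simp
    have "low i \<le> b \<longleftrightarrow> (\<exists>z. (z, i) \<in> {(y, M PAR y) |y. 1 \<le> y \<and> y \<le> n}\<^sup>* \<and> 1 \<le> z \<and> z \<le> n \<and>
      (z \<le> b \<or> (\<exists>u. nbr (M ORD z) u \<and> M NUM u \<le> b)))"
      by (rule low_char[OF L i par])
    also have "\<dots> \<longleftrightarrow> ?R"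
    proof
      assume "\<exists>z. (z, i) \<in> {(y, M PAR y) |y. 1 \<le> y \<and> y \<le> n}\<^sup>* \<and> 1 \<le> z \<and> z \<le> n \<and>
        (z \<le> b \<or> (\<exists>u. nbr (M ORD z) u \<and> M NUM u \<le> b))"
      then obtain z where z: "(z, i) \<in> {(y, M PAR y) |y. 1 \<le> y \<and> y \<le> n}\<^sup>*" "1 \<le> z" "z \<le> n"
        "z \<le> b \<or> (\<exists>u. nbr (M ORD z) u \<and> M NUM u \<le> b)" by (elim exE conjE) simp
      have "\<not> z \<le> b" using up[OF z(1)] par[OF i] Suc by simp
      then obtain u where u: "nbr (M ORD z) u" "M NUM u \<le> b" using z(4) by auto
      have "u < n" using nbr_less[OF u(1)] dfs_done_ord[OF d z(2,3)] by simp
      then have "1 \<le> M NUM u" "M NUM u \<le> n" "M ORD (M NUM u) = u" using dfs_done_num[OF d] by simp_all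
      then show ?R using z u Suc by (intro exI[of _ z] exI[of _ "M NUM u"]) simp
    next
      assume ?R
      then obtain z a where za: "(z, i) \<in> {(y, M PAR y) |y. 1 \<le> y \<and> y \<le> n}\<^sup>*" "1 \<le> z" "z \<le> n" "1 \<le> a" "a \<le> n"
        "nbr (M ORD z) (M ORD a)" "a < M PAR i" by (elim exE conjE) simp
      have "M NUM (M ORD a) = a" using dfs_done_ord[OF d za(4,5)] by simp
      then have "nbr (M ORD z) (M ORD a) \<and> M NUM (M ORD a) \<le> b" using za Suc by simp
      then show "\<exists>z. (z, i) \<in> {(y, M PAR y) |y. 1 \<le> y \<and> y \<le> n}\<^sup>* \<and> 1 \<le> z \<and> z \<le> n \<and>
        (z \<le> b \<or> (\<exists>u. nbr (M ORD z) u \<and> M NUM u \<le> b))"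
        using za by (intro exI[of _ z]) (simp, blast)
    qed
    finally show ?thesis using Suc by (simp add: less_Suc_eq_le)
  qed
  note joined = this
  show ?thesis
    unfolding analysed_def
  proof (intro conjI allI impI d)
    fix i assume i: "1 \<le> i \<and> i \<le> n"
    note S = hd_specD[OF h conjunct1[OF i] conjunct2[OF i]]
    show "M HD i = (if \<exists>z a. (z, i) \<in> {(y, M PAR y) |y. 1 \<le> y \<and> y \<le> n}\<^sup>* \<and>
        (1 \<le> z \<and> z \<le> n \<and> 1 \<le> a \<and> a \<le> n \<and> nbr (M ORD z) (M ORD a)) \<and> a < M PAR i then
      M HD (M PAR i) else i)"
      using S(2) unfolding joined[OF conjunct1[OF i] conjunct2[OF i]] .
    show "M BS i = i * Suc n" "M LOC i = length (members (M HD) (i - 1) (M HD i))" using S by blast+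
  next
    show "M SZ w = length (members (M HD) n w)" "seg (M MB) (w * Suc n) (members (M HD) n w)" for w
      using conjunct2[OF h[unfolded hd_spec_def]] by simp_all
  qed
qed

lemma wp_analyse:
  assumes M: "M IN = A" and z: "\<And>a i. a \<noteq> 0 \<Longrightarrow> M a i = 0"
  shows "wp analyse M (400 * n + 300 * st n + 200) (\<lambda>M' _. analysed M' \<and> M' IN = A \<and>
     (\<forall>a. 13 \<le> a \<and> a \<notin> {20..28} \<longrightarrow> M' a = M a))"
  unfolding analyse_def
  apply (rule wp_Seq)
  apply (rule wp_call[OF wp_dfs])
     apply (rule M)
    apply (use z in simp)
   apply simp
  subgoal premises p for M1 c1
  proof -
    have fr1: "\<And>a. a \<notin> {NUM, ORD, PAR, LOW, SV, SP, xSC, xCNT, xX, xK, xE} \<Longrightarrow> M1 a = M a"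
      and c1: "240 * n + 100 * st n + 160 \<le> c1" using p by auto
    have M1: "M1 IN = A" using fr1 M by simp
    let ?N = "M1(xJ := (M1 xJ)(0 := n))"
    show ?thesis
      using c1
      apply -
      apply (rule wp_Set_Seq, simp, simp add: M1 A0 cong: wp_cong)
      apply (rule wp_Seq)
      apply (rule wp_call[OF wp_low_loop])
           apply (use M1 p in simp_all)[4]
       apply simp
      subgoal premises q for M2 c2
      proof -
        have fr2: "\<And>a. a \<notin> {LOW, xJ, xK, xE, xX, xP} \<Longrightarrow> M2 a = M1 a" using q(2) by simp
        have L: "low_inv (M1 NUM) (M1 ORD) (M1 PAR) (M2 LOW) 0" and J: "M2 xJ 0 = 0" using q(2) by simp_all
        have d: "dfs_done (M1 NUM) (M1 ORD) (M1 PAR)" using p by simp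
        show ?thesis
          apply (rule wp_call[OF wp_block_loop[of M2 n]])
                apply (use fr2 M1 A0 in simp)
               apply (rule J)
              apply (use fr1 fr2 z in simp)
             apply (use fr1 fr2 z in simp)
            apply (use fr2 dfs_done_ord[OF d] in simp)
           apply (use q(1,3) in simp)
          subgoal premises r for M3 c3
          proof -
            have fr3: "\<And>a. a \<notin> {HD, LOC, SZ, BS, MB, xJ, xACC, xP, xX} \<Longrightarrow> M3 a = M2 a"
              and h: "hd_spec n (M2 PAR) (M2 LOW) M3 n" using r by simp_all
            have "analysed M3" by (rule analysedI[where low = "M2 LOW"]) (use d L h fr2 fr3 in simp_all)
            moreover have "M3 a = M a" if "13 \<le> a \<and> a \<notin> {20..28}" for a
              using fr1[of a] fr2[of a] fr3[of a] that by auto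
            ultimately show ?thesis using fr2 fr3 M1 by simp
          qed
          done
      qed
      done
  qed
  done

end

section \<open>Relocated subprograms\<close>

abbreviation (input) "DD \<equiv> 50::nat"

text \<open>Relocation of a program: its arrays are renamed so that they are disjoint from those of the
  caller, and all its indices are offset by \<open>xBASE\<close>, the first index beyond everything that earlier
  calls have touched. In this way every call finds memory that is still zero.\<close>
fun rexp :: "exp \<Rightarrow> exp" where
  "rexp (Const c) = Const c"
| "rexp (Get a e) = Get (a + DD) (Plus (V xBASE) (rexp e))"
| "rexp (Plus e1 e2) = Plus (rexp e1) (rexp e2)"
| "rexp (Minus e1 e2) = Minus (rexp e1) (rexp e2)"

text \<open>Before every write, \<open>xHI\<close> is raised to cover the relative index, as
  \<open>h + (x - h)\<close> is a maximum under truncated subtraction. Output is redirected to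
  \<open>OA\<close>, because it has to be read again.\<close>

fun rcom :: "com \<Rightarrow> com" where
  "rcom Skip = Skip"
| "rcom (Set a i e) =
    (xHI ::= Plus (V xHI) (Minus (Plus (rexp i) (Const 1)) (V xHI)) ;;
     Set (a + DD) (Plus (V xBASE) (rexp i)) (rexp e))"
| "rcom (Out e) = (Set OA (V xOP) (rexp e) ;; Inc xOP)"
| "rcom (Seq p q) = Seq (rcom p) (rcom q)"
| "rcom (If e p q) = If (rexp e) (rcom p) (rcom q)"
| "rcom (While e p) = While (rexp e) (rcom p)"

text \<open>The second conjunct records how far the call has written: from
  \<open>xBASE + xHI\<close> on, the relocated arrays are still zero, and this sum becomes the base
  of the next call.\<close>

definition sim :: "mem \<Rightarrow> nat list \<Rightarrow> mem \<Rightarrow> bool" where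
  "sim M ys N \<longleftrightarrow> (\<forall>a i. N (a + DD) (N xBASE 0 + i) = M a i) \<and> (\<forall>a i. N xHI 0 \<le> i \<longrightarrow> M a i = 0) \<and>
     N xOP 0 = length ys \<and> seg (N OA) 0 ys"

lemma rexp_val: "sim M ys N \<Longrightarrow> val N (rexp e) = val M e"
  by (induction e) (simp_all add: sim_def)

lemma rexp_cost: "cost (rexp e) \<le> 5 * cost e"
  by (induction e) simp_all

lemma exec_SetI:
  "t = cost i + cost e + 1 \<Longrightarrow> M' = M(a := (M a)(val M i := val M e)) \<Longrightarrow> exec (Set a i e) (M, out) t (M', out)"
  by (simp only: exec.Set)

text \<open>The slowdown is constant because relocation lengthens an expression at most fivefold and
  adds a bounded number of bookkeeping steps to each command.\<close>

lemma exec_rcom: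
  assumes "exec p s t s'" "sim (fst s) (snd s) N"
  shows "\<exists>t' N'. exec (rcom p) (N, out) t' (N', out) \<and> t' \<le> 30 * t \<and> sim (fst s') (snd s') N' \<and>
    (\<forall>a. a < DD \<and> a \<notin> {xHI, xOP, OA} \<longrightarrow> N' a = N a)"
  using assms
proof (induction arbitrary: N rule: exec.induct)
  case (Skip s)
  then show ?case by (intro exI[of _ 1] exI[of _ N]) (use exec.Skip[of "(N, out)"] in simp)
next
  case (Set a i e M ys)
  then have S: "sim M ys N" by simp
  let ?N1 = "N(xHI := (N xHI)(0 := N xHI 0 + (val M i + 1 - N xHI 0)))"
  let ?N2 = "?N1(a + DD := (?N1 (a + DD))(N xBASE 0 + val M i := val M e))"
  have S1: "sim M ys ?N1" using S by (simp add: sim_def)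
  have e1: "exec (xHI ::= Plus (V xHI) (Minus (Plus (rexp i) (Const 1)) (V xHI))) (N, out)
      (cost (rexp i) + 10) (?N1, out)"
    by (rule exec_SetI) (simp_all add: rexp_val[OF S])
  have e2: "exec (Set (a + DD) (Plus (V xBASE) (rexp i)) (rexp e)) (?N1, out)
      (cost (rexp i) + cost (rexp e) + 4) (?N2, out)"
    by (rule exec_SetI) (simp_all add: rexp_val[OF S1, simplified])
  have "sim (M(a := (M a)(val M i := val M e))) ys ?N2"
    using S by (auto simp: sim_def)
  moreover have "exec (rcom (com.Set a i e)) (N, out) (cost (rexp i) + 10 + (cost (rexp i) + cost (rexp e) + 4)) (?N2, out)"
    using exec.Seq[OF e1 e2] by simp
  moreover have "cost (rexp i) + 10 + (cost (rexp i) + cost (rexp e) + 4) \<le> 30 * (cost i + cost e + 1)"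
    using rexp_cost[of i] rexp_cost[of e] by simp
  moreover have "\<forall>a. a < DD \<and> a \<notin> {xHI, xOP, OA} \<longrightarrow> ?N2 a = N a" by simp
  ultimately show ?case unfolding fst_conv snd_conv by blast
next
  case (Out e M ys)
  then have S: "sim M ys N" by simp
  let ?N1 = "N(OA := (N OA)(length ys := val M e))"
  let ?N2 = "?N1(xOP := (N xOP)(0 := Suc (length ys)))"
  have e1: "exec (Set OA (V xOP) (rexp e)) (N, out) (cost (rexp e) + 3) (?N1, out)"
    by (rule exec_SetI) (use S in \<open>simp_all add: rexp_val[OF S] sim_def\<close>)
  have e2: "exec (Inc xOP) (?N1, out) 6 (?N2, out)"
    by (rule exec_SetI) (use S in \<open>simp_all add: sim_def\<close>)
  have "sim M (ys @ [val M e]) ?N2"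
    using S by (simp add: sim_def seg_snoc)
  moreover have "exec (rcom (com.Out e)) (N, out) (cost (rexp e) + 3 + 6) (?N2, out)"
    using exec.Seq[OF e1 e2] by simp
  moreover have "cost (rexp e) + 3 + 6 \<le> 30 * (cost e + 1)"
    using rexp_cost[of e] by simp
  moreover have "\<forall>a. a < DD \<and> a \<notin> {xHI, xOP, OA} \<longrightarrow> ?N2 a = N a" by simp
  ultimately show ?case unfolding fst_conv snd_conv by blast
next
  case (Seq p s t s' q t' s'')
  obtain t1 N1 where 1: "exec (rcom p) (N, out) t1 (N1, out)" "t1 \<le> 30 * t" "sim (fst s') (snd s') N1"
    "\<forall>a. a < DD \<and> a \<notin> {xHI, xOP, OA} \<longrightarrow> N1 a = N a"
    using Seq.IH(1)[OF Seq.prems] by blast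
  obtain t2 N2 where 2: "exec (rcom q) (N1, out) t2 (N2, out)" "t2 \<le> 30 * t'" "sim (fst s'') (snd s'') N2"
    "\<forall>a. a < DD \<and> a \<notin> {xHI, xOP, OA} \<longrightarrow> N2 a = N1 a"
    using Seq.IH(2)[OF 1(3)] by blast
  show ?case
    using exec.Seq[OF 1(1) 2(1)] 1 2 by (intro exI[of _ "t1 + t2"] exI[of _ N2]) simp
next
  case (IfTrue s e p t s' q)
  obtain t1 N1 where 1: "exec (rcom p) (N, out) t1 (N1, out)" "t1 \<le> 30 * t" "sim (fst s') (snd s') N1"
    "\<forall>a. a < DD \<and> a \<notin> {xHI, xOP, OA} \<longrightarrow> N1 a = N a"
    using IfTrue.IH[OF IfTrue.prems] by blast
  have "exec (rcom (com.If e p q)) (N, out) (cost (rexp e) + 1 + t1) (N1, out)"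
    using exec.IfTrue[of "(N, out)" "rexp e"] IfTrue.hyps 1 rexp_val[OF IfTrue.prems] by simp
  then show ?case
    using 1 rexp_cost[of e] by (intro exI[of _ "cost (rexp e) + 1 + t1"] exI[of _ N1]) simp
next
  case (IfFalse s e q t s' p)
  obtain t1 N1 where 1: "exec (rcom q) (N, out) t1 (N1, out)" "t1 \<le> 30 * t" "sim (fst s') (snd s') N1"
    "\<forall>a. a < DD \<and> a \<notin> {xHI, xOP, OA} \<longrightarrow> N1 a = N a"
    using IfFalse.IH[OF IfFalse.prems] by blast
  have "exec (rcom (com.If e p q)) (N, out) (cost (rexp e) + 1 + t1) (N1, out)"
    using exec.IfFalse[of "(N, out)" "rexp e"] IfFalse.hyps 1 rexp_val[OF IfFalse.prems] by simp
  then show ?case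
    using 1 rexp_cost[of e] by (intro exI[of _ "cost (rexp e) + 1 + t1"] exI[of _ N1]) simp
next
  case (WhileFalse s e p)
  have "exec (rcom (com.While e p)) (N, out) (cost (rexp e) + 1) (N, out)"
    using exec.WhileFalse[of "(N, out)" "rexp e"] WhileFalse.hyps rexp_val[OF WhileFalse.prems] by simp
  then show ?case
    using WhileFalse.prems rexp_cost[of e] by (intro exI[of _ "cost (rexp e) + 1"] exI[of _ N]) simp
next
  case (WhileTrue s e p t s' t' s'')
  obtain t1 N1 where 1: "exec (rcom p) (N, out) t1 (N1, out)" "t1 \<le> 30 * t" "sim (fst s') (snd s') N1"
    "\<forall>a. a < DD \<and> a \<notin> {xHI, xOP, OA} \<longrightarrow> N1 a = N a"
    using WhileTrue.IH(1)[OF WhileTrue.prems] by blast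
  obtain t2 N2 where 2: "exec (rcom (While e p)) (N1, out) t2 (N2, out)" "t2 \<le> 30 * t'" "sim (fst s'') (snd s'') N2"
    "\<forall>a. a < DD \<and> a \<notin> {xHI, xOP, OA} \<longrightarrow> N2 a = N1 a"
    using WhileTrue.IH(2)[OF 1(3)] by blast
  have "exec (rcom (com.While e p)) (N, out) (cost (rexp e) + 1 + t1 + t2) (N2, out)"
    using exec.WhileTrue[of "(N, out)" "rexp e"] WhileTrue.hyps 1 2 rexp_val[OF WhileTrue.prems] by simp
  then show ?case
    using 1 2 rexp_cost[of e] by (intro exI[of _ "cost (rexp e) + 1 + t1 + t2"] exI[of _ N2]) simp
qed

text \<open>Every output costs at least one step. This is the reason why translating the output of a
  call costs no more, up to a constant, than the call itself.\<close>

lemma exec_output_length: "exec p s t s' \<Longrightarrow> length (snd s') \<le> length (snd s) + t"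
  by (induction rule: exec.induct) auto

lemma wp_rcom:
  assumes h: "halts_with p xs t ys" and s: "sim (init_mem xs) [] N"
  shows "wp (rcom p) N (30 * t) (\<lambda>N' _. seg (N' OA) 0 ys \<and> length ys \<le> t \<and>
    (\<forall>a i. N' xHI 0 \<le> i \<longrightarrow> N' (a + DD) (N' xBASE 0 + i) = 0) \<and>
    (\<forall>a. a < DD \<and> a \<notin> {xHI, xOP, OA} \<longrightarrow> N' a = N a))"
  unfolding wp_def
proof
  fix out
  obtain M where M: "exec p (init_mem xs, []) t (M, ys)" using h by (auto simp: halts_with_def)
  obtain t' N' where N': "exec (rcom p) (N, out) t' (N', out)" "t' \<le> 30 * t" "sim M ys N'"
    "\<forall>a. a < DD \<and> a \<notin> {xHI, xOP, OA} \<longrightarrow> N' a = N a"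
    using exec_rcom[OF M, of N out] s unfolding fst_conv snd_conv by blast
  have "length ys \<le> t" using exec_output_length[OF M] by simp
  then show "\<exists>t' N'. exec (rcom p) (N, out) t' (N', out) \<and> t' \<le> 30 * t \<and> (seg (N' OA) 0 ys \<and> length ys \<le> t \<and>
    (\<forall>a i. N' xHI 0 \<le> i \<longrightarrow> N' (a + DD) (N' xBASE 0 + i) = 0) \<and>
    (\<forall>a. a < DD \<and> a \<notin> {xHI, xOP, OA} \<longrightarrow> N' a = N a))"
    using N' by (intro exI[of _ t'] exI[of _ N']) (simp add: sim_def)
qed

section \<open>Translating the output of the subprogram\<close>

text \<open>The bag part of the output format; \<open>flat_edges\<close> is the edge part. They are
  kept apart since they grow in different arrays.\<close>

definition flat_pairs :: "(nat list \<times> nat list) list \<Rightarrow> nat list" where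
  "flat_pairs ps = concat (map (\<lambda>(x, u). length x # x @ length u # u) ps)"

definition flat_edges :: "(nat \<times> nat) list \<Rightarrow> nat list" where
  "flat_edges es = concat (map (\<lambda>(a, b). [a, b]) es)"

lemma length_flat_edges: "length (flat_edges es) = 2 * length es"
  unfolding flat_edges_def by (induction es) auto

lemma flat_pairs_simps [simp]: "flat_pairs [] = []"
  "flat_pairs (p # ps) = length (fst p) # fst p @ length (snd p) # snd p @ flat_pairs ps"
  "flat_pairs (ps @ qs) = flat_pairs ps @ flat_pairs qs"
  by (auto simp: flat_pairs_def split: prod.split)

text \<open>A local number is turned into a search number by \<open>MB\<close> and then into an
  input vertex by \<open>ORD\<close>. Overwriting \<open>HOME\<close> is harmless, as any node whose
  bag contains the vertex serves for gluing.\<close>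

definition copy_entries :: com where
  "copy_entries = While (V xL) (
     xX ::= Get ORD (Get MB (Plus (Get BS (V xW)) (Get OA (V xI)))) ;;
     Set BA (V xBN) (V xX) ;; Inc xBN ;; Inc xI ;;
     Set HOME (V xX) (V xT) ;;
     xL ::= Minus (V xL) (Const 1))"

definition copy_list :: com where
  "copy_list = (xL ::= Get OA (V xI) ;; Set BA (V xBN) (V xL) ;; Inc xBN ;; Inc xI ;; copy_entries)"

lemma wp_copy_entries:
  assumes zs: "seg (M OA) (M xI 0) zs" and L: "M xL 0 = length zs" and bn: "M xBN 0 = length bs" and ba: "seg (M BA) 0 bs"
    and gl: "\<And>z. z \<in> set zs \<Longrightarrow> M ORD (M MB (M BS (M xW 0) + z)) = gl z"
  shows "wp copy_entries M (60 * length zs + 10) (\<lambda>M' _. M' xI 0 = M xI 0 + length zs \<and>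
    M' xBN 0 = length bs + length zs \<and> seg (M' BA) 0 (bs @ map gl zs) \<and>
    (\<forall>v. M' HOME v = (if v \<in> gl ` set zs then M xT 0 else M HOME v)) \<and>
    (\<forall>a. a \<notin> {BA, HOME, xI, xBN, xL, xX} \<longrightarrow> M' a = M a))"
  unfolding copy_entries_def
proof (rule wp_While[where I = "\<lambda>M' c. \<exists>j\<le>length zs. M' xL 0 = length zs - j \<and> M' xI 0 = M xI 0 + j \<and>
    M' xBN 0 = length bs + j \<and> seg (M' BA) 0 (bs @ map gl (take j zs)) \<and>
    (\<forall>v. M' HOME v = (if v \<in> gl ` set (take j zs) then M xT 0 else M HOME v)) \<and>
    (\<forall>a. a \<notin> {BA, HOME, xI, xBN, xL, xX} \<longrightarrow> M' a = M a) \<and> 60 * (length zs - j) + 10 \<le> c"], goal_cases)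
  case 1
  show ?case by (rule exI[of _ 0]) (use L bn ba in simp)
next
  case (2 M' c)
  then show ?case by auto
next
  case (3 M' c)
  then obtain j where j: "j \<le> length zs" "M' xL 0 = length zs - j" "M' xI 0 = M xI 0 + j"
    "M' xBN 0 = length bs + j" "seg (M' BA) 0 (bs @ map gl (take j zs))"
    "\<And>v. M' HOME v = (if v \<in> gl ` set (take j zs) then M xT 0 else M HOME v)"
    and fr: "\<And>a. a \<notin> {BA, HOME, xI, xBN, xL, xX} \<Longrightarrow> M' a = M a" and c: "60 * (length zs - j) + 10 \<le> c"
    by blast
  have jl: "j < length zs" using 3(2) j(1,2) by simp
  then have c': "60 * (length zs - Suc j) + 60 + 10 \<le> c" using c by linarith
  have z: "M OA (M xI 0 + j) = zs ! j" using zs jl by (simp add: seg_def)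
  have g: "M ORD (M MB (M BS (M xW 0) + zs ! j)) = gl (zs ! j)" using gl jl by simp
  have fr': "M' ORD = M ORD" "M' MB = M MB" "M' BS = M BS" "M' OA = M OA" "M' xW = M xW" "M' xT = M xT"
    using fr by auto
  have tk: "take (Suc j) zs = take j zs @ [zs ! j]" using jl by (rule take_Suc_conv_app_nth)
  show ?case
    using c'
    apply -
    apply (rule wp_Set_Seq, simp, simp add: fr' j(3,4) z g cong: wp_cong)+
    apply (rule wp_Set, simp)
    subgoal premises p
    proof -
      have s: "seg ((M' BA)(length bs + j := gl (zs ! j))) 0 (bs @ map gl (take (Suc j) zs))"
        using seg_snoc[OF j(5)] j(1) by (simp add: tk)
      have h: "((M' HOME)(gl (zs ! j) := M xT 0)) v = (if v \<in> gl ` set (take (Suc j) zs) then M xT 0 else M HOME v)" for v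
        by (simp add: tk j(6))
      show ?thesis
        by (rule exI[of _ "Suc j"]) (use s h jl j(2-4) fr p in simp)
    qed
    done
next
  case (4 M' c)
  then obtain j where j: "j \<le> length zs" "M' xL 0 = length zs - j" "M' xI 0 = M xI 0 + j"
    "M' xBN 0 = length bs + j" "seg (M' BA) 0 (bs @ map gl (take j zs))"
    "\<And>v. M' HOME v = (if v \<in> gl ` set (take j zs) then M xT 0 else M HOME v)"
    and fr: "\<And>a. a \<notin> {BA, HOME, xI, xBN, xL, xX} \<Longrightarrow> M' a = M a" by blast
  then have "j = length zs" using 4(2) by simp
  then show ?case using j fr by simp
qed

lemma wp_copy_list:
  assumes zs: "seg (M OA) (M xI 0) (length zs # zs)" and bn: "M xBN 0 = length bs" and ba: "seg (M BA) 0 bs"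
    and gl: "\<And>z. z \<in> set zs \<Longrightarrow> M ORD (M MB (M BS (M xW 0) + z)) = gl z"
  shows "wp copy_list M (60 * length zs + 40) (\<lambda>M' _. M' xI 0 = M xI 0 + Suc (length zs) \<and>
    M' xBN 0 = length bs + Suc (length zs) \<and> seg (M' BA) 0 (bs @ length zs # map gl zs) \<and>
    (\<forall>v. M' HOME v = (if v \<in> gl ` set zs then M xT 0 else M HOME v)) \<and>
    (\<forall>a. a \<notin> {BA, HOME, xI, xBN, xL, xX} \<longrightarrow> M' a = M a))"
proof -
  have z: "M OA (M xI 0) = length zs" "seg (M OA) (Suc (M xI 0)) zs" using zs by (simp_all add: seg_Cons)
  have s: "seg ((M BA)(length bs := length zs)) 0 (bs @ [length zs])" using seg_snoc[OF ba] by simp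
  show ?thesis
    unfolding copy_list_def
    apply (rule wp_Set_Seq, simp, simp add: z bn cong: wp_cong)+
    apply (rule wp_call[OF wp_copy_entries[where zs = zs and bs = "bs @ [length zs]" and gl = gl]])
          apply (use z s s[unfolded fun_upd_def] gl in simp_all)
    done
qed

text \<open>A tree with \<open>N\<close> nodes has \<open>N - 1\<close> edges, so their entries
  occupy the positions 1 to \<open>2 * N - 2\<close> of the output; the test is
  \<open>xI + 1 < 2 * N\<close>.\<close>

definition copy_edges :: com where
  "copy_edges = While (Minus (Plus (Get OA (Const 0)) (Get OA (Const 0))) (Plus (V xI) (Const 1)))
     (Set EA (V xEN) (Plus (Get OA (V xI)) (V xNN)) ;; Inc xEN ;; Inc xI)"

lemma wp_copy_edges:
  assumes zs: "seg (M OA) 1 zs" and N: "2 * M OA 0 = 2 + length zs" and I: "M xI 0 = 1"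
    and en: "M xEN 0 = length ea" and ea: "seg (M EA) 0 ea"
  shows "wp copy_edges M (60 * length zs + 20) (\<lambda>M' _. M' xI 0 = Suc (length zs) \<and> M' xEN 0 = length ea + length zs \<and>
    seg (M' EA) 0 (ea @ map (\<lambda>x. x + M xNN 0) zs) \<and> (\<forall>a. a \<notin> {EA, xEN, xI} \<longrightarrow> M' a = M a))"
  unfolding copy_edges_def
proof (rule wp_While[where I = "\<lambda>M' c. \<exists>j\<le>length zs. M' xI 0 = Suc j \<and> M' xEN 0 = length ea + j \<and>
    seg (M' EA) 0 (ea @ map (\<lambda>x. x + M xNN 0) (take j zs)) \<and> (\<forall>a. a \<notin> {EA, xEN, xI} \<longrightarrow> M' a = M a) \<and>
    60 * (length zs - j) + 20 \<le> c"], goal_cases)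
  case 1
  show ?case by (rule exI[of _ 0]) (use I en ea in simp)
next
  case (2 M' c)
  then show ?case by auto
next
  case (3 M' c)
  then obtain j where j: "j \<le> length zs" "M' xI 0 = Suc j" "M' xEN 0 = length ea + j"
    "seg (M' EA) 0 (ea @ map (\<lambda>x. x + M xNN 0) (take j zs))"
    and fr: "\<And>a. a \<notin> {EA, xEN, xI} \<Longrightarrow> M' a = M a" and c: "60 * (length zs - j) + 20 \<le> c" by blast
  have fr': "M' OA = M OA" "M' xNN = M xNN" using fr by auto
  have jl: "j < length zs" using 3(2) N j(2) fr' by simp
  then have c': "60 * (length zs - Suc j) + 60 + 20 \<le> c" using c by linarith
  have z: "M OA (Suc j) = zs ! j" using zs jl by (simp add: seg_def)
  have tk: "take (Suc j) zs = take j zs @ [zs ! j]" using jl by (rule take_Suc_conv_app_nth)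
  show ?case
    using c'
    apply -
    apply (rule wp_Set_Seq, simp, simp add: fr' j(2,3) z cong: wp_cong)+
    apply (rule wp_Set, simp)
    subgoal premises p
    proof -
      have s: "seg ((M' EA)(length ea + j := zs ! j + M xNN 0)) 0 (ea @ map (\<lambda>x. x + M xNN 0) (take (Suc j) zs))"
        using seg_snoc[OF j(4)] j(1) by (simp add: tk)
      show ?thesis
        by (rule exI[of _ "Suc j"]) (use s jl j(2,3) fr p in simp)
    qed
    done
next
  case (4 M' c)
  then obtain j where j: "j \<le> length zs" "M' xI 0 = Suc j" "M' xEN 0 = length ea + j"
    "seg (M' EA) 0 (ea @ map (\<lambda>x. x + M xNN 0) (take j zs))"
    and fr: "\<And>a. a \<notin> {EA, xEN, xI} \<Longrightarrow> M' a = M a" by blast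
  have "M' OA = M OA" using fr by simp
  then have "j = length zs" using 4(2) N j(1,2) by simp
  then show ?case using j fr by simp
qed

definition copy_bags :: com where
  "copy_bags = While (Minus (Plus (V xNN) (Get OA (Const 0))) (V xT)) (copy_list ;; copy_list ;; Inc xT)"

definition bag_of :: "nat list \<times> nat list \<Rightarrow> nat set" where
  "bag_of p = set (fst p) \<union> set (snd p)"

text \<open>Of the several nodes that may contain \<open>v\<close> the last one ends up in
  \<open>HOME\<close>. The statement keeps only that it is one of them, and that vertices outside
  all bags keep their old value; the latter matters for the dummy vertex.\<close>

lemma wp_copy_bags:
  assumes ps: "seg (M OA) (M xI 0) (flat_pairs ps)" and N: "M OA 0 = length ps" and T: "M xT 0 = M xNN 0"
    and bn: "M xBN 0 = length bs" and ba: "seg (M BA) 0 bs"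
    and gl: "\<And>p z. p \<in> set ps \<Longrightarrow> z \<in> bag_of p \<Longrightarrow> M ORD (M MB (M BS (M xW 0) + z)) = gl z"
  defines "out \<equiv> flat_pairs (map (\<lambda>(x, u). (map gl x, map gl u)) ps)"
  shows "wp copy_bags M (120 * length (flat_pairs ps) + 20) (\<lambda>M' _. M' xBN 0 = length bs + length out \<and> seg (M' BA) 0 (bs @ out) \<and>
    (\<forall>v. (\<exists>t<length ps. v \<in> gl ` bag_of (ps ! t) \<and> M' HOME v = M xNN 0 + t) \<or>
         (\<forall>p\<in>set ps. v \<notin> gl ` bag_of p) \<and> M' HOME v = M HOME v) \<and>
    (\<forall>a. a \<notin> {BA, HOME, xI, xBN, xL, xX, xT} \<longrightarrow> M' a = M a))"
  unfolding copy_bags_def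
proof -
  let ?gl = "map (\<lambda>(x, u). (map gl x, map gl u))"
  let ?H = "\<lambda>M' j. \<forall>v. (\<exists>t<j. v \<in> gl ` bag_of (ps ! t) \<and> M' HOME v = M xNN 0 + t) \<or>
         (\<forall>p\<in>set (take j ps). v \<notin> gl ` bag_of p) \<and> M' HOME v = M HOME v"
  let ?I = "\<lambda>M' c. \<exists>j\<le>length ps. M' xT 0 = M xNN 0 + j \<and> seg (M OA) (M' xI 0) (flat_pairs (drop j ps)) \<and>
    M' xBN 0 = length bs + length (flat_pairs (?gl (take j ps))) \<and> seg (M' BA) 0 (bs @ flat_pairs (?gl (take j ps))) \<and>
    ?H M' j \<and> (\<forall>a. a \<notin> {BA, HOME, xI, xBN, xL, xX, xT} \<longrightarrow> M' a = M a) \<and>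
    120 * length (flat_pairs (drop j ps)) + 20 \<le> c"
  show "wp (While (Minus (Plus (V xNN) (Get OA (Const 0))) (V xT)) (copy_list ;; copy_list ;; Inc xT)) M
      (120 * length (flat_pairs ps) + 20) (\<lambda>M' _. M' xBN 0 = length bs + length out \<and> seg (M' BA) 0 (bs @ out) \<and>
    (\<forall>v. (\<exists>t<length ps. v \<in> gl ` bag_of (ps ! t) \<and> M' HOME v = M xNN 0 + t) \<or>
         (\<forall>p\<in>set ps. v \<notin> gl ` bag_of p) \<and> M' HOME v = M HOME v) \<and>
    (\<forall>a. a \<notin> {BA, HOME, xI, xBN, xL, xX, xT} \<longrightarrow> M' a = M a))"
  proof (rule wp_While[where I = ?I], goal_cases)
    case 1
    show ?case by (rule exI[of _ 0]) (use T ps bn ba in simp)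
  next
    case (2 M' c)
    then show ?case by auto
  next
    case (3 M' c)
    then obtain j where j: "j \<le> length ps" "M' xT 0 = M xNN 0 + j" "seg (M OA) (M' xI 0) (flat_pairs (drop j ps))"
      "M' xBN 0 = length bs + length (flat_pairs (?gl (take j ps)))" "seg (M' BA) 0 (bs @ flat_pairs (?gl (take j ps)))"
      and H: "?H M' j" and fr: "\<And>a. a \<notin> {BA, HOME, xI, xBN, xL, xX, xT} \<Longrightarrow> M' a = M a"
      and c: "120 * length (flat_pairs (drop j ps)) + 20 \<le> c"
      by blast
    have fr': "M' OA = M OA" "M' xNN = M xNN" "M' ORD = M ORD" "M' MB = M MB" "M' BS = M BS" "M' xW = M xW"
      using fr by auto
    have jl: "j < length ps" using 3(2) N j(1,2) fr' by simp
    obtain x u where p: "ps ! j = (x, u)" by (cases "ps ! j")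
    have dr: "drop j ps = (x, u) # drop (Suc j) ps" using Cons_nth_drop_Suc[OF jl] p by simp
    have tk: "take (Suc j) ps = take j ps @ [(x, u)]" using take_Suc_conv_app_nth[OF jl] p by simp
    let ?r = "flat_pairs (drop (Suc j) ps)"
    let ?bs = "bs @ flat_pairs (?gl (take j ps))"
    have "seg (M OA) (M' xI 0) ((length x # x) @ (length u # u) @ ?r)" using j(3) dr by simp
    then have s: "seg (M OA) (M' xI 0) (length x # x)" "seg (M OA) (M' xI 0 + Suc (length x)) (length u # u)"
      "seg (M OA) (M' xI 0 + Suc (length x) + Suc (length u)) ?r"
      unfolding seg_append by simp_all
    have inp: "(x, u) \<in> set ps" using p jl nth_mem by metis
    have glx: "M ORD (M MB (M BS (M xW 0) + z)) = gl z" if "z \<in> set x \<or> z \<in> set u" for z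
      using gl[OF inp] that by (auto simp: bag_of_def)
    have c': "120 * (length x + length u + 2 + length ?r) + 20 \<le> c" using c dr by simp
    show ?case
      using c'
      apply -
      apply (rule wp_Seq)
      apply (rule wp_call[OF wp_copy_list[where zs = x and bs = ?bs and gl = gl]])
           apply (use s fr' j(4,5) glx in simp_all)[5]
      subgoal premises q for M1 c1
      proof -
        have fr1: "M1 OA = M OA" "M1 ORD = M ORD" "M1 MB = M MB" "M1 BS = M BS" "M1 xW = M xW" "M1 xT = M' xT"
          using q(2) fr' by simp_all
        have bn1: "M1 xBN 0 = length (?bs @ length x # map gl x)"
          and ba1: "seg (M1 BA) 0 (?bs @ length x # map gl x)" and i1: "M1 xI 0 = M' xI 0 + Suc (length x)"
          using q(2) by simp_all
        show ?thesis
          apply (rule wp_Seq)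
          apply (rule wp_call[OF wp_copy_list[where zs = u and bs = "?bs @ length x # map gl x" and gl = gl]])
               apply (use s(2) fr1 i1 in simp)
              apply (rule bn1)
             apply (rule ba1)
            apply (use glx fr1 in simp)
           apply (use q(1,3) in simp)
          subgoal premises r for M2 c2
          proof -
            have fr2: "M2 a = M a" if "a \<notin> {BA, HOME, xI, xBN, xL, xX, xT}" for a
              using r(1) q(2) fr[OF that] that by simp
            have T2: "M2 xT 0 = M xNN 0 + j" using r(1) fr1 j(2) by simp
            have c2: "120 * length ?r + 20 + 50 \<le> c2" using r(2) q(1,3) by simp
            have i2: "M2 xI 0 = M' xI 0 + Suc (length x) + Suc (length u)" using r(1) i1 by simp
            have f: "?bs @ length x # map gl x @ length u # map gl u = bs @ flat_pairs (?gl (take (Suc j) ps))"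
              by (simp add: tk)
            have ba2: "seg (M2 BA) 0 (bs @ flat_pairs (?gl (take (Suc j) ps)))" using r(1) f by simp
            have "M2 xBN 0 = length (?bs @ length x # map gl x) + Suc (length u)" using r(1) by blast
            then have bn2: "M2 xBN 0 = length bs + length (flat_pairs (?gl (take (Suc j) ps)))"
              using f[THEN arg_cong[where f = length]] by simp
            have h: "M2 HOME v = (if v \<in> gl ` bag_of (x, u) then M xNN 0 + j else M' HOME v)" for v
              using r(1) q(2) j(2) fr1 by (auto simp: bag_of_def)
            have H2: "?H M2 (Suc j)"
            proof
              fix v
              show "(\<exists>t<Suc j. v \<in> gl ` bag_of (ps ! t) \<and> M2 HOME v = M xNN 0 + t) \<or>
                (\<forall>p\<in>set (take (Suc j) ps). v \<notin> gl ` bag_of p) \<and> M2 HOME v = M HOME v"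
              proof (cases "v \<in> gl ` bag_of (x, u)")
                case True
                then have "v \<in> gl ` bag_of (ps ! j) \<and> M2 HOME v = M xNN 0 + j" using h p by simp
                then show ?thesis by blast
              next
                case False
                then have e: "M2 HOME v = M' HOME v" using h by simp
                consider t where "t < j" "v \<in> gl ` bag_of (ps ! t)" "M' HOME v = M xNN 0 + t" |
                  "\<forall>p\<in>set (take j ps). v \<notin> gl ` bag_of p" "M' HOME v = M HOME v" using H by blast
                then show ?thesis
                proof cases
                  case 1
                  then have "t < Suc j \<and> v \<in> gl ` bag_of (ps ! t) \<and> M2 HOME v = M xNN 0 + t"
                    using e by simp
                  then show ?thesis by blast
                next
                  case 2
                  then show ?thesis using e False by (simp add: tk)
                qed
              qed
            qed
            show ?thesis
              using c2
              apply -
              apply (rule wp_Set, simp)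
              apply (rule exI[of _ "Suc j"])
              using T2 i2 s(3) ba2 bn2 H2 fr2 jl by simp
          qed
          done
      qed
      done
  next
    case (4 M' c)
    then obtain j where j: "j \<le> length ps" "M' xT 0 = M xNN 0 + j"
      "M' xBN 0 = length bs + length (flat_pairs (?gl (take j ps)))" "seg (M' BA) 0 (bs @ flat_pairs (?gl (take j ps)))"
      and H: "?H M' j" and fr: "\<And>a. a \<notin> {BA, HOME, xI, xBN, xL, xX, xT} \<Longrightarrow> M' a = M a"
      by blast
    have "M' OA = M OA" "M' xNN = M xNN" using fr by simp_all
    then have "j = length ps" using 4(2) N j(1,2) by simp
    then show ?case using j H fr by (simp add: out_def)
  qed
qed

section \<open>Encoding a block\<close>

text \<open>The block has \<open>s\<close> members and a top vertex. Its two header numbers and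
  \<open>s + 2\<close> start positions fill the first \<open>4 + s\<close> cells, and
  \<open>q\<close> adjacency entries follow so far.\<close>

abbreviation (input) "eSlot \<equiv> Plus (V xBASE) (Plus (Const 4) (Plus (V xS) (V xQ)))"

text \<open>
  The vertex \<open>par w\<close> gets the last local number. Scanning its adjacency list for each of its blocks
  would not be linear in total, so its list of neighbours in the block is gathered in \<open>TP\<close> while the
  lists of the other members are scanned, and appended at the end.
\<close>
definition scan_nbrs :: com where
  "scan_nbrs = While (Minus (V xE) (V xK)) (
     xU ::= Get NUM (eTgt (V xK)) ;;
     If (Differ (V xU) (V xP))
       (If (Differ (Get HD (V xU)) (V xW)) Skip
         (Set DD eSlot (Get LOC (V xU)) ;; Inc xQ ;;
          If (Minus (V xI) (Get LOC (V xU))) (Inc xEC) Skip))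
       (Set DD eSlot (V xS) ;; Inc xQ ;; Inc xEC ;; Set TP (V xTC) (V xI) ;; Inc xTC) ;;
     Inc xK)"

definition scan_members :: com where
  "scan_members = While (Minus (V xS) (V xI)) (
     Set DD (Plus (V xBASE) (Plus (Const 2) (V xI))) (V xQ) ;;
     xX ::= Get ORD (Get MB (Plus (Get BS (V xW)) (V xI))) ;;
     xK ::= eFrom (V xX) ;;
     xE ::= eTo (V xX) ;;
     scan_nbrs ;;
     Inc xI)"

definition copy_top :: com where
  "copy_top = While (Minus (V xTC) (V xJ)) (Set DD eSlot (Get TP (V xJ)) ;; Inc xQ ;; Inc xJ)"

text \<open>Finally \<open>xHI\<close> becomes the length of the code, so that the input of the call
  counts as touched memory.\<close>

definition encode_block :: com where
  "encode_block = (xEC ::= Const 0 ;; xQ ::= Const 0 ;; xTC ::= Const 0 ;; xI ::= Const 0 ;;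
     scan_members ;;
     Set DD (Plus (V xBASE) (Plus (Const 2) (V xS))) (V xQ) ;;
     xJ ::= Const 0 ;;
     copy_top ;;
     Set DD (Plus (V xBASE) (Plus (Const 3) (V xS))) (V xQ) ;;
     Set DD (V xBASE) (Plus (V xS) (Const 1)) ;;
     Set DD (Plus (V xBASE) (Const 1)) (V xEC) ;;
     xHI ::= Plus (Const 4) (Plus (V xS) (V xQ)))"

definition nbr_entry :: "(nat \<Rightarrow> nat) \<Rightarrow> (nat \<Rightarrow> nat) \<Rightarrow> nat \<Rightarrow> nat \<Rightarrow> nat \<Rightarrow> nat \<Rightarrow> nat list" where
  "nbr_entry h loc w p s u = (if u = p then [s] else if h u = w then [loc u] else [])"

definition top_entry :: "nat \<Rightarrow> nat \<Rightarrow> nat \<Rightarrow> nat list" where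
  "top_entry p i u = (if u = p then [i] else [])"

text \<open>Counts each edge of the block once: an edge between members at the end with the larger
  position, and an edge to \<open>par w\<close> at the member, since the list of
  \<open>par w\<close> is not scanned.\<close>

definition edge_count :: "(nat \<Rightarrow> nat) \<Rightarrow> (nat \<Rightarrow> nat) \<Rightarrow> nat \<Rightarrow> nat \<Rightarrow> nat \<Rightarrow> nat \<Rightarrow> nat" where
  "edge_count h loc w p i u = (if u = p \<or> h u = w \<and> loc u < i then 1 else 0)"

context input begin

text \<open>A statement about lists of numbers only; that these lists are an encoding of the block
  is left to \<open>block_code_encodes\<close>.\<close>

lemma wp_scan_nbrs:
  assumes M: "M IN = A" and KE: "M xK 0 \<le> M xE 0"
    and b: "b = M xBASE 0 + 4 + M xS 0" and qs: "seg (M DD) b qs" "M xQ 0 = length qs"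
    and ts: "seg (M TP) 0 ts" "M xTC 0 = length ts"
  defines "us \<equiv> \<lambda>k. map (\<lambda>k. M NUM (tgt k)) [M xK 0..<k]"
    and "ent \<equiv> nbr_entry (M HD) (M LOC) (M xW 0) (M xP 0) (M xS 0)"
    and "tpe \<equiv> top_entry (M xP 0) (M xI 0)"
    and "cnt \<equiv> edge_count (M HD) (M LOC) (M xW 0) (M xP 0) (M xI 0)"
  shows "wp scan_nbrs M (120 * (M xE 0 - M xK 0) + 10) (\<lambda>M' _.
    M' xQ 0 = length (qs @ concat (map ent (us (M xE 0)))) \<and> seg (M' DD) b (qs @ concat (map ent (us (M xE 0)))) \<and>
    M' xTC 0 = length (ts @ concat (map tpe (us (M xE 0)))) \<and> seg (M' TP) 0 (ts @ concat (map tpe (us (M xE 0)))) \<and>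
    M' xEC 0 = M xEC 0 + sum_list (map cnt (us (M xE 0))) \<and>
    (\<forall>i. i < b \<or> b + M' xQ 0 \<le> i \<longrightarrow> M' DD i = M DD i) \<and>
    (\<forall>a. a \<notin> {DD, TP, xK, xU, xQ, xEC, xTC} \<longrightarrow> M' a = M a))"
proof -
  let ?J = "\<lambda>M' k. 
    M' xQ 0 = length (qs @ concat (map ent (us k))) \<and> seg (M' DD) b (qs @ concat (map ent (us k))) \<and>
    M' xTC 0 = length (ts @ concat (map tpe (us k))) \<and> seg (M' TP) 0 (ts @ concat (map tpe (us k))) \<and>
    M' xEC 0 = M xEC 0 + sum_list (map cnt (us k)) \<and>
    (\<forall>i. i < b \<or> b + M' xQ 0 \<le> i \<longrightarrow> M' DD i = M DD i) \<and>
    (\<forall>a. a \<notin> {DD, TP, xK, xU, xQ, xEC, xTC} \<longrightarrow> M' a = M a)"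
  let ?I = "\<lambda>M' c. \<exists>k. M xK 0 \<le> k \<and> k \<le> M xE 0 \<and> M' xK 0 = k \<and> ?J M' k \<and> 120 * (M xE 0 - k) + 10 \<le> c"
  show ?thesis
    unfolding scan_nbrs_def
  proof (rule wp_While[where I = ?I], goal_cases)
    case 1
    show ?case by (rule exI[of _ "M xK 0"]) (use KE qs ts in \<open>simp add: us_def\<close>)
  next
    case (2 M' c)
    then show ?case by auto
  next
    case (3 M' c)
    then obtain k where k: "M xK 0 \<le> k" "k \<le> M xE 0" "M' xK 0 = k" and J: "?J M' k"
      and c: "120 * (M xE 0 - k) + 10 \<le> c" by blast
    define X where "X = concat (map ent (us k))"
    define Y where "Y = concat (map tpe (us k))"
    have q: "M' xQ 0 = length qs + length X" "seg (M' DD) b (qs @ X)" 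
      and t: "M' xTC 0 = length ts + length Y" "seg (M' TP) 0 (ts @ Y)"
      and ec: "M' xEC 0 = M xEC 0 + sum_list (map cnt (us k))"
      and dd: "\<And>i. i < b \<or> b + (length qs + length X) \<le> i \<Longrightarrow> M' DD i = M DD i"
      and fr: "\<And>a. a \<notin> {DD, TP, xK, xU, xQ, xEC, xTC} \<Longrightarrow> M' a = M a"
      using J by (auto simp: X_def Y_def)
    have fr': "M' IN = A" "M' NUM = M NUM" "M' HD = M HD" "M' LOC = M LOC" "M' xW = M xW" "M' xP = M xP"
      "M' xS = M xS" "M' xI = M xI" "M' xBASE = M xBASE" "M' xE = M xE"
      using fr M by simp_all
    have kl: "k < M xE 0" using 3(2) k(3) fr' by simp
    then have c': "120 * (M xE 0 - Suc k) + 120 + 10 \<le> c" using c by linarith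
    define u where "u = M NUM (tgt k)"
    have us: "us (Suc k) = us k @ [u]" using k(1) by (simp add: us_def u_def)
    have slot: "M xBASE 0 + (4 + (M xS 0 + (length qs + length X))) = b + (length qs + length X)"
      using b by simp
    have fin: "wp (Inc xK) N d ?I"
      if "N xK 0 = k" "120 * (M xE 0 - Suc k) + 40 \<le> d"
        "N xQ 0 = length qs + length X + length (ent u)" "seg (N DD) b (qs @ X @ ent u)"
        "N xTC 0 = length ts + length Y + length (tpe u)" "seg (N TP) 0 (ts @ Y @ tpe u)"
        "N xEC 0 = M xEC 0 + sum_list (map cnt (us k)) + cnt u"
        "\<And>i. i < b \<or> b + N xQ 0 \<le> i \<Longrightarrow> N DD i = M DD i"
        "\<And>a. a \<notin> {DD, TP, xK, xU, xQ, xEC, xTC} \<Longrightarrow> N a = M a" for N d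
      using that(2)
      apply -
      apply (rule wp_Set, simp)
      apply (rule exI[of _ "Suc k"])
      using that k kl by (simp add: us X_def[symmetric] Y_def[symmetric])
    show ?case
      using c'
      apply -
      apply (rule wp_Set_Seq, simp, simp add: fr' k(3) eTgt_val A0 u_def[symmetric] cong: wp_cong)
      apply (rule wp_Seq)
      apply (rule wp_If, simp)
      subgoal premises p
      proof -
        have ne: "u \<noteq> M xP 0" using p(2) fr' by auto
        show ?thesis
          using p(1)
          apply -
          apply (rule wp_If, simp)
          subgoal premises r
          proof -
            have "M HD u \<noteq> M xW 0" using r(2) fr' by auto
            then have e: "ent u = []" "tpe u = []" "cnt u = 0" using ne
              by (simp_all add: ent_def tpe_def cnt_def nbr_entry_def top_entry_def edge_count_def)
            show ?thesis
              apply (rule wp_Skip)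
              using r apply simp
              apply (rule fin)
              using r q t ec dd fr k(3) by (simp_all add: e)
          qed
          subgoal premises r
          proof -
            have hd: "M HD u = M xW 0" using r(2) fr' by auto
            have e: "ent u = [M LOC u]" "tpe u = []" "cnt u = (if M LOC u < M xI 0 then 1 else 0)" using ne hd
              by (simp_all add: ent_def tpe_def cnt_def nbr_entry_def top_entry_def edge_count_def)
            let ?D = "(M' DD)(b + (length qs + length X) := M LOC u)"
            have s: "seg ?D b (qs @ X @ [M LOC u])"
              using seg_snoc[OF q(2), of "b + (length qs + length X)"] by simp
            note s' = s s[unfolded fun_upd_def]
            show ?thesis
              using r(1)
              apply -
              apply (rule wp_Set_Seq, simp, simp add: fr' k(3) q(1) slot cong: wp_cong)+
              apply (rule wp_If, simp)
              subgoal premises z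
                apply (rule wp_Set)
                using z apply simp
                apply (rule fin)
                using z s' q t ec dd fr k(3) fr' by (simp_all add: e) auto
              subgoal premises z
                apply (rule wp_Skip)
                using z apply simp
                apply (rule fin)
                using z s' q t ec dd fr k(3) fr' by (simp_all add: e) auto
              done
          qed
          done
      qed
      subgoal premises p
      proof -
        have eq: "u = M xP 0" using p(2) fr' by auto
        have e: "ent u = [M xS 0]" "tpe u = [M xI 0]" "cnt u = 1" using eq
          by (simp_all add: ent_def tpe_def cnt_def nbr_entry_def top_entry_def edge_count_def)
        let ?D = "(M' DD)(b + (length qs + length X) := M xS 0)"
        have s: "seg ?D b (qs @ X @ [M xS 0])"
          using seg_snoc[OF q(2), of "b + (length qs + length X)"] by simp
        have s2: "seg ((M' TP)(length ts + length Y := M xI 0)) 0 (ts @ Y @ [M xI 0])"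
          using seg_snoc[OF t(2), of "length ts + length Y"] by simp
        note s' = s s[unfolded fun_upd_def] s2 s2[unfolded fun_upd_def]
        show ?thesis
          using p(1)
          apply -
          apply (rule wp_Set_Seq, simp, simp add: fr' k(3) q(1) t(1) slot cong: wp_cong)+
          apply (rule wp_Set, simp)
          apply (rule fin)
          using s' q t ec dd fr k(3) fr' by (simp_all add: e) auto
      qed
      done
  next
    case (4 M' c)
    then obtain k where k: "M xK 0 \<le> k" "k \<le> M xE 0" "M' xK 0 = k" and J: "?J M' k" by blast
    have "M' xE = M xE" using J by simp
    then have "k = M xE 0" using 4(2) k by simp
    then show ?case using J by simp
  qed
qed

end

context input begin

definition nbr_nums :: "(nat \<Rightarrow> nat) \<Rightarrow> nat \<Rightarrow> nat list" where
  "nbr_nums num x = map (\<lambda>k. num (tgt k)) [st x..<st (Suc x)]"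

lemma length_nbr_nums: "length (nbr_nums num x) = st (Suc x) - st x"
  by (simp add: nbr_nums_def)

text \<open>Only the adjacency lists of members are paid for. As every vertex is a member of exactly
  one block, these budgets have a linear sum.\<close>

lemma wp_scan_members:
  assumes M: "M IN = A" and x: "\<And>i. i < s \<Longrightarrow> M ORD (M MB (M BS (M xW 0) + i)) = x i \<and> x i < n"
    and s: "M xS 0 = s" and bs: "M xBASE 0 = base"
    and z: "M xQ 0 = 0" "M xTC 0 = 0" "M xEC 0 = 0" "M xI 0 = 0"
  defines "adj \<equiv> \<lambda>i. concat (map (nbr_entry (M HD) (M LOC) (M xW 0) (M xP 0) s) (nbr_nums (M NUM) (x i)))"
    and "tpl \<equiv> \<lambda>i. concat (map (top_entry (M xP 0) i) (nbr_nums (M NUM) (x i)))"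
    and "cnt \<equiv> \<lambda>i. sum_list (map (edge_count (M HD) (M LOC) (M xW 0) (M xP 0) i) (nbr_nums (M NUM) (x i)))"
  shows "wp scan_members M (100 * s + 120 * (\<Sum>i<s. st (Suc (x i)) - st (x i)) + 10) (\<lambda>M' _.
    M' xQ 0 = length (concat (map adj [0..<s])) \<and> seg (M' DD) (base + 4 + s) (concat (map adj [0..<s])) \<and>
    M' xTC 0 = length (concat (map tpl [0..<s])) \<and> seg (M' TP) 0 (concat (map tpl [0..<s])) \<and>
    M' xEC 0 = (\<Sum>i<s. cnt i) \<and>
    (\<forall>i<s. M' DD (base + 2 + i) = length (concat (map adj [0..<i]))) \<and>
    (\<forall>i. i \<ge> base + 4 + s + M' xQ 0 \<longrightarrow> M' DD i = M DD i) \<and>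
    (\<forall>a. a \<notin> {DD, TP, xK, xE, xX, xI, xU, xQ, xEC, xTC} \<longrightarrow> M' a = M a))"
proof -
  let ?J = "\<lambda>M' j. 
    M' xQ 0 = length (concat (map adj [0..<j])) \<and> seg (M' DD) (base + 4 + s) (concat (map adj [0..<j])) \<and>
    M' xTC 0 = length (concat (map tpl [0..<j])) \<and> seg (M' TP) 0 (concat (map tpl [0..<j])) \<and>
    M' xEC 0 = (\<Sum>i<j. cnt i) \<and>
    (\<forall>i<j. M' DD (base + 2 + i) = length (concat (map adj [0..<i]))) \<and>
    (\<forall>i. i \<ge> base + 4 + s + M' xQ 0 \<longrightarrow> M' DD i = M DD i) \<and>
    (\<forall>a. a \<notin> {DD, TP, xK, xE, xX, xI, xU, xQ, xEC, xTC} \<longrightarrow> M' a = M a)"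
  let ?d = "\<lambda>i. st (Suc (x i)) - st (x i)"
  let ?I = "\<lambda>M' c. \<exists>j\<le>s. M' xI 0 = j \<and> ?J M' j \<and> 100 * (s - j) + 120 * (\<Sum>i\<in>{j..<s}. ?d i) + 10 \<le> c"
  show ?thesis
    unfolding scan_members_def
  proof (rule wp_While[where I = ?I], goal_cases)
    case 1
    show ?case by (rule exI[of _ 0]) (use z in \<open>simp add: lessThan_atLeast0\<close>)
  next
    case (2 M' c)
    then show ?case by auto
  next
    case (3 M' c)
    then obtain j where j: "j \<le> s" "M' xI 0 = j" and J: "?J M' j"
      and c: "100 * (s - j) + 120 * (\<Sum>i\<in>{j..<s}. ?d i) + 10 \<le> c" by blast
    define X where "X = concat (map adj [0..<j])"
    define Y where "Y = concat (map tpl [0..<j])"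
    have q: "M' xQ 0 = length X" "seg (M' DD) (base + 4 + s) X"
      and t: "M' xTC 0 = length Y" "seg (M' TP) 0 Y"
      and ec: "M' xEC 0 = (\<Sum>i<j. cnt i)"
      and start: "\<And>i. i < j \<Longrightarrow> M' DD (base + 2 + i) = length (concat (map adj [0..<i]))"
      and dd: "\<And>i. i \<ge> base + 4 + s + length X \<Longrightarrow> M' DD i = M DD i"
      and fr: "\<And>a. a \<notin> {DD, TP, xK, xE, xX, xI, xU, xQ, xEC, xTC} \<Longrightarrow> M' a = M a"
      using J by (simp_all add: X_def Y_def)
    have fr': "M' IN = A" "M' NUM = M NUM" "M' HD = M HD" "M' LOC = M LOC" "M' xW = M xW" "M' xP = M xP"
      "M' xS 0 = s" "M' xBASE 0 = base" "M' ORD = M ORD" "M' MB = M MB" "M' BS = M BS"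
      using fr M s bs by simp_all
    have js: "j < s" using 3(2) j(2) fr' by simp
    have "{j..<s} = insert j {Suc j..<s}" using js by auto
    then have sm: "(\<Sum>i\<in>{j..<s}. ?d i) = ?d j + (\<Sum>i\<in>{Suc j..<s}. ?d i)" by simp
    have c': "100 + 100 * (s - Suc j) + 120 * ?d j + 120 * (\<Sum>i\<in>{Suc j..<s}. ?d i) + 10 \<le> c"
      using c sm js by (simp add: algebra_simps)
    have xj: "M ORD (M MB (M BS (M xW 0) + j)) = x j" "x j < n" using x js by auto
    let ?D = "(M' DD)(base + Suc (Suc j) := length X)"
    have segD: "seg ?D (base + 4 + s) X" using q(2) js by (simp add: seg_upd_other)
    have adjS: "concat (map adj [0..<Suc j]) = X @ adj j" by (simp add: X_def)
    have tplS: "concat (map tpl [0..<Suc j]) = Y @ tpl j" by (simp add: Y_def)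
    show ?case
      using c'
      apply -
      apply (rule wp_Set_Seq, simp, simp add: fr' j(2) q(1) xj eFrom_val eTo_val cong: wp_cong)+
      apply (rule wp_Seq)
      apply (rule wp_call[OF wp_scan_nbrs[where qs = X and ts = Y and b = "base + 4 + s"]])
             apply (simp add: fr')
            apply (simp add: st_step xj)
           apply (simp add: fr')
          apply (use segD in \<open>simp add: fun_upd_def\<close>)
         apply (simp add: q)
        apply (use t in simp)
       apply (use t in simp)
      apply (simp)
      subgoal premises p for M1 c1
      proof -
        have Q1: "M1 xQ 0 = length (X @ adj j)" "seg (M1 DD) (base + 4 + s) (X @ adj j)"
          using p(2) by (simp_all add: fr' adj_def nbr_nums_def)
        have T1: "M1 xTC 0 = length (Y @ tpl j)" "seg (M1 TP) 0 (Y @ tpl j)"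
          using p(2) by (simp_all add: fr' j(2) tpl_def nbr_nums_def)
        have E1: "M1 xEC 0 = (\<Sum>i<Suc j. cnt i)"
          using p(2) by (simp add: fr' j(2) ec cnt_def nbr_nums_def)
        have D1: "M1 DD i = ?D i" if "i < base + 4 + s \<or> base + 4 + s + M1 xQ 0 \<le> i" for i
          using that p(2) by (elim disjE) simp_all
        have S1: "M1 DD (base + 2 + i) = length (concat (map adj [0..<i]))" if "i < Suc j" for i
        proof (cases "i = j")
          case True
          then show ?thesis using D1[of "base + 2 + i"] js by (simp add: X_def)
        next
          case False
          then have "i < j" using that by simp
          then show ?thesis using D1[of "base + 2 + i"] js start[of i] by simp
        qed
        have H1: "M1 DD i = M DD i" if "i \<ge> base + 4 + s + M1 xQ 0" for i
          using D1[of i] dd[of i] that Q1(1) js by simp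
        have F1: "M1 a = M a" if "a \<notin> {DD, TP, xK, xE, xX, xI, xU, xQ, xEC, xTC}" for a
          using p(2) that fr[of a] by simp
        have I1: "M1 xI 0 = j" using p(2) j(2) by simp
        have c1: "100 * (s - Suc j) + 120 * (\<Sum>i\<in>{Suc j..<s}. ?d i) + 10 + 20 \<le> c1"
          using p(1,3) by simp
        show ?thesis
          using c1
          apply -
          apply (rule wp_Set, simp)
          apply (rule exI[of _ "Suc j"])
          using I1 js Q1 T1 E1 S1 H1 F1 unfolding adjS tplS by simp
      qed
      done
  next
    case (4 M' c)
    then obtain j where j: "j \<le> s" "M' xI 0 = j" and J: "?J M' j" by blast
    have "M' xS = M xS" using J by simp
    then have "j = s" using 4(2) j s by simp
    then show ?case using J by simp
  qed
qed

lemma wp_copy_top: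
  assumes b: "b = M xBASE 0 + 4 + M xS 0" and qs: "seg (M DD) b qs" "M xQ 0 = length qs"
    and ts: "seg (M TP) 0 ts" "M xTC 0 = length ts" and J: "M xJ 0 = 0"
  shows "wp copy_top M (60 * length ts + 10) (\<lambda>M' _. M' xQ 0 = length (qs @ ts) \<and> seg (M' DD) b (qs @ ts) \<and>
    (\<forall>i. i < b \<or> b + M' xQ 0 \<le> i \<longrightarrow> M' DD i = M DD i) \<and>
    (\<forall>a. a \<notin> {DD, xQ, xJ} \<longrightarrow> M' a = M a))"
proof -
  let ?P = "\<lambda>M' j. M' xQ 0 = length (qs @ take j ts) \<and> seg (M' DD) b (qs @ take j ts) \<and>
    (\<forall>i. i < b \<or> b + M' xQ 0 \<le> i \<longrightarrow> M' DD i = M DD i) \<and>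
    (\<forall>a. a \<notin> {DD, xQ, xJ} \<longrightarrow> M' a = M a)"
  show ?thesis unfolding copy_top_def
  proof (rule wp_While[where I = "\<lambda>M' c. \<exists>j\<le>length ts. M' xJ 0 = j \<and> ?P M' j \<and> 60 * (length ts - j) + 10 \<le> c"], goal_cases)
    case 1
    show ?case by (rule exI[of _ 0]) (use J qs in simp)
  next
    case (2 M' c)
    then show ?case by auto
  next
    case (3 M' c)
    then obtain j where j: "j \<le> length ts" "M' xJ 0 = j" "M' xQ 0 = length (qs @ take j ts)"
      "seg (M' DD) b (qs @ take j ts)" "\<And>i. i < b \<or> b + M' xQ 0 \<le> i \<Longrightarrow> M' DD i = M DD i"
      and fr: "\<And>a. a \<notin> {DD, xQ, xJ} \<Longrightarrow> M' a = M a" and c: "60 * (length ts - j) + 10 \<le> c" by blast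
    have fr': "M' xTC = M xTC" "M' TP = M TP" "M' xBASE = M xBASE" "M' xS = M xS" using fr by simp_all
    have jl: "j < length ts" using 3(2) j(2) ts(2) fr' by simp
    then have c': "60 * (length ts - Suc j) + 60 + 10 \<le> c" using c by linarith
    have z: "M TP j = ts ! j" using ts(1) jl by (simp add: seg_def)
    have tk: "take (Suc j) ts = take j ts @ [ts ! j]" using jl by (rule take_Suc_conv_app_nth)
    have Q: "M' xQ 0 = length qs + j" using j(3) jl by simp
    have slot: "M xBASE 0 + (4 + (M xS 0 + (length qs + j))) = b + (length qs + j)" using b by simp
    have s: "seg ((M' DD)(b + (length qs + j) := ts ! j)) b (qs @ take (Suc j) ts)"
      using seg_snoc[OF j(4), of "b + (length qs + j)"] jl by (simp add: tk)
    show ?case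
      using c'
      apply -
      apply (rule wp_Set_Seq, simp, simp add: fr' j(2) Q z slot cong: wp_cong)+
      apply (rule wp_Set, simp)
      apply (rule exI[of _ "Suc j"])
      using s s[unfolded fun_upd_def] jl j(2) Q fr j(5) by simp
  next
    case (4 M' c)
    then obtain j where j: "j \<le> length ts" "M' xJ 0 = j" "?P M' j" by blast
    have "M' xTC = M xTC" using j(3) by simp
    then have "j = length ts" using 4(2) j ts(2) by simp
    then show ?case using j(3) by simp
  qed
qed

lemma wp_encode_block:
  assumes M: "M IN = A" and x: "\<And>i. i < s \<Longrightarrow> M ORD (M MB (M BS (M xW 0) + i)) = x i \<and> x i < n"
    and s: "M xS 0 = s" and bs: "M xBASE 0 = base" and z: "\<And>j. base \<le> j \<Longrightarrow> M DD j = 0"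
  defines "adj \<equiv> map (\<lambda>i. concat (map (nbr_entry (M HD) (M LOC) (M xW 0) (M xP 0) s) (nbr_nums (M NUM) (x i)))) [0..<s] @
      [concat (map (\<lambda>i. concat (map (top_entry (M xP 0) i) (nbr_nums (M NUM) (x i)))) [0..<s])]"
    and "cnt \<equiv> \<lambda>i. sum_list (map (edge_count (M HD) (M LOC) (M xW 0) (M xP 0) i) (nbr_nums (M NUM) (x i)))"
  defines "xs \<equiv> [Suc s, \<Sum>i<s. cnt i] @ map (\<lambda>i. length (concat (take i adj))) [0..<Suc (Suc s)] @ concat adj"
  shows "wp encode_block M (100 * s + 200 * (\<Sum>i<s. st (Suc (x i)) - st (x i)) + 200) (\<lambda>M' _.
    seg (M' DD) base xs \<and> M' xHI 0 = length xs \<and> (\<forall>j. base + length xs \<le> j \<longrightarrow> M' DD j = 0) \<and>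
    (\<forall>a. a \<notin> {DD, TP, xK, xE, xX, xI, xU, xQ, xEC, xTC, xJ, xHI} \<longrightarrow> M' a = M a))"
proof -
  let ?adj = "\<lambda>i. concat (map (nbr_entry (M HD) (M LOC) (M xW 0) (M xP 0) s) (nbr_nums (M NUM) (x i)))"
  let ?tp = "\<lambda>i. concat (map (top_entry (M xP 0) i) (nbr_nums (M NUM) (x i)))"
  define X where "X = concat (map ?adj [0..<s])"
  define T where "T = concat (map ?tp [0..<s])"
  let ?d = "\<Sum>i<s. st (Suc (x i)) - st (x i)"
  \<comment> \<open>Each entry gathered for the top vertex stems from one scanned list entry, so
    appending them costs no more than the scan.\<close>
  have lT: "length T \<le> ?d"
  proof -
    have "length (?tp i) \<le> st (Suc (x i)) - st (x i)" for i
    proof -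
      have "length (concat (map (top_entry p i) us)) \<le> length us" for p us
        by (induction us) (auto simp: top_entry_def)
      then show ?thesis using length_nbr_nums by metis
    qed
    then have "sum_list (map (\<lambda>i. length (?tp i)) [0..<s]) \<le> sum_list (map (\<lambda>i. st (Suc (x i)) - st (x i)) [0..<s])"
      by (rule sum_list_mono)
    moreover have "length T = sum_list (map (\<lambda>i. length (?tp i)) [0..<s])"
      by (simp add: T_def length_concat comp_def)
    ultimately show ?thesis by (simp add: interv_sum_list_conv_sum_set_nat lessThan_atLeast0)
  qed
  have adj: "adj = map ?adj [0..<s] @ [T]" by (simp add: adj_def T_def)
  have cadj: "concat adj = X @ T" by (simp add: adj X_def)
  have tk: "concat (take i adj) = concat (map ?adj [0..<i])" if "i \<le> s" for i
    using that by (simp add: adj take_map take_upt)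
  have tks: "concat (take (Suc s) adj) = X @ T" by (simp add: adj X_def)
  have len: "length xs = 4 + s + length (X @ T)" by (simp add: xs_def cadj)
  show ?thesis
    unfolding encode_block_def
    apply (rule wp_Set_Seq, simp, simp cong: wp_cong)+
    apply (rule wp_Seq)
    apply (rule wp_call[OF wp_scan_members[where s = s and x = x and base = base]])
            apply (use M x s bs in simp_all)[9]
    subgoal premises p for M1 c1
    proof -
      have Q1: "M1 xQ 0 = length X" "seg (M1 DD) (base + 4 + s) X"
        and T1: "M1 xTC 0 = length T" "seg (M1 TP) 0 T"
        and E1: "M1 xEC 0 = (\<Sum>i<s. cnt i)"
        and S1: "\<And>i. i < s \<Longrightarrow> M1 DD (base + 2 + i) = length (concat (map ?adj [0..<i]))"
        using p(1) by (simp_all add: X_def T_def cnt_def)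
      have H1: "\<And>i. i \<ge> base + 4 + s + length X \<Longrightarrow> M1 DD i = 0"
        using p(1) z Q1(1) by simp
      have F1: "\<And>a. a \<notin> {DD, TP, xK, xE, xX, xI, xU, xQ, xEC, xTC} \<Longrightarrow> M1 a = M a"
        using p(1) by simp
      have F1': "M1 xS 0 = s" "M1 xBASE 0 = base" using F1 s bs by simp_all
      have c1: "80 * ?d + 140 \<le> c1" using p(2) by simp
      let ?D = "(M1 DD)(base + Suc (Suc s) := length X)"
      have sD: "seg ?D (base + 4 + s) X" using Q1(2) by (simp add: seg_upd_other)
      show ?thesis
        using c1
        apply -
        apply (rule wp_Set_Seq, simp, simp add: F1' Q1(1) cong: wp_cong)+
        apply (rule wp_Seq)
        apply (rule wp_call[OF wp_copy_top[where b = "base + 4 + s" and qs = X and ts = T]])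
               apply (simp add: F1')
              apply (use sD in \<open>simp add: fun_upd_def\<close>)
             apply (use Q1 T1 in simp_all)[4]
         apply (use lT in simp)
        subgoal premises q for M2 c2
        proof -
          have Q2: "M2 xQ 0 = length (X @ T)" "seg (M2 DD) (base + 4 + s) (X @ T)" using q(2) by simp_all
          have D2: "M2 DD i = ?D i" if "i < base + 4 + s \<or> base + 4 + s + length (X @ T) \<le> i" for i
            using that q(2) Q2(1) by (elim disjE) simp_all
          have F2: "\<And>a. a \<notin> {DD, TP, xK, xE, xX, xI, xU, xQ, xEC, xTC, xJ} \<Longrightarrow> M2 a = M a"
            using q(2) F1 by simp
          have F2': "M2 xS 0 = s" "M2 xBASE 0 = base" "M2 xEC 0 = (\<Sum>i<s. cnt i)" using F2 s bs E1 q(2) by simp_all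
          have c2: "60 \<le> c2" using q(1,3) lT by simp
          let ?E = "(M2 DD)(base + Suc (Suc (Suc s)) := length X + length T, base := Suc s, Suc base := (\<Sum>i<s. cnt i))"
          have e1: "seg ?E base [Suc s, \<Sum>i<s. cnt i]" by (simp add: seg_Cons)
          have e2: "seg ?E (base + 2) (map (\<lambda>i. length (concat (take i adj))) [0..<Suc (Suc s)])"
            unfolding seg_def
          proof (intro allI impI)
            fix i assume "i < length (map (\<lambda>i. length (concat (take i adj))) [0..<Suc (Suc s)])"
            then have i: "i < Suc (Suc s)" by simp
            then have n: "map (\<lambda>i. length (concat (take i adj))) [0..<Suc (Suc s)] ! i = length (concat (take i adj))"
              by (simp del: upt_Suc)
            consider "i = Suc s" | "i = s" | "i < s" using i by linarith
            then show "?E (base + 2 + i) = map (\<lambda>i. length (concat (take i adj))) [0..<Suc (Suc s)] ! i"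
              unfolding n
            proof cases
              case 1
              then show "?E (base + 2 + i) = length (concat (take i adj))" using tks by simp
            next
              case 2
              then show "?E (base + 2 + i) = length (concat (take i adj))"
                using D2[of "base + 2 + s"] tk[of s] by (simp add: X_def)
            next
              case 3
              then show "?E (base + 2 + i) = length (concat (take i adj))"
                using D2[of "base + 2 + i"] tk[of i] S1[of i] by simp
            qed
          qed
          have e3: "seg ?E (base + 4 + s) (concat adj)"
            unfolding cadj using Q2(2) by (simp add: seg_upd_other)
          have idx: "base + 4 + s = Suc (Suc (Suc (Suc (base + s))))" by simp
          have "seg ?E base xs"
            unfolding xs_def seg_append using e1 e2 e3[unfolded idx] by (simp add: add.assoc del: upt_Suc)
          then have fin: "seg ?E base xs" "seg (\<lambda>i. if i = Suc base then (\<Sum>i<s. cnt i) else if i = base then Suc s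
             else if i = Suc (Suc (Suc (base + s))) then length X + length T else M2 DD i) base xs"
            by (simp_all add: fun_upd_def)
          have idx3: "base + (3 + s) = Suc (Suc (Suc (base + s)))" by simp
          have H2: "M2 DD i = 0" if "base + 4 + s + length (X @ T) \<le> i" for i
            using D2[of i] H1[of i] that by simp
          show ?thesis
            using c2
            apply -
            apply (rule wp_Set_Seq, simp, simp add: F2' Q2(1) cong: wp_cong)+
            apply (rule wp_Set, simp)
            using fin len F2 H2 by (simp add: F2' Q2(1) idx3 s)
        qed
        done
    qed
    done
qed

end

section \<open>The blocks of the input graph\<close>

lemma set_members: "set (members h n w) = {i. 1 \<le> i \<and> i \<le> n \<and> h i = w}"
  by (auto simp: members_def)

lemma distinct_members: "distinct (members h n w)"
  by (simp add: members_def)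

text \<open>Members are listed in increasing order, so the position recorded when \<open>i\<close>
  was appended stays its position in the complete list.\<close>

lemma members_nth:
  assumes "1 \<le> i" "i \<le> n" "h i = w"
  shows "length (members h (i - 1) w) < length (members h n w) \<and> members h n w ! length (members h (i - 1) w) = i"
proof -
  have "[1..<Suc n] = [1..<i] @ [i..<Suc n]" using upt_add_eq_append[of 1 i "Suc n - i"] assms by simp
  also have "[i..<Suc n] = i # [Suc i..<Suc n]" using assms by (simp add: upt_conv_Cons del: upt_Suc)
  finally have "members h n w = members h (i - 1) w @ i # filter (\<lambda>j. h j = w) [Suc i..<Suc n]"
    using assms by (simp add: members_def del: upt_Suc)
  then show ?thesis by simp
qed

locale analysed_graph = input A n for A n +
  fixes num ord par hd loc :: "nat \<Rightarrow> nat" and G :: "'a graph" and vs :: "'a list"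
  assumes distinct_vs: "distinct vs" and set_vs: "set vs = verts G" and length_vs: "length vs = n"
    and simple: "simple_graph G"
    and nbr_iff: "\<And>v u. v < n \<Longrightarrow> u < n \<Longrightarrow> nbr v u \<longleftrightarrow> {vs ! v, vs ! u} \<in> edges G"
    and tgt_distinct: "\<And>v. v < n \<Longrightarrow> distinct (map tgt [st v..<st (Suc v)])"
    and dfs_done: "dfs_done num ord par"
    and head_eq: "\<And>i. 1 \<le> i \<Longrightarrow> i \<le> n \<Longrightarrow> hd i =
      (if \<exists>z a. (z, i) \<in> {(y, par y) |y. 1 \<le> y \<and> y \<le> n}\<^sup>* \<and>
        (1 \<le> z \<and> z \<le> n \<and> 1 \<le> a \<and> a \<le> n \<and> nbr (ord z) (ord a)) \<and> a < par i then hd (par i) else i)"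
    and loc_eq: "\<And>i. 1 \<le> i \<Longrightarrow> i \<le> n \<Longrightarrow> loc i = length (members hd (i - 1) (hd i))"
begin

lemma numD: "v < n \<Longrightarrow> 1 \<le> num v \<and> num v \<le> n \<and> ord (num v) = v"
  by (rule dfs_done_num[OF dfs_done])

lemma ordD: "1 \<le> i \<Longrightarrow> i \<le> n \<Longrightarrow> ord i < n \<and> num (ord i) = i \<and> par i < i \<and>
    (par i \<noteq> 0 \<longrightarrow> nbr (ord (par i)) (ord i))"
  by (rule dfs_done_ord[OF dfs_done])

abbreviation vx :: "nat \<Rightarrow> 'a" where "vx i \<equiv> vs ! ord i"

abbreviation adjacent :: "nat \<Rightarrow> nat \<Rightarrow> bool" where
  "adjacent \<equiv> \<lambda>i j. i \<in> {1..n} \<and> j \<in> {1..n} \<and> {vx i, vx j} \<in> edges G"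

lemma nbr_ord: "1 \<le> i \<Longrightarrow> i \<le> n \<Longrightarrow> 1 \<le> j \<Longrightarrow> j \<le> n \<Longrightarrow> nbr (ord i) (ord j) \<longleftrightarrow> adjacent i j"
  using nbr_iff ordD by auto

lemma bij_vx: "bij_betw vx {1..n} (verts G)"
proof -
  have "bij_betw ord {1..n} {..<n}"
    by (rule bij_betw_byWitness[where f' = num]) (use numD ordD in auto)
  moreover have "bij_betw ((!) vs) {..<n} (verts G)"
    using bij_betw_nth[OF distinct_vs] length_vs set_vs by simp
  ultimately show ?thesis using bij_betw_trans[of ord] by (simp add: comp_def)
qed

lemma no_loop: "{x} \<notin> edges G"
  using simple by (auto simp: simple_graph_def)

sublocale numbered_graph n par hd vx G
proof
  show "par i < i" if "1 \<le> i" "i \<le> n" for i using ordD[OF that] by simp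
  show "adjacent j i" if "adjacent i j" for i j using that by (simp add: insert_commute)
  show "\<not> adjacent i i" for i using no_loop by simp
  show "1 \<le> i \<and> i \<le> n" if "adjacent i j" for i j using that by simp
  show "adjacent (par i) i" if "1 \<le> i" "i \<le> n" "par i \<noteq> 0" for i
    using ordD[OF that(1,2)] that nbr_ord[of "par i" i] by simp
  show "a \<le> par i" if "a < i" "i \<le> u" "adjacent a u" for a i u
  proof -
    have "nbr (ord a) (ord u)" using nbr_ord[of a u] that by simp
    then show ?thesis
      using conjunct2[OF conjunct2[OF dfs_done[unfolded dfs_done_def]], rule_format, of a i u] that by simp
  qed
  show "hd i = (if \<exists>z a. (z, i) \<in> {(y, par y) |y. 1 \<le> y \<and> y \<le> n}\<^sup>* \<and> adjacent z a \<and> a < par i then hd (par i) else i)"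
    if "1 \<le> i" "i \<le> n" for i
  proof -
    have "(1 \<le> z \<and> z \<le> n \<and> 1 \<le> a \<and> a \<le> n \<and> nbr (ord z) (ord a)) \<longleftrightarrow> adjacent z a" for z a
      using nbr_ord[of z a] by auto
    then show ?thesis using head_eq[OF that] by simp
  qed
  show "bij_betw vx {1..n} (verts G)" by (rule bij_vx)
  show "simple_graph G" by (rule simple)
qed

text \<open>The order of the cells of \<open>MB\<close> once the top vertex has been written behind
  the members; local vertex numbers are positions in this list.\<close>

definition block_list :: "nat \<Rightarrow> nat list" where
  "block_list w = members hd n w @ (if par w = 0 then [] else [par w])"

abbreviation block_verts :: "nat \<Rightarrow> 'a list" where
  "block_verts w \<equiv> map vx (block_list w)"

lemma par_not_member: "w \<in> heads \<Longrightarrow> hd (par w) \<noteq> w \<or> par w = 0"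
  using par_hd_less[of w] by (cases "par w = 0") auto

lemma set_block_list: "w \<in> heads \<Longrightarrow> set (block_list w) = block w"
  by (auto simp: block_list_def block_def set_members)

lemma distinct_block_list: "w \<in> heads \<Longrightarrow> distinct (block_list w)"
  using par_not_member[of w] by (auto simp: block_list_def distinct_members set_members)

lemma distinct_block_verts: "w \<in> heads \<Longrightarrow> distinct (block_verts w)"
  using distinct_block_list[of w] inj_v[of "set (block_list w)"] block_subset[of w]
  by (simp add: distinct_map set_block_list)

lemma set_block_verts: "w \<in> heads \<Longrightarrow> set (block_verts w) = vx ` block w"
  by (simp add: set_block_list)

lemma length_block_list: "w \<in> heads \<Longrightarrow> length (block_list w) = card (block w)"
  using distinct_card[OF distinct_block_list, of w] set_block_list[of w] by simp

lemma block_list_loc: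
  assumes "1 \<le> u" "u \<le> n" "hd u = w"
  shows "loc u < length (members hd n w) \<and> block_list w ! loc u = u"
  using members_nth[where h = hd, OF assms] loc_eq[OF assms(1,2)] assms(3) by (simp add: block_list_def nth_append)

lemma nbr_nums_adjacent:
  assumes "1 \<le> y" "y \<le> n"
  shows "set (nbr_nums num (ord y)) = {u. adjacent y u}" "distinct (nbr_nums num (ord y))"
proof -
  have y: "ord y < n" using ordD assms by simp
  have t: "tgt k < n" if "k \<in> set [st (ord y)..<st (Suc (ord y))]" for k using tgt_lt[OF y] that by simp
  have nb: "nbr (ord y) v \<longleftrightarrow> (\<exists>k \<in> set [st (ord y)..<st (Suc (ord y))]. tgt k = v)" for v
    by (auto simp: nbr_def)
  show "set (nbr_nums num (ord y)) = {u. adjacent y u}"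
  proof (intro equalityI subsetI)
    fix u assume "u \<in> set (nbr_nums num (ord y))"
    then obtain k where k: "k \<in> set [st (ord y)..<st (Suc (ord y))]" "u = num (tgt k)"
      unfolding nbr_nums_def by auto
    then have "nbr (ord y) (tgt k)" using nb by blast
    then have "nbr (ord y) (ord u)" "1 \<le> u" "u \<le> n" using numD[OF t[OF k(1)]] k(2) by auto
    then show "u \<in> {u. adjacent y u}" using nbr_ord[OF assms, of u] by simp
  next
    fix u assume "u \<in> {u. adjacent y u}"
    then have u: "adjacent y u" "1 \<le> u" "u \<le> n" by auto
    then have "nbr (ord y) (ord u)" using nbr_ord[OF assms, of u] by simp
    then obtain k where k: "k \<in> set [st (ord y)..<st (Suc (ord y))]" "tgt k = ord u" using nb by blast
    then have "num (tgt k) = u" using ordD[OF u(2,3)] by simp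
    then show "u \<in> set (nbr_nums num (ord y))" using k(1) unfolding nbr_nums_def by force
  qed
  have "inj_on num (set (map tgt [st (ord y)..<st (Suc (ord y))]))"
    by (rule inj_on_inverseI[where g = ord]) (use t numD in auto)
  then show "distinct (nbr_nums num (ord y))"
    using tgt_distinct[OF y] unfolding nbr_nums_def map_map[symmetric, unfolded comp_def]
    by (simp add: distinct_map comp_def inj_on_def)
qed

section \<open>The code of a block with a top vertex\<close>

context
  fixes w :: nat
  assumes w: "w \<in> heads" and pw: "par w \<noteq> 0"
begin

abbreviation (input) "ms \<equiv> members hd n w"
abbreviation (input) "sz \<equiv> length (members hd n w)"

definition "pos u = (if u = par w then length (members hd n w) else loc u)"

lemma length_bl: "length (block_list w) = Suc sz"
  using pw by (simp add: block_list_def)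

lemma bl_last: "block_list w ! sz = par w"
  using pw by (simp add: block_list_def nth_append)

lemma bl_member: "i < sz \<Longrightarrow> block_list w ! i = ms ! i"
  by (simp add: block_list_def nth_append)

lemma ms_nth: "i < sz \<Longrightarrow> 1 \<le> ms ! i \<and> ms ! i \<le> n \<and> hd (ms ! i) = w"
  using nth_mem[of i ms] set_members[of hd n w] by auto

lemma pos_inverse:
  assumes "u \<in> block w"
  shows "pos u < Suc sz" "block_list w ! pos u = u" "pos u = sz \<longleftrightarrow> u = par w"
proof -
  have *: "u \<noteq> par w \<Longrightarrow> loc u < sz \<and> block_list w ! loc u = u"
    using assms block_list_loc[of u w] by (auto simp: block_def)
  then show "pos u < Suc sz" "block_list w ! pos u = u" "pos u = sz \<longleftrightarrow> u = par w"
    using bl_last by (auto simp: pos_def)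
qed

lemma pos_bl:
  assumes "j < Suc sz"
  shows "pos (block_list w ! j) = j" "block_list w ! j \<in> block w"
proof -
  show b: "block_list w ! j \<in> block w" using nth_mem[of j "block_list w"] assms length_bl set_block_list[OF w] by simp
  show "pos (block_list w ! j) = j"
    using pos_inverse[OF b] distinct_block_list[OF w] assms length_bl by (simp add: nth_eq_iff_index_eq)
qed

lemma entries_eq:
  "concat (map (nbr_entry hd loc w (par w) sz) us) = map pos (filter (\<lambda>u. u = par w \<or> hd u = w) us)"
  by (induction us) (auto simp: nbr_entry_def pos_def)

lemma tops_eq:
  "distinct us \<Longrightarrow> concat (map (top_entry (par w) i) us) = (if par w \<in> set us then [i] else [])"
  by (induction us) (auto simp: top_entry_def)

lemma counts_eq:
  "i \<le> sz \<Longrightarrow> (\<And>u. u \<in> set us \<Longrightarrow> 1 \<le> u \<and> u \<le> n) \<Longrightarrow>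
    sum_list (map (edge_count hd loc w (par w) i) us) =
    length (filter (\<lambda>u. (u = par w \<or> hd u = w) \<and> (pos u = sz \<or> pos u < i)) us)"
proof (induction us)
  case (Cons u us)
  have "1 \<le> u \<and> u \<le> n" using Cons.prems by simp
  then have "hd u = w \<Longrightarrow> loc u < sz" using block_list_loc by blast
  then show ?case using Cons by (auto simp: edge_count_def pos_def)
qed simp

lemma block_iff: "1 \<le> u \<Longrightarrow> u \<le> n \<Longrightarrow> u \<in> block w \<longleftrightarrow> u = par w \<or> hd u = w"
  by (auto simp: block_def)

lemma pos_nbrs:
  assumes y: "1 \<le> y" "y \<le> n"
  defines "us \<equiv> nbr_nums num (ord y)"
  shows "distinct (map pos (filter (\<lambda>u. (u = par w \<or> hd u = w) \<and> P u) us))"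
    and "set (map pos (filter (\<lambda>u. (u = par w \<or> hd u = w) \<and> P u) us)) =
      {j. j < Suc sz \<and> adjacent y (block_list w ! j) \<and> P (block_list w ! j)}"
proof -
  note us = nbr_nums_adjacent[OF y, folded us_def]
  have S: "set (filter (\<lambda>u. (u = par w \<or> hd u = w) \<and> P u) us) = {u \<in> block w. adjacent y u \<and> P u}"
    using us(1) block_iff by auto
  have "inj_on pos {u \<in> block w. adjacent y u \<and> P u}"
    by (rule inj_on_inverseI[where g = "(!) (block_list w)"]) (use pos_inverse in auto)
  then show "distinct (map pos (filter (\<lambda>u. (u = par w \<or> hd u = w) \<and> P u) us))"
    using us(2) unfolding distinct_map S by simp
  show "set (map pos (filter (\<lambda>u. (u = par w \<or> hd u = w) \<and> P u) us)) =
      {j. j < Suc sz \<and> adjacent y (block_list w ! j) \<and> P (block_list w ! j)}"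
    unfolding set_map S
  proof (intro equalityI subsetI)
    fix j assume "j \<in> pos ` {u \<in> block w. adjacent y u \<and> P u}"
    then obtain u where "u \<in> block w" "adjacent y u" "P u" "j = pos u" by auto
    then show "j \<in> {j. j < Suc sz \<and> adjacent y (block_list w ! j) \<and> P (block_list w ! j)}"
      using pos_inverse[of u] by simp
  next
    fix j assume "j \<in> {j. j < Suc sz \<and> adjacent y (block_list w ! j) \<and> P (block_list w ! j)}"
    then show "j \<in> pos ` {u \<in> block w. adjacent y u \<and> P u}"
      using pos_bl[of j] by (intro image_eqI[of _ _ "block_list w ! j"]) auto
  qed
qed

lemma adjacent_block_verts:
  assumes "i < Suc sz" "j < Suc sz"
  shows "adjacent (block_list w ! i) (block_list w ! j) \<longleftrightarrow>
    {block_verts w ! i, block_verts w ! j} \<in> edges (induced_subgraph G (vx ` block w))"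
  using pos_bl(2)[OF assms(1)] pos_bl(2)[OF assms(2)] block_subset[of w] w length_bl assms by auto

text \<open>Each edge has exactly one orientation from a position \<open>i < sz\<close> to the last
  position or to a smaller one, which gives a bijection with the counted pairs.\<close>

lemma card_block_edges:
  "card (edges (induced_subgraph G (vx ` block w))) =
   (\<Sum>i<sz. card {j. j < Suc sz \<and> adjacent (ms ! i) (block_list w ! j) \<and> (j = sz \<or> j < i)})"
proof -
  let ?E = "edges (induced_subgraph G (vx ` block w))"
  let ?Q = "SIGMA i:{..<sz}. {j. j < Suc sz \<and> adjacent (ms ! i) (block_list w ! j) \<and> (j = sz \<or> j < i)}"
  let ?f = "\<lambda>(i, j). {block_verts w ! i, block_verts w ! j}"
  have nth: "block_verts w ! i = block_verts w ! j \<longleftrightarrow> i = j" if "i < Suc sz" "j < Suc sz" for i j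
    using nth_eq_iff_index_eq[OF distinct_block_verts[OF w]] that length_bl by simp
  have "bij_betw ?f ?Q ?E"
  proof (rule bij_betw_imageI)
    show "inj_on ?f ?Q"
    proof (rule inj_onI)
      fix p q assume "p \<in> ?Q" "q \<in> ?Q" and eq: "?f p = ?f q"
      then obtain i j i' j' where p: "p = (i, j)" "i < sz" "j < Suc sz" "j = sz \<or> j < i"
        and q: "q = (i', j')" "i' < sz" "j' < Suc sz" "j' = sz \<or> j' < i'" by auto
      from eq have "i = i' \<and> j = j' \<or> i = j' \<and> j = i'"
        unfolding p(1) q(1) using nth[of i i'] nth[of j j'] nth[of i j'] nth[of j i'] p q
        by (simp add: doubleton_eq_iff)
      then show "p = q" using p q by auto
    qed
    show "?f ` ?Q = ?E"
    proof (intro equalityI subsetI)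
      fix e assume "e \<in> ?f ` ?Q"
      then obtain i j where "i < sz" "j < Suc sz" "adjacent (ms ! i) (block_list w ! j)"
        "e = {block_verts w ! i, block_verts w ! j}" by auto
      then show "e \<in> ?E" using adjacent_block_verts[of i j] bl_member[of i] by simp
    next
      fix e assume e: "e \<in> ?E"
      then have e': "e \<in> edges G" "e \<subseteq> vx ` block w" by simp_all
      obtain x y where xy: "x \<in> block w" "y \<in> block w" "e = {vx x, vx y}" "x \<noteq> y"
        using edge_ends[OF e'] by blast
      let ?i = "pos x" and ?j = "pos y"
      have ij: "?i < Suc sz" "?j < Suc sz" "block_list w ! ?i = x" "block_list w ! ?j = y"
        using pos_inverse xy by auto
      then have ne: "?i \<noteq> ?j" using xy(4) by auto
      have ev: "e = {block_verts w ! ?i, block_verts w ! ?j}" using ij xy(3) length_bl by simp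
      have wlog: "e \<in> ?f ` ?Q" if "i < Suc sz" "j < Suc sz" "j = sz \<or> j < i" "i \<noteq> j" "i < sz"
        "e = {block_verts w ! i, block_verts w ! j}" for i j
      proof -
        have "adjacent (ms ! i) (block_list w ! j)"
          using adjacent_block_verts[OF that(1,2)] e that(6) bl_member[OF that(5)] by simp
        then show ?thesis using that by (intro image_eqI[of _ _ "(i, j)"]) auto
      qed
      consider "?j = sz \<or> ?j < ?i \<and> ?i \<noteq> sz" | "?i = sz \<or> ?i < ?j \<and> ?j \<noteq> sz" using ne ij by linarith
      then show "e \<in> ?f ` ?Q"
      proof cases
        case 1
        then show ?thesis using wlog[of ?i ?j] ij(1,2) ne ev by linarith
      next
        case 2
        then show ?thesis using wlog[of ?j ?i] ij(1,2) ne ev by (simp add: insert_commute) linarith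
      qed
    qed
  qed
  then have "card ?Q = card ?E" by (rule bij_betw_same_card)
  then have "card ?E = card ?Q" by (rule sym)
  also have "\<dots> = (\<Sum>i<sz. card {j. j < Suc sz \<and> adjacent (ms ! i) (block_list w ! j) \<and> (j = sz \<or> j < i)})"
    by (rule card_SigmaI) auto
  finally show ?thesis .
qed

definition "block_adj = map (\<lambda>i. concat (map (nbr_entry hd loc w (par w) (length (members hd n w))) (nbr_nums num (ord (members hd n w ! i))))) [0..<length (members hd n w)] @
      [concat (map (\<lambda>i. concat (map (top_entry (par w) i) (nbr_nums num (ord (members hd n w ! i))))) [0..<length (members hd n w)])]"

definition "block_code = [Suc (length (members hd n w)), \<Sum>i<length (members hd n w). sum_list (map (edge_count hd loc w (par w) i) (nbr_nums num (ord (members hd n w ! i))))] @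
   map (\<lambda>i. length (concat (take i block_adj))) [0..<Suc (Suc (length (members hd n w)))] @ concat block_adj"

text \<open>The rows of the members come from their own lists. The row of the top vertex consists of
  the members in whose lists it was met, which is right by symmetry of adjacency; the encoding
  leaves the order inside a row free.\<close>

lemma block_code_encodes: "encodes_graph (block_verts w) block_code (induced_subgraph G (vx ` block w))"
proof -
  let ?nl = "\<lambda>i. nbr_nums num (ord (ms ! i))"
  let ?H = "induced_subgraph G (vx ` block w)"
  have nl: "set (?nl i) = {u. adjacent (ms ! i) u}" "distinct (?nl i)" if "i < sz" for i
    using nbr_nums_adjacent ms_nth[OF that] by blast+
  let ?T = "concat (map (\<lambda>i. concat (map (top_entry (par w) i) (?nl i))) [0..<sz])"
  have "?T = concat (map (\<lambda>i. if par w \<in> set (?nl i) then [i] else []) [0..<sz])"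
    using tops_eq nl(2) by (intro arg_cong[where f = concat] map_cong) auto
  also have "\<dots> = filter (\<lambda>i. par w \<in> set (?nl i)) [0..<sz]"
  proof -
    have "concat (map (\<lambda>i. if P i then [i] else []) zs) = filter P zs" for P and zs :: "nat list"
      by (induction zs) auto
    then show ?thesis .
  qed
  finally have T: "?T = filter (\<lambda>i. par w \<in> set (?nl i)) [0..<sz]" .
  have len: "length block_adj = Suc sz" by (simp add: block_adj_def)
  have adj_lt: "block_adj ! i = map pos (filter (\<lambda>u. (u = par w \<or> hd u = w) \<and> True) (?nl i))" if "i < sz" for i
    using that entries_eq by (simp add: block_adj_def nth_append)
  have adj_last: "block_adj ! sz = ?T" by (simp add: block_adj_def nth_append)
  have E: "{j. j < Suc sz \<and> adjacent (block_list w ! i) (block_list w ! j)} =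
      {j. j < length (block_verts w) \<and> {block_verts w ! i, block_verts w ! j} \<in> edges ?H}" if "i < Suc sz" for i
    unfolding length_map length_bl
    by (rule Collect_cong, rule conj_cong[OF refl], rule adjacent_block_verts[OF that])
  have "distinct (block_adj ! i) \<and> set (block_adj ! i) = {j. j < length (block_verts w) \<and> {block_verts w ! i, block_verts w ! j} \<in> edges ?H}"
    if i: "i < Suc sz" for i
  proof (cases "i < sz")
    case True
    have "set (block_adj ! i) = {j. j < Suc sz \<and> adjacent (ms ! i) (block_list w ! j)}"
      unfolding adj_lt[OF True] using pos_nbrs(2)[of "ms ! i" "\<lambda>_. True"] ms_nth[OF True] by simp
    moreover have "distinct (block_adj ! i)"
      unfolding adj_lt[OF True] using pos_nbrs(1)[of "ms ! i" "\<lambda>_. True"] ms_nth[OF True] by simp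
    ultimately show ?thesis using E[OF i] unfolding bl_member[OF True] by simp
  next
    case False
    then have i_eq: "i = sz" using i by simp
    have "set ?T = {j. j < sz \<and> adjacent (ms ! j) (par w)}" unfolding T using nl(1) by auto
    also have "\<dots> = {j. j < Suc sz \<and> adjacent (block_list w ! sz) (block_list w ! j)}"
    proof -
      have "adjacent (ms ! j) (par w) \<longleftrightarrow> adjacent (block_list w ! sz) (block_list w ! j)" if "j < sz" for j
        using bl_member[OF that] bl_last by (auto simp: insert_commute)
      moreover have "\<not> adjacent (block_list w ! sz) (block_list w ! sz)" using no_loop by simp
      ultimately show ?thesis by (auto simp: less_Suc_eq)
    qed
    finally have "set ?T = {j. j < Suc sz \<and> adjacent (block_list w ! sz) (block_list w ! j)}" .
    moreover have "distinct ?T" unfolding T by simp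
    ultimately show ?thesis unfolding i_eq adj_last using E[of sz] by simp
  qed
  moreover have "(\<Sum>i<sz. sum_list (map (edge_count hd loc w (par w) i) (?nl i))) = card (edges ?H)"
    unfolding card_block_edges
  proof (rule sum.cong[OF refl])
    fix i assume "i \<in> {..<sz}"
    then have i: "i < sz" by simp
    let ?P = "\<lambda>u. pos u = sz \<or> pos u < i"
    let ?L = "map pos (filter (\<lambda>u. (u = par w \<or> hd u = w) \<and> ?P u) (?nl i))"
    have "sum_list (map (edge_count hd loc w (par w) i) (?nl i)) = length ?L"
      using counts_eq[of i "?nl i"] i nl(1)[OF i] by simp
    also have "\<dots> = card (set ?L)"
      using distinct_card[OF pos_nbrs(1)[of "ms ! i" ?P]] ms_nth[OF i] by simp
    also have "set ?L = {j. j < Suc sz \<and> adjacent (ms ! i) (block_list w ! j) \<and> ?P (block_list w ! j)}"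
      by (rule pos_nbrs(2)) (use ms_nth[OF i] in auto)
    also have "\<dots> = {j. j < Suc sz \<and> adjacent (ms ! i) (block_list w ! j) \<and> (j = sz \<or> j < i)}"
      using pos_bl(1) by auto
    finally show "sum_list (map (edge_count hd loc w (par w) i) (?nl i)) =
      card {j. j < Suc sz \<and> adjacent (ms ! i) (block_list w ! j) \<and> (j = sz \<or> j < i)}" .
  qed
  ultimately show ?thesis
    unfolding encodes_graph_def block_code_def
    using distinct_block_verts[OF w] set_block_verts[OF w] len length_bl
    by (intro conjI exI[of _ block_adj]) (simp_all del: upt_Suc)
qed

end

end

section \<open>Decompositions as lists of vertex indices\<close>

lemma refined_tree_decomposition_cong:
  assumes "refined_tree_decomposition l G T X U" "\<And>t. t \<in> verts T \<Longrightarrow> X' t = X t" "\<And>t. t \<in> verts T \<Longrightarrow> U' t = U t"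
  shows "refined_tree_decomposition l G T X' U'"
proof -
  have "{t \<in> verts T. u \<in> X' t} = {t \<in> verts T. u \<in> X t}" for u using assms(2) by auto
  then show ?thesis
    using assms unfolding refined_tree_decomposition_def tree_decomposition_def by simp
qed

text \<open>The residual bound is stated bag by bag and in terms of \<open>G\<close> instead of by a
  maximum over one decomposition. In this form it is inherited by a glued decomposition without any
  computation.\<close>

definition good :: "'a graph \<Rightarrow> 'a list \<Rightarrow> nat \<Rightarrow> int \<Rightarrow> 'a set \<Rightarrow> (nat \<times> nat) list \<Rightarrow> nat list list \<Rightarrow> nat list list \<Rightarrow> bool" where
  "good G vs l r S es xb ub \<longleftrightarrow> length ub = length xb \<and> 0 < length xb \<and> length es = length xb - 1 \<and>
    (\<forall>t<length xb. distinct (xb ! t) \<and> set (xb ! t) \<subseteq> {..<length vs} \<and> distinct (ub ! t) \<and> set (ub ! t) \<subseteq> {..<length vs}) \<and>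
    refined_tree_decomposition l (induced_subgraph G S) ({..<length xb}, (\<lambda>(a, b). {a, b}) ` set es)
      (\<lambda>t. (!) vs ` set (xb ! t)) (\<lambda>t. (!) vs ` set (ub ! t)) \<and>
    (\<forall>t<length xb. int (independence_number (induced_subgraph G ((!) vs ` set (xb ! t) - (!) vs ` set (ub ! t)))) \<le> r)"

lemma goodD:
  assumes "good G vs l r S es xb ub"
  shows "length ub = length xb" "0 < length xb" "length es = length xb - 1"
    "\<And>t. t < length xb \<Longrightarrow> distinct (xb ! t) \<and> set (xb ! t) \<subseteq> {..<length vs} \<and> distinct (ub ! t) \<and> set (ub ! t) \<subseteq> {..<length vs}"
    "refined_tree_decomposition l (induced_subgraph G S) ({..<length xb}, (\<lambda>(a, b). {a, b}) ` set es)
      (\<lambda>t. (!) vs ` set (xb ! t)) (\<lambda>t. (!) vs ` set (ub ! t))"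
    "\<And>t. t < length xb \<Longrightarrow> int (independence_number (induced_subgraph G ((!) vs ` set (xb ! t) - (!) vs ` set (ub ! t)))) \<le> r"
  using assms unfolding good_def by blast+

definition shift_edges :: "nat \<Rightarrow> (nat \<times> nat) list \<Rightarrow> (nat \<times> nat) list" where
  "shift_edges N es = map (\<lambda>(a, b). (a + N, b + N)) es"

lemma flat_shift_edges: "flat_edges (shift_edges N es) = map (\<lambda>x. x + N) (flat_edges es)"
  unfolding flat_edges_def shift_edges_def by (induction es) auto

lemma flat_edges_append: "flat_edges (es @ es') = flat_edges es @ flat_edges es'"
  by (simp add: flat_edges_def)

lemma set_shift_edges:
  "(\<lambda>(a, b). {a, b}) ` set (shift_edges N es) = (`) ((+) N) ` (\<lambda>(a, b). {a, b}) ` set es"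
  unfolding shift_edges_def by (force simp: image_image add.commute)

text \<open>The edge list has the order in which the program writes: old edges, shifted edges of the
  new part, and the linking edge last.\<close>

lemma good_glue:
  assumes 1: "good G vs l r S1 es1 xb1 ub1" and 2: "good G vs l r S2 es2 xb2 ub2"
    and h: "h < length xb1" "h' < length xb2" "S1 \<inter> S2 \<subseteq> (!) vs ` set (xb1 ! h)" "S1 \<inter> S2 \<subseteq> (!) vs ` set (xb2 ! h')"
    and cov: "\<And>e. e \<in> edges G \<Longrightarrow> e \<subseteq> S1 \<union> S2 \<Longrightarrow> e \<subseteq> S1 \<or> e \<subseteq> S2"
  shows "good G vs l r (S1 \<union> S2) (es1 @ shift_edges (length xb1) es2 @ [(h, length xb1 + h')]) (xb1 @ xb2) (ub1 @ ub2)"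
proof -
  note d1 = goodD[OF 1] and d2 = goodD[OF 2]
  let ?N = "length xb1"
  let ?T = "({..<?N + length xb2}, insert {h, ?N + h'} ((\<lambda>(a, b). {a, b}) ` set es1 \<union> (`) ((+) ?N) ` (\<lambda>(a, b). {a, b}) ` set es2))"
  have R: "refined_tree_decomposition l (induced_subgraph G (S1 \<union> S2)) ?T
     (glue ?N (\<lambda>t. (!) vs ` set (xb1 ! t)) (\<lambda>t. (!) vs ` set (xb2 ! t)))
     (glue ?N (\<lambda>t. (!) vs ` set (ub1 ! t)) (\<lambda>t. (!) vs ` set (ub2 ! t)))"
    using refined_tree_decomposition_glue[OF d1(5) _ d2(5) _ h cov] by simp
  have T: "?T = ({..<length (xb1 @ xb2)}, (\<lambda>(a, b). {a, b}) ` set (es1 @ shift_edges ?N es2 @ [(h, ?N + h')]))"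
    using set_shift_edges[of ?N es2] by (auto simp: image_Un)
  show ?thesis
    unfolding good_def
  proof (intro conjI allI impI)
    show "refined_tree_decomposition l (induced_subgraph G (S1 \<union> S2))
      ({..<length (xb1 @ xb2)}, (\<lambda>(a, b). {a, b}) ` set (es1 @ shift_edges ?N es2 @ [(h, ?N + h')]))
      (\<lambda>t. (!) vs ` set ((xb1 @ xb2) ! t)) (\<lambda>t. (!) vs ` set ((ub1 @ ub2) ! t))"
      using R unfolding T by (rule refined_tree_decomposition_cong) (use d1 in \<open>auto simp: glue_def nth_append\<close>)
    show "length (es1 @ shift_edges ?N es2 @ [(h, ?N + h')]) = length (xb1 @ xb2) - 1"
    proof -
      have "length (es1 @ shift_edges ?N es2 @ [(h, ?N + h')]) = length es1 + length es2 + 1"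
        by (simp add: shift_edges_def)
      then show ?thesis using d1(2,3) d2(2,3) unfolding length_append by linarith
    qed
    fix t assume t: "t < length (xb1 @ xb2)"
    have "t - ?N < length xb2" if "\<not> t < ?N" using t that by simp
    then show "distinct ((xb1 @ xb2) ! t)" "set ((xb1 @ xb2) ! t) \<subseteq> {..<length vs}"
        "distinct ((ub1 @ ub2) ! t)" "set ((ub1 @ ub2) ! t) \<subseteq> {..<length vs}"
        "int (independence_number (induced_subgraph G ((!) vs ` set ((xb1 @ xb2) ! t) - (!) vs ` set ((ub1 @ ub2) ! t)))) \<le> r"
      using d1(4,6)[of t] d2(4,6)[of "t - ?N"] d1(1) by (auto simp: nth_append split: if_splits)
  qed (use d1 d2 in auto)
qed

lemma good_encodes:
  assumes g: "good G vs l r (verts G) es xb ub" and G: "simple_graph G"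
  defines "T \<equiv> ({..<length xb}, (\<lambda>(a, b). {a, b}) ` set es)"
    and "X \<equiv> \<lambda>t. (!) vs ` set (xb ! t)" and "U \<equiv> \<lambda>t. (!) vs ` set (ub ! t)"
  shows "encodes_decomposition vs (length xb # flat_edges es @ flat_pairs (zip xb ub)) T X U"
    "refined_tree_decomposition l G T X U" "card (verts T) = length xb"
    "int (residual_independence_number G T X U) \<le> r"
proof -
  note d = goodD[OF g]
  show "encodes_decomposition vs (length xb # flat_edges es @ flat_pairs (zip xb ub)) T X U"
    unfolding encodes_decomposition_def
    by (intro exI[of _ "length xb"] exI[of _ es] exI[of _ xb] exI[of _ ub])
      (use d(1-4) in \<open>auto simp: T_def X_def U_def flat_edges_def flat_pairs_def\<close>)
  show "refined_tree_decomposition l G T X U" using d(5) induced_verts[OF G] by (simp add: T_def X_def U_def)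
  show "card (verts T) = length xb" by (simp add: T_def)
  have "residual_independence_number G T X U \<in> (\<lambda>t. independence_number (induced_subgraph G (X t - U t))) ` verts T"
    unfolding residual_independence_number_def by (rule Max_in) (use d(2) in \<open>auto simp: T_def\<close>)
  then obtain t where "t < length xb" "residual_independence_number G T X U = independence_number (induced_subgraph G (X t - U t))"
    by (auto simp: T_def)
  then show "int (residual_independence_number G T X U) \<le> r" using d(6) by (simp add: X_def U_def)
qed

text \<open>Passes from local numbers to input indices. The numbering being injective, bags keep
  their distinctness, and inclusions between vertex sets become inclusions between lists.\<close>

lemma encoded_good:
  assumes E: "encodes_decomposition bs ys T X U" and R: "refined_tree_decomposition l (induced_subgraph G (set bs)) T X U"
    and r: "int (residual_independence_number (induced_subgraph G (set bs)) T X U) \<le> r"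
    and bs: "distinct bs" "bs = map ((!) vs \<circ> gl) [0..<length bs]" "gl ` {..<length bs} \<subseteq> {..<length vs}"
  obtains es xb ub where "ys = length xb # flat_edges es @ flat_pairs (zip xb ub)" "length ub = length xb" "card (verts T) = length xb"
    "\<And>p z. p \<in> set (zip xb ub) \<Longrightarrow> z \<in> bag_of p \<Longrightarrow> z < length bs"
    "good G vs l r (set bs) es (map (map gl) xb) (map (map gl) ub)"
    "\<And>t. t < length xb \<Longrightarrow> set (ub ! t) \<subseteq> set (xb ! t)"
proof -
  obtain N es xb ub where N: "verts T = {..<N}" "edges T = (\<lambda>(a, b). {a, b}) ` set es" "length es = N - 1"
    "length xb = N" "length ub = N"
    and t: "\<And>t. t < N \<Longrightarrow> distinct (xb ! t) \<and> set (xb ! t) \<subseteq> {..<length bs} \<and> X t = (!) bs ` set (xb ! t) \<and>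
               distinct (ub ! t) \<and> set (ub ! t) \<subseteq> {..<length bs} \<and> U t = (!) bs ` set (ub ! t)"
    and ys: "ys = N # flat_edges es @ flat_pairs (zip xb ub)"
    using E unfolding encodes_decomposition_def flat_edges_def flat_pairs_def by blast
  have "verts T \<noteq> {}"
    using R unfolding refined_tree_decomposition_def tree_decomposition_def tree_def connected_def by blast
  then have N0: "0 < N" using N(1) by auto
  have nth: "bs ! z = vs ! gl z" if "z < length bs" for z
    using bs(2) that by (metis (no_types, lifting) add_0 comp_apply diff_zero length_map length_upt nth_map nth_upt)
  have inj: "inj_on gl {..<length bs}"
  proof (rule inj_onI)
    fix x y assume xy: "x \<in> {..<length bs}" "y \<in> {..<length bs}" "gl x = gl y"
    then have "bs ! x = bs ! y" using nth[of x] nth[of y] by simp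
    then show "x = y" using xy bs(1) by (simp add: nth_eq_iff_index_eq)
  qed
  have glb: "gl z < length vs" if "z < length bs" for z using bs(3) that by auto
  have img: "(!) vs ` set (map gl zs) = (!) bs ` set zs" if "set zs \<subseteq> {..<length bs}" for zs
    using that nth by (force simp: image_image)
  have ind: "independence_number (induced_subgraph (induced_subgraph G (set bs)) (X t - U t)) \<le> residual_independence_number (induced_subgraph G (set bs)) T X U"
    if "t < N" for t
    unfolding residual_independence_number_def by (rule Max_ge) (use N(1) that in auto)
  have XB: "X t \<subseteq> set bs" if "t < N" for t using t[OF that] by (auto simp: nth_mem)
  have "good G vs l r (set bs) es (map (map gl) xb) (map (map gl) ub)"
    unfolding good_def
  proof (intro conjI allI impI)
    have "T = ({..<length (map (map gl) xb)}, (\<lambda>(a, b). {a, b}) ` set es)" using N by (simp add: prod_eq_iff)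
    then show "refined_tree_decomposition l (induced_subgraph G (set bs)) ({..<length (map (map gl) xb)}, (\<lambda>(a, b). {a, b}) ` set es)
        (\<lambda>t. (!) vs ` set (map (map gl) xb ! t)) (\<lambda>t. (!) vs ` set (map (map gl) ub ! t))"
      using refined_tree_decomposition_cong[OF R] t img N by simp
    fix s assume "s < length (map (map gl) xb)"
    then have s: "s < N" using N by simp
    show "distinct (map (map gl) xb ! s)" "distinct (map (map gl) ub ! s)"
      using t[OF s] s N inj by (auto simp: distinct_map intro: inj_on_subset)
    show "set (map (map gl) xb ! s) \<subseteq> {..<length vs}" "set (map (map gl) ub ! s) \<subseteq> {..<length vs}"
      using t[OF s] s N by (auto intro!: glb dest: subsetD)
    show "int (independence_number (induced_subgraph G ((!) vs ` set (map (map gl) xb ! s) - (!) vs ` set (map (map gl) ub ! s)))) \<le> r"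
      using ind[OF s] r t[OF s] s N img XB[OF s] by (subst (asm) induced_induced) auto
  qed (use N N0 in auto)
  moreover have "z < length bs" if p: "p \<in> set (zip xb ub)" "z \<in> bag_of p" for p z
  proof -
    obtain s where s: "s < N" "p = (xb ! s, ub ! s)" using p(1) N by (auto simp: set_zip)
    then show ?thesis using t[OF s(1)] p(2) by (auto simp: bag_of_def)
  qed
  moreover have "set (ub ! s) \<subseteq> set (xb ! s)" if s: "s < length xb" for s
  proof
    fix z assume z: "z \<in> set (ub ! s)"
    have s': "s < N" using s N by simp
    have "U s \<subseteq> X s" using R N s' unfolding refined_tree_decomposition_def by simp
    then have "bs ! z \<in> (!) bs ` set (xb ! s)" using t[OF s'] z by auto
    then obtain y where "y \<in> set (xb ! s)" "bs ! y = bs ! z" by auto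
    moreover have "y < length bs" "z < length bs" using calculation t[OF s'] z by auto
    ultimately show "z \<in> set (xb ! s)" using bs(1) by (simp add: nth_eq_iff_index_eq)
  qed
  ultimately show thesis using that[of xb es ub] N ys by simp
qed

text \<open>All vertices form one bag, and the set removed from it takes as many of them as
  \<open>l\<close> permits, leaving \<open>s - l\<close> with truncated subtraction. With at most
  two vertices this is the origin of \<open>2 - l\<close> in the final bound.\<close>

lemma single_bag:
  assumes G: "simple_graph G" and bs: "distinct bs" "set bs = verts G" "bs \<noteq> []"
  defines "s \<equiv> length bs"
  shows "encodes_decomposition bs (1 # flat_pairs [([0..<s], [0..<min l s])]) ({..<1::nat}, {}) (\<lambda>_. set bs) (\<lambda>_. (!) bs ` {..<min l s})"
    and "refined_tree_decomposition l G ({..<1::nat}, {}) (\<lambda>_. set bs) (\<lambda>_. (!) bs ` {..<min l s})"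
    and "residual_independence_number G ({..<1::nat}, {}) (\<lambda>_. set bs) (\<lambda>_. (!) bs ` {..<min l s}) \<le> s - l"
proof -
  have im: "(!) bs ` {..<s} = set bs" using bs by (auto simp: s_def set_conv_nth)
  have inj: "inj_on ((!) bs) {..<min l s}" using bs(1) by (auto simp: inj_on_def nth_eq_iff_index_eq s_def)
  have im': "(!) bs ` {..<min l s} \<subseteq> set bs" by (auto simp: s_def)
  show "encodes_decomposition bs (1 # flat_pairs [([0..<s], [0..<min l s])]) ({..<1::nat}, {}) (\<lambda>_. set bs) (\<lambda>_. (!) bs ` {..<min l s})"
    unfolding encodes_decomposition_def
    by (intro exI[of _ 1] exI[of _ "[]"] exI[of _ "[[0..<s]]"] exI[of _ "[[0..<min l s]]"])
      (use im in \<open>auto simp: s_def atLeast0LessThan\<close>)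
  have con: "connected (induced_subgraph ({..<1::nat}, {}) {t. t < Suc 0})"
    by (rule connectedI[of 0]) auto
  have "tree ({..<1::nat}, {})"
    unfolding tree_def
  proof (intro conjI notI)
    show "simple_graph ({..<1::nat}, {})" by (simp add: simple_graph_def)
    show "connected ({..<1::nat}, {})" by (rule connectedI[of 0]) auto
    assume "\<exists>p. cycle ({..<1::nat}, {}) p"
    then obtain p where "cycle ({..<1::nat}, {}) p" ..
    then have "3 \<le> length p" "\<forall>i<length p. False" by (simp_all add: cycle_def)
    moreover from this have "0 < length p" by linarith
    ultimately show False by blast
  qed
  then show "refined_tree_decomposition l G ({..<1::nat}, {}) (\<lambda>_. set bs) (\<lambda>_. (!) bs ` {..<min l s})"
    unfolding refined_tree_decomposition_def tree_decomposition_def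
    using bs G im' con card_image[OF inj] by (auto simp: simple_graph_def)
  have fin: "finite (set bs - (!) bs ` {..<min l s})" by simp
  have "card (set bs - (!) bs ` {..<min l s}) = s - l"
    using card_Diff_subset[OF _ im'] card_image[OF inj] distinct_card[OF bs(1)] by (simp add: s_def)
  then show "residual_independence_number G ({..<1::nat}, {}) (\<lambda>_. set bs) (\<lambda>_. (!) bs ` {..<min l s}) \<le> s - l"
    using independence_number_le_card[OF fin, of G] by (subst residual_le_iff) auto
qed

section \<open>Solving and gluing the blocks\<close>

text \<open>The expression \<open>2 - (1 - p)\<close> is the size of the block, 1 at a root and 2
  otherwise. For size 1, cell 3 is overwritten by the size of the second set; cells beyond the
  encoded length are never copied.\<close>

definition small_block :: "nat \<Rightarrow> com" where
  "small_block l = (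
     Set OA (Const 0) (Const 1) ;;
     Set OA (Const 1) (Minus (Const 2) (Minus (Const 1) (V xP))) ;;
     Set OA (Const 2) (Const 0) ;;
     Set OA (Const 3) (Const 1) ;;
     Set OA (Plus (Const 2) (Get OA (Const 1))) (Minus (Get OA (Const 1)) (Minus (Get OA (Const 1)) (Const l))) ;;
     Set OA (Plus (Const 3) (Get OA (Const 1))) (Const 0) ;;
     Set OA (Plus (Const 4) (Get OA (Const 1))) (Const 1))"

lemma wp_small_block:
  assumes s: "s = (if M xP 0 = 0 then 1 else 2)"
  shows "wp (small_block l) M 100 (\<lambda>M' _. seg (M' OA) 0 (1 # flat_pairs [([0..<s], [0..<min l s])]) \<and>
     (\<forall>a. a \<noteq> OA \<longrightarrow> M' a = M a))"
proof -
  have l: "l = 0 \<or> l = 1 \<or> (\<exists>k. l = k + 2)" by presburger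
  show ?thesis
  proof (cases "M xP 0 = 0")
    case True
    then have s1: "s = 1" using s by simp
    show ?thesis
      unfolding small_block_def
      apply (rule wp_Set_Seq, simp, simp add: True cong: wp_cong)+
      apply (rule wp_Set, simp)
      using l by (auto simp: s1 seg_Cons numeral_eq_Suc)
  next
    case False
    then have s2: "s = 2" using s by simp
    from False have e: "2 - (Suc 0 - M xP 0) = 2" by simp
    show ?thesis
      unfolding small_block_def
      apply (rule wp_Set_Seq, simp, simp add: e cong: wp_cong)+
      apply (rule wp_Set, simp)
      using l by (auto simp: s2 seg_Cons numeral_eq_Suc)
  qed
qed

definition solve_block :: "com \<Rightarrow> nat \<Rightarrow> com" where
  "solve_block p l = If (Minus (V xS) (Const 1))
     (encode_block ;; xOP ::= Const 0 ;; rcom p ;; xBASE ::= Plus (V xBASE) (V xHI))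
     (small_block l)"

definition unused_free :: "mem \<Rightarrow> bool" where
  "unused_free M \<longleftrightarrow> (\<forall>a i. M xBASE 0 \<le> i \<longrightarrow> M (a + DD) i = 0)"

text \<open>The graph class has disappeared: what remains of it is that \<open>p\<close> solves the
  2-connected induced subgraphs of \<open>G\<close>.\<close>

locale block_algorithm = analysed_graph A n num ord par hd loc G vs
  for A n num ord par hd loc and G :: "'a graph" and vs :: "'a list" +
  fixes p :: com and l k :: nat and f g :: "nat \<Rightarrow> nat \<Rightarrow> nat"
  assumes solver: "\<And>S. S \<subseteq> verts G \<Longrightarrow> two_connected (induced_subgraph G S) \<Longrightarrow>
      computes_refined_tree_decomposition p l (induced_subgraph G S)
        (f (card S) (card (edges (induced_subgraph G S)))) (g (card S) (card (edges (induced_subgraph G S)))) (int k)"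
    and ord_0: "ord 0 = n" and superadd_f: "superadditive f" and superadd_g: "superadditive g"
begin

definition block_graph :: "nat \<Rightarrow> 'a graph" where "block_graph w = induced_subgraph G (vx ` block w)"
definition size_of :: "nat \<Rightarrow> nat" where "size_of w = length (members hd n w)"
text \<open>The threshold counts members. By \<open>par_of_big\<close>, two of them come with a top
  vertex, which makes the three vertices that 2-connectedness demands.\<close>

definition time_of :: "nat \<Rightarrow> nat" where
  "time_of w = (if 2 \<le> size_of w then f (card (block w)) (card (edges (block_graph w))) else 0)"
definition nodes_of :: "nat \<Rightarrow> nat" where
  "nodes_of w = (if 2 \<le> size_of w then g (card (block w)) (card (edges (block_graph w))) else 1)"
definition deg_of :: "nat \<Rightarrow> nat" where
  "deg_of w = (\<Sum>i<size_of w. st (Suc (ord (members hd n w ! i))) - st (ord (members hd n w ! i)))"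
definition bound :: int where "bound = max (2 - int l) (int k)"

definition static :: "mem \<Rightarrow> bool" where
  "static M \<longleftrightarrow> M IN = A \<and> M NUM = num \<and> M ORD = ord \<and> M PAR = par \<and> M HD = hd \<and> M LOC = loc \<and>
    (\<forall>w. 1 \<le> w \<and> w \<le> n \<longrightarrow> M BS w = w * Suc n) \<and> (\<forall>w. M SZ w = size_of w) \<and>
    (\<forall>w. seg (M MB) (w * Suc n) (members hd n w))"

lemma staticD:
  assumes "static M"
  shows "M IN = A" "M NUM = num" "M ORD = ord" "M PAR = par" "M HD = hd" "M LOC = loc"
    "\<And>w. 1 \<le> w \<Longrightarrow> w \<le> n \<Longrightarrow> M BS w = w * Suc n" "\<And>w. M SZ w = size_of w"
    "\<And>w. seg (M MB) (w * Suc n) (members hd n w)"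
  using assms by (simp_all add: static_def)

lemma static_cong:
  assumes "static M" "\<And>a. a \<in> {IN, NUM, ORD, PAR, HD, LOC, BS, SZ, MB} \<Longrightarrow> M' a = M a"
  shows "static M'"
  using assms by (simp add: static_def)

text \<open>By \<open>hd_root\<close>, a head without a parent is the only member of its
  block.\<close>

lemma par_of_big: "w \<in> heads \<Longrightarrow> 2 \<le> size_of w \<Longrightarrow> par w \<noteq> 0"
proof
  assume w: "w \<in> heads" and s: "2 \<le> size_of w" and pw: "par w = 0"
  have "i = w" if "i \<in> set (members hd n w)" for i
    using hd_root[of i] that pw by (auto simp: set_members)
  then have "set (members hd n w) \<subseteq> {w}" by auto
  then have "card (set (members hd n w)) \<le> 1" using card_mono[of "{w}"] by fastforce
  then show False using s distinct_card[OF distinct_members, of hd n w] by (simp add: size_of_def)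
qed

lemma solver_block: "w \<in> heads \<Longrightarrow> 2 \<le> size_of w \<Longrightarrow>
  computes_refined_tree_decomposition p l (block_graph w) (time_of w) (nodes_of w) (int k)"
proof -
  assume w: "w \<in> heads" and s: "2 \<le> size_of w"
  have sub: "block w \<subseteq> {1..n}" using block_subset w by simp
  have c: "card (vx ` block w) = card (block w)" using card_image inj_v[OF sub] by blast
  have "size_of w \<le> card (block w) \<and> (par w \<noteq> 0 \<longrightarrow> size_of w < card (block w))"
    using length_block_list[OF w] by (auto simp: block_list_def size_of_def)
  then have "3 \<le> card (block w)" using s par_of_big[OF w s] by simp
  then have "two_connected (block_graph w)" unfolding block_graph_def by (rule block_two_connected[OF w])
  then show ?thesis
    using solver[of "vx ` block w"] v_in[OF sub] s c by (simp add: block_graph_def time_of_def nodes_of_def)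
qed

lemma size_pos: "w \<in> heads \<Longrightarrow> 1 \<le> size_of w"
proof -
  assume "w \<in> heads"
  then have "w \<in> set (members hd n w)" by (simp add: set_members)
  then show ?thesis unfolding size_of_def by (cases "members hd n w") auto
qed

text \<open>The bound on the length pays for copying: output is no longer than the running time, and
  the summand 10 allows for the fixed output on small blocks.\<close>

definition solution :: "nat \<Rightarrow> nat list \<Rightarrow> bool" where
  "solution w ys \<longleftrightarrow> (\<exists>T X U. encodes_decomposition (block_verts w) ys T X U \<and>
     refined_tree_decomposition l (block_graph w) T X U \<and>
     int (residual_independence_number (block_graph w) T X U) \<le> bound \<and> card (verts T) \<le> nodes_of w) \<and>
     length ys \<le> time_of w + 10"

lemma small_solution:
  assumes w: "w \<in> heads" and s: "\<not> 2 \<le> size_of w"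
  defines "c \<equiv> (if par w = 0 then 1 else 2)"
  shows "solution w (1 # flat_pairs [([0..<c], [0..<min l c])])"
proof -
  have c: "length (block_verts w) = c"
    using s size_pos[OF w] by (simp add: c_def block_list_def size_of_def)
  have gr: "simple_graph (block_graph w)"
    unfolding block_graph_def using simple_graph_induced[OF simple] v_in[OF block_subset[of w]] w by blast
  have ne: "block_verts w \<noteq> []" using c by (auto simp: c_def split: if_splits)
  have set: "set (block_verts w) = verts (block_graph w)" using set_block_verts[OF w] by (simp add: block_graph_def)
  note B = single_bag[OF gr distinct_block_verts[OF w] set ne, of l, unfolded c]
  have "int (c - l) \<le> bound" by (auto simp: c_def bound_def)
  then have "int (residual_independence_number (block_graph w) ({..<1::nat}, {}) (\<lambda>_. set (block_verts w)) (\<lambda>_. (!) (block_verts w) ` {..<min l c})) \<le> bound"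
    using B(3) by linarith
  moreover have "nodes_of w = 1" using s by (simp add: nodes_of_def)
  moreover have "length (1 # flat_pairs [([0..<c], [0..<min l c])]) \<le> 10" by (auto simp: c_def min_def)
  ultimately show ?thesis unfolding solution_def using B(1,2)
    by (intro conjI exI[of _ "({..<1::nat}, {})"] exI) simp_all
qed

lemma wp_solve_block:
  assumes w: "w \<in> heads" and S: "static M" and free: "unused_free M"
    and M: "M xW 0 = w" "M xS 0 = size_of w" "M xP 0 = par w"
  shows "wp (solve_block p l) M (30 * time_of w + 100 * size_of w + 200 * deg_of w + 400) (\<lambda>M' _.
    (\<exists>ys. seg (M' OA) 0 ys \<and> solution w ys) \<and> unused_free M' \<and>
    (\<forall>a. a < DD \<and> a \<notin> {OA, TP, xK, xE, xX, xI, xU, xQ, xEC, xTC, xJ, xHI, xOP, xBASE} \<longrightarrow> M' a = M a))"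
proof (cases "2 \<le> size_of w")
  case False
  then have s: "size_of w = 1" using size_pos[OF w] by simp
  show ?thesis
    unfolding solve_block_def
    apply (rule wp_If)
      apply simp
     apply (simp add: M s)
    apply (rule wp_call[OF wp_small_block[OF refl]])
     apply simp
    subgoal premises q for M' c'
    proof -
      have "seg (M' OA) 0 (1 # flat_pairs [([0..<if par w = 0 then 1 else 2], [0..<min l (if par w = 0 then 1 else 2)])])"
        using q(2) M(3) by simp
      then have "\<exists>ys. seg (M' OA) 0 ys \<and> solution w ys" using small_solution[OF w False] by blast
      moreover have "unused_free M'" using free q(2) by (simp add: unused_free_def)
      ultimately show ?thesis using q(2) by simp
    qed
    done
next
  case True
  have pw: "par w \<noteq> 0" using par_of_big w True by blast
  have w': "1 \<le> w" "w \<le> n" using w by auto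
  note S' = staticD[OF S]
  have x: "M ORD (M MB (M BS (M xW 0) + i)) = ord (members hd n w ! i) \<and> ord (members hd n w ! i) < n"
    if i: "i < size_of w" for i
  proof -
    have "M MB (w * Suc n + i) = members hd n w ! i" using S'(9)[of w] i by (simp add: seg_def size_of_def)
    moreover have "ord (members hd n w ! i) < n"
      using ms_nth[OF w pw, of i] i ordD[of "members hd n w ! i"] by (simp add: size_of_def)
    ultimately show ?thesis using S'(3) S'(7)[OF w'] M(1) by simp
  qed
  have z: "M DD j = 0" if "M xBASE 0 \<le> j" for j
    using free that unfolding unused_free_def by (metis add_0)
  obtain t ys T X U where h: "halts_with p (block_code w) t ys" "t \<le> time_of w"
    "encodes_decomposition (block_verts w) ys T X U" "refined_tree_decomposition l (block_graph w) T X U"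
    "card (verts T) \<le> nodes_of w" "int (residual_independence_number (block_graph w) T X U) \<le> int k"
    using solver_block[OF w True] block_code_encodes[OF w pw]
    unfolding computes_refined_tree_decomposition_def block_graph_def[symmetric] by blast
  let ?xs = "block_code w"
  have enc: "wp encode_block M (100 * size_of w + 200 * deg_of w + 200) (\<lambda>M' _.
    seg (M' DD) (M xBASE 0) ?xs \<and> M' xHI 0 = length ?xs \<and> (\<forall>j. M xBASE 0 + length ?xs \<le> j \<longrightarrow> M' DD j = 0) \<and>
    (\<forall>a. a \<notin> {DD, TP, xK, xE, xX, xI, xU, xQ, xEC, xTC, xJ, xHI} \<longrightarrow> M' a = M a))"
    using wp_encode_block[where s = "size_of w" and x = "\<lambda>i. ord (members hd n w ! i)" and base = "M xBASE 0", OF S'(1) x M(2) refl z]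
    unfolding M S'(2-6) block_code_def[OF w pw] block_adj_def[OF w pw] deg_of_def size_of_def .
  show ?thesis
    unfolding solve_block_def
    apply (rule wp_If)
      apply simp
     defer
     apply (use M True in simp)
    apply (rule wp_Seq)
    apply (rule wp_call[OF enc])
     apply simp
    subgoal premises q for M1 c1
    proof -
      have F1: "\<And>a. a \<notin> {DD, TP, xK, xE, xX, xI, xU, xQ, xEC, xTC, xJ, xHI} \<Longrightarrow> M1 a = M a" using q(2) by simp
      have base: "M1 xBASE 0 = M xBASE 0" using F1 by simp
      have c1: "30 * time_of w + 150 \<le> c1" using q(3) by simp
      let ?N = "M1(xOP := (M1 xOP)(0 := 0))"
      \<comment> \<open>Seen from the base, array 0 of the call holds the code just written and all
        other arrays are zero, which is the initial memory of \<open>p\<close> on this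
        input.\<close>
      have "?N (a + DD) (M xBASE 0 + i) = init_mem ?xs a i" for a i
      proof (cases "a = 0")
        case True
        then show ?thesis using q(2) by (auto simp: init_mem_def seg_def)
      next
        case False
        have "?N (a + DD) = M (a + DD)" using F1[of "a + DD"] False by simp
        then show ?thesis using free False by (simp add: init_mem_def unused_free_def)
      qed
      then have sm: "sim (init_mem ?xs) [] ?N"
        unfolding sim_def using q(2) base by (auto simp: init_mem_def)
      show ?thesis
        using c1
        apply -
        apply (rule wp_Set_Seq, simp, simp cong: wp_cong)
        apply (rule wp_Seq)
        apply (rule wp_call[OF wp_rcom[OF h(1)]])
          apply (rule sm)
         apply (use h(2) in simp)
        subgoal premises r for M2 c2
        proof -
          have F2: "\<And>a. a < DD \<Longrightarrow> a \<notin> {TP, xK, xE, xX, xI, xU, xQ, xEC, xTC, xJ, xHI, xOP, OA} \<Longrightarrow> M2 a = M a"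
            using r(2) F1 by simp
          have ys: "seg (M2 OA) 0 ys" "length ys \<le> t" using r(2) by simp_all
          have c2: "50 \<le> c2" using r(1,3) h(2) by simp
          have fr: "M2 (a + DD) i = 0" if "M2 xBASE 0 + M2 xHI 0 \<le> i" for a i
          proof -
            have "M2 xHI 0 \<le> i - M2 xBASE 0" using that by linarith
            then have "M2 (a + DD) (M2 xBASE 0 + (i - M2 xBASE 0)) = 0" using r(2) by blast
            then show ?thesis using that by simp
          qed
          have "solution w ys" unfolding solution_def
            by (intro conjI exI[of _ T] exI[of _ X] exI[of _ U]) (use h ys(2) in \<open>auto simp: bound_def\<close>)
          then show ?thesis
            apply -
            apply (rule wp_Set)
            using c2 apply simp
            using ys fr F2 by (auto simp: unused_free_def)
        qed
        done
    qed
    done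
qed

end

text \<open>Number 0, the parent of the roots, stands for a dummy vertex \<open>ord 0 = n\<close> that makes the linking
  of a block uniform: if \<open>w\<close> is a root, its node is linked to that of the previous root.\<close>
definition process_block :: "com \<Rightarrow> nat \<Rightarrow> com" where
  "process_block p l = (
     xS ::= Get SZ (V xW) ;;
     xP ::= Get PAR (V xW) ;;
     Set MB (Plus (Get BS (V xW)) (V xS)) (V xP) ;;
     xH ::= Get HOME (Get ORD (V xP)) ;;
     Set HOME (Get ORD (V xP)) (V xNN) ;;
     solve_block p l ;;
     xI ::= Const 1 ;;
     copy_edges ;;
     xT ::= V xNN ;;
     copy_bags ;;
     If (V xNN)
       (Set EA (V xEN) (V xH) ;; Inc xEN ;;
        Set EA (V xEN) (Get HOME (Get ORD (V xP))) ;; Inc xEN)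
       Skip ;;
     xNN ::= Plus (V xNN) (Get OA (Const 0)))"

section \<open>Invariant of the gluing loop\<close>

context block_algorithm begin

text \<open>At \<open>w = 1\<close> nothing has been built, and a tree cannot be empty, so
  \<open>good\<close> is replaced by empty lists. The clause on \<open>HOME n\<close> concerns the
  dummy. The 12 per block is the 10 of \<open>solution\<close> plus the two entries of a linking
  edge.\<close>

definition progress :: "nat \<Rightarrow> mem \<Rightarrow> (nat \<times> nat) list \<Rightarrow> nat list list \<Rightarrow> nat list list \<Rightarrow> bool" where
  "progress w M es xb ub \<longleftrightarrow>
    M xNN 0 = length xb \<and> M xEN 0 = length (flat_edges es) \<and> seg (M EA) 0 (flat_edges es) \<and>
    M xBN 0 = length (flat_pairs (zip xb ub)) \<and> seg (M BA) 0 (flat_pairs (zip xb ub)) \<and>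
    (if w = 1 then xb = [] \<and> ub = [] \<and> es = [] else good G vs l bound (vx ` before w) es xb ub) \<and>
    (\<forall>i\<in>before w. M HOME (ord i) < length xb \<and> ord i \<in> set (xb ! M HOME (ord i))) \<and>
    (1 < w \<longrightarrow> M HOME n < length xb) \<and>
    length xb \<le> (\<Sum>v | v \<in> heads \<and> v < w. nodes_of v) \<and>
    length (flat_edges es) + length (flat_pairs (zip xb ub)) \<le> (\<Sum>v | v \<in> heads \<and> v < w. time_of v + 12)"

lemma progressD:
  assumes "progress w M es xb ub"
  shows "M xNN 0 = length xb" "M xEN 0 = length (flat_edges es)" "seg (M EA) 0 (flat_edges es)"
    "M xBN 0 = length (flat_pairs (zip xb ub))" "seg (M BA) 0 (flat_pairs (zip xb ub))"
    "w = 1 \<Longrightarrow> xb = [] \<and> ub = [] \<and> es = []" "w \<noteq> 1 \<Longrightarrow> good G vs l bound (vx ` before w) es xb ub"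
    "\<And>i. i \<in> before w \<Longrightarrow> M HOME (ord i) < length xb \<and> ord i \<in> set (xb ! M HOME (ord i))"
    "1 < w \<Longrightarrow> M HOME n < length xb"
    "length xb \<le> (\<Sum>v | v \<in> heads \<and> v < w. nodes_of v)"
    "length (flat_edges es) + length (flat_pairs (zip xb ub)) \<le> (\<Sum>v | v \<in> heads \<and> v < w. time_of v + 12)"
  using assms unfolding progress_def by (auto split: if_splits)

lemma sum_heads_Suc: "w \<in> heads \<Longrightarrow> (\<Sum>v | v \<in> heads \<and> v < Suc w. h v) = (\<Sum>v | v \<in> heads \<and> v < w. h v) + h w"
  for h :: "nat \<Rightarrow> nat"
proof -
  assume "w \<in> heads"
  then have "{v. v \<in> heads \<and> v < Suc w} = insert w {v. v \<in> heads \<and> v < w}" by auto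
  then show ?thesis by simp
qed

lemma sum_heads_skip: "w \<notin> heads \<Longrightarrow> (\<Sum>v | v \<in> heads \<and> v < Suc w. h v) = (\<Sum>v | v \<in> heads \<and> v < w. h v)"
  for h :: "nat \<Rightarrow> nat"
proof -
  assume "w \<notin> heads"
  then have "{v. v \<in> heads \<and> v < Suc w} = {v. v \<in> heads \<and> v < w}" by (auto simp: less_Suc_eq)
  then show ?thesis by simp
qed

lemma before_1: "before 1 = {}"
  using hd_bounds by (force simp: before_def)

lemma progress_skip:
  assumes P: "progress w M es xb ub" and w: "1 \<le> w" "w \<le> n" "hd w \<noteq> w"
  shows "progress (Suc w) M es xb ub"
proof -
  have "w \<noteq> 1" using hd_bounds[of 1] w by auto
  moreover have "w \<notin> heads" using w by simp
  ultimately show ?thesis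
    using P w(1) unfolding progress_def sum_heads_skip[OF \<open>w \<notin> heads\<close>] before_Suc_nohd[OF w] by simp
qed

abbreviation gl :: "nat \<Rightarrow> nat \<Rightarrow> nat" where "gl w z \<equiv> ord (block_list w ! z)"

lemma gl_props:
  assumes w: "w \<in> heads"
  shows "block_verts w = map ((!) vs \<circ> gl w) [0..<length (block_verts w)]"
    "z < length (block_verts w) \<Longrightarrow> gl w z < n"
proof -
  show "block_verts w = map ((!) vs \<circ> gl w) [0..<length (block_verts w)]"
    by (rule nth_equalityI) simp_all
  assume "z < length (block_verts w)"
  then have "block_list w ! z \<in> block w" using nth_mem[of z "block_list w"] set_block_list[OF w] by simp
  then show "gl w z < n" using block_subset[of w] w ordD by auto
qed

lemma ord_eq: "1 \<le> i \<Longrightarrow> i \<le> n \<Longrightarrow> 1 \<le> j \<Longrightarrow> j \<le> n \<Longrightarrow> ord i = ord j \<longleftrightarrow> i = j"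
  using ordD by metis

text \<open>The linking edge runs from the home that \<open>par w\<close> had before to the home
  that it gets in the new block; both bags contain \<open>par w\<close>, which is all that the new
  block shares with the earlier ones.\<close>

lemma progress_step:
  assumes P: "progress w M es xb ub" and w: "w \<in> heads"
    and ys: "length ys \<le> time_of w + 10" "ys = length xb' # flat_edges es' @ flat_pairs (zip xb' ub')"
    and g: "good G vs l bound (vx ` block w) es' (map (map (gl w)) xb') (map (map (gl w)) ub')"
    and inr: "\<And>p z. p \<in> set (zip xb' ub') \<Longrightarrow> z \<in> bag_of p \<Longrightarrow> z < length (block_list w)"
    and len: "length ub' = length xb'" "length xb' \<le> nodes_of w"
    and NN: "M' xNN 0 = length xb + length xb'"
    and EA: "M' xEN 0 = length ea" "seg (M' EA) 0 ea"
      "ea = flat_edges es @ map (\<lambda>x. x + length xb) (flat_edges es') @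
         (if length xb = 0 then [] else [M HOME (ord (par w)), M' HOME (ord (par w))])"
    and BA: "M' xBN 0 = length ba" "seg (M' BA) 0 ba"
      "ba = flat_pairs (zip xb ub) @ flat_pairs (map (\<lambda>(x, u). (map (gl w) x, map (gl w) u)) (zip xb' ub'))"
    and H: "\<And>v. (\<exists>t<length xb'. v \<in> gl w ` bag_of (zip xb' ub' ! t) \<and> M' HOME v = length xb + t) \<or>
         (\<forall>p\<in>set (zip xb' ub'). v \<notin> gl w ` bag_of p) \<and> M' HOME v = (if v = ord (par w) then length xb else M HOME v)"
    and sub: "\<And>t. t < length xb' \<Longrightarrow> set (ub' ! t) \<subseteq> set (xb' ! t)"
  shows "\<exists>es xb ub. progress (Suc w) M' es xb ub"
proof -
  let ?N = "length xb" and ?g = "map (map (gl w))"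
  let ?xb = "xb @ ?g xb'" and ?ub = "ub @ ?g ub'"
  let ?h = "M HOME (ord (par w))" and ?h' = "M' HOME (ord (par w))"
  let ?es = "es @ shift_edges ?N es' @ (if ?N = 0 then [] else [(?h, ?h')])"
  note p = progressD[OF P] and d = goodD[OF g]
  have w1: "1 \<le> w" "w \<le> n" "hd w = w" using w by auto
  have bag: "bag_of (zip xb' ub' ! t) = set (xb' ! t)" if "t < length xb'" for t
    using sub[OF that] that len by (auto simp: bag_of_def)
  have lub: "length ub = length xb"
  proof (cases "w = 1")
    case False
    then show ?thesis using goodD(1)[OF p(7)] by blast
  qed (use p(6) in simp)
  have bap: "flat_pairs (zip ?xb ?ub) = ba"
    unfolding BA(3) using lub len by (simp add: zip_map_map)
  have eap: "flat_edges ?es = ea"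
    unfolding EA(3) by (simp add: flat_edges_append flat_shift_edges) (simp add: flat_edges_def)
  have N': "0 < length xb'" using d(2) by simp
  have v_bag: "\<exists>t<length xb'. ord i \<in> gl w ` set (xb' ! t)" if i: "i \<in> block w" for i
  proof -
    have "vx i \<in> vx ` block w" using i by simp
    then obtain t where t: "t < length xb'" "vx i \<in> (!) vs ` set (?g xb' ! t)"
      using d(5) unfolding refined_tree_decomposition_def tree_decomposition_def by auto
    then obtain z where z: "z \<in> set (xb' ! t)" "vs ! ord i = vs ! gl w z" by auto
    have "z < length (block_list w)"
      by (rule inr[of "(xb' ! t, ub' ! t)"]) (use t(1) z(1) len in \<open>auto simp: set_zip bag_of_def\<close>)
    then have "gl w z < n" using gl_props(2)[OF w] by simp
    moreover have "ord i < n" using i block_subset[OF w1(1,2)] ordD by auto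
    ultimately have "ord i = gl w z" using z(2) distinct_vs length_vs by (simp add: nth_eq_iff_index_eq)
    then show ?thesis using t(1) z(1) by blast
  qed
  have bag_lt: "v < n" if v: "t < length xb'" "v \<in> gl w ` bag_of (zip xb' ub' ! t)" for t v
  proof -
    obtain z where z: "z \<in> bag_of (zip xb' ub' ! t)" "v = gl w z" using v(2) by auto
    have "zip xb' ub' ! t \<in> set (zip xb' ub')" using v(1) len by (intro nth_mem) simp
    then have "z < length (block_list w)" using inr z(1) by blast
    then show ?thesis using gl_props(2)[OF w] z(2) by simp
  qed
  have Hin: "\<exists>t<length xb'. ord i \<in> gl w ` set (xb' ! t) \<and> M' HOME (ord i) = ?N + t" if i: "i \<in> block w" for i
  proof -
    obtain t where t: "t < length xb'" "ord i \<in> gl w ` set (xb' ! t)" using v_bag[OF i] by blast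
    have "zip xb' ub' ! t \<in> set (zip xb' ub')" using t(1) len by (intro nth_mem) simp
    then have "\<not> (\<forall>p\<in>set (zip xb' ub'). ord i \<notin> gl w ` bag_of p)" using t bag[OF t(1)] by auto
    then show ?thesis using H[of "ord i"] bag by auto
  qed
  \<comment> \<open>No bag contains the index \<open>n\<close>, so for a root the dummy keeps its
    preset value, the first node of the new block.\<close>
  have Hn: "M' HOME n = (if par w = 0 then ?N else M HOME n)"
  proof -
    have "M' HOME n = (if n = ord (par w) then ?N else M HOME n)"
      using H[of n] bag_lt[of _ n] by blast
    moreover have "n = ord (par w) \<longleftrightarrow> par w = 0"
      using ord_0 ordD[of "par w"] ordD[OF w1(1,2)] w1 by fastforce
    ultimately show ?thesis by simp
  qed
  have pb: "par w \<in> before w \<inter> block w" if "par w \<noteq> 0"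
    unfolding before_Int_block[OF w1(1,2)] using that by simp
  note par_before = IntD1[OF pb] and par_block = IntD2[OF pb]
  have good': "good G vs l bound (vx ` before (Suc w)) ?es ?xb ?ub"
  proof (cases "w = 1")
    case True
    then have "xb = []" "ub = []" "es = []" using p(6) by auto
    moreover have "before (Suc w) = block w" using before_Suc[OF w1] True before_1 by simp
    moreover have "shift_edges 0 es' = es'" by (simp add: shift_edges_def)
    ultimately show ?thesis using g by simp
  next
    case False
    then have w2: "1 < w" using w1 by simp
    have g1: "good G vs l bound (vx ` before w) es xb ub" using p(7) False by simp
    note d1 = goodD[OF g1]
    \<comment> \<open>For a root the new block is disjoint from the earlier ones, so any two nodes
      may be linked and only their ranges matter. Otherwise both nodes must contain the top
      vertex.\<close>
    have H': "?N \<le> ?h' \<and> ?h' - ?N < length xb' \<and> (par w \<noteq> 0 \<longrightarrow> ord (par w) \<in> gl w ` set (xb' ! (?h' - ?N))) \<and>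
       ?h < ?N \<and> (par w \<noteq> 0 \<longrightarrow> ord (par w) \<in> set (xb ! ?h))"
    proof (cases "par w = 0")
      case True
      then show ?thesis using Hn ord_0 N' p(9)[OF w2] by simp
    next
      case False
      then show ?thesis using Hin[OF par_block[OF False]] p(8)[OF par_before[OF False]] by auto
    qed
    have "good G vs l bound (vx ` before w \<union> vx ` block w) (es @ shift_edges ?N es' @ [(?h, ?N + (?h' - ?N))]) ?xb ?ub"
    proof (rule good_glue[OF g1 g])
      show "?h < ?N" "?h' - ?N < length (?g xb')" using H' by auto
      show "vx ` before w \<inter> vx ` block w \<subseteq> (!) vs ` set (xb ! ?h)"
        using v_before_Int_block[OF w1(1,2)] H' by auto
      show "vx ` before w \<inter> vx ` block w \<subseteq> (!) vs ` set (?g xb' ! (?h' - ?N))"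
        using v_before_Int_block[OF w1(1,2)] H' by (auto simp: image_image)
      show "e \<subseteq> vx ` before w \<or> e \<subseteq> vx ` block w" if "e \<in> edges G" "e \<subseteq> vx ` before w \<union> vx ` block w" for e
        using edge_split[OF w1(1,2) that] .
    qed
    moreover have "?N \<noteq> 0" using d1(2) by simp
    ultimately show ?thesis using H' unfolding before_Suc[OF w1] image_Un by simp
  qed
  have home': "M' HOME (ord i) < length ?xb \<and> ord i \<in> set (?xb ! M' HOME (ord i))" if i: "i \<in> before (Suc w)" for i
  proof (cases "\<exists>t<length xb'. ord i \<in> gl w ` bag_of (zip xb' ub' ! t) \<and> M' HOME (ord i) = ?N + t")
    case True
    then show ?thesis using bag by (auto simp: nth_append)
  next
    case False
    then have *: "M' HOME (ord i) = (if ord i = ord (par w) then ?N else M HOME (ord i))" using H[of "ord i"] by blast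
    have "i \<notin> block w" using Hin[of i] False bag by blast
    then have ib: "i \<in> before w" using i before_Suc[OF w1] by simp
    then have ir: "1 \<le> i" "i \<le> n" by (auto simp: before_def)
    have "ord i \<noteq> ord (par w)"
    proof (cases "par w = 0")
      case True
      then show ?thesis using ord_0 ordD[OF ir] by simp
    next
      case False
      then have "i \<noteq> par w" using par_block \<open>i \<notin> block w\<close> by blast
      moreover have "par w \<le> n" using ordD[OF w1(1,2)] w1 by simp
      ultimately show ?thesis using ord_eq[OF ir, of "par w"] False by simp
    qed
    then show ?thesis using * p(8)[OF ib] by (simp add: nth_append)
  qed
  have hn: "M' HOME n < length ?xb"
  proof (cases "par w = 0")
    case False
    then have "1 < w" using ordD[OF w1(1,2)] by simp
    then show ?thesis using Hn p(9) False by simp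
  qed (use Hn N' in simp)
  have nodes: "length ?xb \<le> (\<Sum>v | v \<in> heads \<and> v < Suc w. nodes_of v)"
    unfolding sum_heads_Suc[OF w] using p(10) len(2) by simp
  have "length (flat_edges ?es) + length (flat_pairs (zip ?xb ?ub)) \<le>
      length (flat_edges es) + length (flat_pairs (zip xb ub)) + (length ys + 2)"
  proof -
    have "length (flat_pairs (map (\<lambda>(x, u). (map (gl w) x, map (gl w) u)) ps)) = length (flat_pairs ps)" for ps
      by (induction ps) auto
    then show ?thesis unfolding eap bap unfolding EA(3) BA(3) ys(2) by simp
  qed
  then have time: "length (flat_edges ?es) + length (flat_pairs (zip ?xb ?ub)) \<le> (\<Sum>v | v \<in> heads \<and> v < Suc w. time_of v + 12)"
    unfolding sum_heads_Suc[OF w] using p(11) ys(1) by linarith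
  have "progress (Suc w) M' ?es ?xb ?ub"
    unfolding progress_def eap[symmetric] bap[symmetric]
    using NN EA(1,2) BA(1,2) good' home' hn nodes time w1 unfolding eap[symmetric] bap[symmetric] by simp
  then show ?thesis by blast
qed

end

definition main_loop :: "com \<Rightarrow> nat \<Rightarrow> com" where
  "main_loop p l = While (Minus (Plus eN (Const 1)) (V xW))
     (If (Differ (Get HD (V xW)) (V xW)) Skip (process_block p l) ;; Inc xW)"

context block_algorithm begin

lemma solution_good:
  assumes w: "w \<in> heads" and s: "solution w ys"
  obtains es xb ub where "length ys \<le> time_of w + 10" "ys = length xb # flat_edges es @ flat_pairs (zip xb ub)"
    "good G vs l bound (vx ` block w) es (map (map (gl w)) xb) (map (map (gl w)) ub)"
    "\<And>p z. p \<in> set (zip xb ub) \<Longrightarrow> z \<in> bag_of p \<Longrightarrow> z < length (block_list w)"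
    "length ub = length xb" "length xb \<le> nodes_of w"
    "\<And>t. t < length xb \<Longrightarrow> set (ub ! t) \<subseteq> set (xb ! t)"
proof -
  obtain T X U where E: "encodes_decomposition (block_verts w) ys T X U"
    "refined_tree_decomposition l (block_graph w) T X U"
    "int (residual_independence_number (block_graph w) T X U) \<le> bound" "card (verts T) \<le> nodes_of w"
    and L: "length ys \<le> time_of w + 10"
    using s unfolding solution_def by blast
  have gr: "block_graph w = induced_subgraph G (set (block_verts w))"
    using set_block_verts[OF w] by (simp add: block_graph_def)
  have gv: "gl w ` {..<length (block_verts w)} \<subseteq> {..<length vs}"
    using gl_props(2)[OF w] length_vs by auto
  show thesis
  proof (rule encoded_good[OF E(1) E(2)[unfolded gr] E(3)[unfolded gr] distinct_block_verts[OF w] gl_props(1)[OF w] gv])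
    fix es xb ub
    assume *: "ys = length xb # flat_edges es @ flat_pairs (zip xb ub)" "length ub = length xb" "card (verts T) = length xb"
      "\<And>p z. p \<in> set (zip xb ub) \<Longrightarrow> z \<in> bag_of p \<Longrightarrow> z < length (block_verts w)"
      "good G vs l bound (set (block_verts w)) es (map (map (gl w)) xb) (map (map (gl w)) ub)"
      "\<And>t. t < length xb \<Longrightarrow> set (ub ! t) \<subseteq> set (xb ! t)"
    show thesis
      by (rule that[OF L *(1)]) (use * E(4) set_block_verts[OF w] in simp_all)
  qed
qed

lemma size_le: "size_of w \<le> n"
  unfolding size_of_def by (rule length_members)

text \<open>The top vertex is written behind the members of \<open>w\<close> but still within the
  stretch of \<open>Suc n\<close> cells of \<open>w\<close>, so no stored member list
  changes.\<close>

lemma static_MB: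
  assumes "static M" "w \<in> heads"
  shows "seg ((M MB)(w * Suc n + size_of w := x)) (v * Suc n) (members hd n v)"
proof -
  have len: "length (members hd n v) \<le> n" by (rule length_members)
  have "w * Suc n + size_of w < v * Suc n \<or> v * Suc n + length (members hd n v) \<le> w * Suc n + size_of w"
  proof -
    consider "v = w" | "w < v" | "v < w" by linarith
    then show ?thesis
    proof cases
      case 1
      then show ?thesis by (simp add: size_of_def)
    next
      case 2
      then have "Suc w * Suc n \<le> v * Suc n" by (intro mult_le_mono1) simp
      then show ?thesis using size_le[of w] by simp
    next
      case 3
      then have "Suc v * Suc n \<le> w * Suc n" by (intro mult_le_mono1) simp
      then show ?thesis using len by simp
    qed
  qed
  then show ?thesis using staticD(9)[OF assms(1), of v] by (simp only: seg_upd_other)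
qed

text \<open>The factor 200 at \<open>time_of\<close> covers 30 for the relocated run and 120 for
  copying its output.\<close>

definition block_cost :: "nat \<Rightarrow> nat" where
  "block_cost w = 200 * time_of w + 100 * size_of w + 200 * deg_of w + 2500"

lemma wp_process_block:
  assumes w: "w \<in> heads" and S: "static M" and free: "unused_free M" and W: "M xW 0 = w"
    and P: "progress w M es xb ub"
  shows "wp (process_block p l) M (block_cost w) (\<lambda>M' _. static M' \<and> unused_free M' \<and> M' xW 0 = w \<and>
    (\<exists>es xb ub. progress (Suc w) M' es xb ub))"
proof -
  note S' = staticD[OF S] and p = progressD[OF P]
  have w1: "1 \<le> w" "w \<le> n" using w by auto
  let ?q = "par w"
  let ?M1 = "M(xS := (M xS)(0 := size_of w), xP := (M xP)(0 := ?q), MB := (M MB)(w * Suc n + size_of w := ?q),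
     xH := (M xH)(0 := M HOME (ord ?q)), HOME := (M HOME)(ord ?q := length xb))"
  have S1: "static ?M1" using S static_MB[OF S w] unfolding static_def by simp
  have free1: "unused_free ?M1" using free by (simp add: unused_free_def)
  have mb: "?M1 MB (w * Suc n + z) = block_list w ! z" if z: "z < length (block_list w)" for z
  proof (cases "z < size_of w")
    case True
    then show ?thesis using S'(9)[of w] by (simp add: seg_def size_of_def block_list_def nth_append)
  next
    case False
    then have "par w \<noteq> 0 \<and> z = size_of w" using z by (auto simp: block_list_def size_of_def split: if_splits)
    then show ?thesis by (simp add: block_list_def nth_append size_of_def)
  qed
  have solve: "wp (solve_block p l) ?M1 (30 * time_of w + 100 * size_of w + 200 * deg_of w + 400) (\<lambda>M' _.
    (\<exists>ys. seg (M' OA) 0 ys \<and> solution w ys) \<and> unused_free M' \<and>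
    (\<forall>a. a < DD \<and> a \<notin> {OA, TP, xK, xE, xX, xI, xU, xQ, xEC, xTC, xJ, xHI, xOP, xBASE} \<longrightarrow> M' a = ?M1 a))"
    by (rule wp_solve_block[OF w S1 free1]) (use W in simp_all)
  have c0: "block_cost w \<ge> 30 * time_of w + 100 * size_of w + 200 * deg_of w + 400 + 120 * (time_of w + 10) + 300"
    by (simp add: block_cost_def)
  have eqs: "M PAR w = ?q" "M BS w = w * Suc n" "M SZ w = size_of w" "M ORD = ord" "M xNN 0 = length xb"
    using S' w1 p(1) by simp_all
  show ?thesis
    unfolding process_block_def
    using c0
    apply -
    apply (rule wp_Set_Seq, simp, simp add: W eqs del: mult_Suc_right cong: wp_cong)+
    apply (rule wp_Seq)
    apply (rule wp_call[OF solve])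
     apply simp
    subgoal premises q for M2 c2
    proof -
      obtain ys where ys: "seg (M2 OA) 0 ys" "solution w ys" using q(2) by blast
      have free2: "unused_free M2" using q(2) by blast
      have F2: "M2 a = ?M1 a" if "a < DD" "a \<notin> {OA, TP, xK, xE, xX, xI, xU, xQ, xEC, xTC, xJ, xHI, xOP, xBASE}" for a
        using q(2) that by blast
      have c2: "120 * (time_of w + 10) + 200 \<le> c2" using q(1,3) by simp
      obtain es' xb' ub' where sol: "length ys \<le> time_of w + 10" "ys = length xb' # flat_edges es' @ flat_pairs (zip xb' ub')"
        "good G vs l bound (vx ` block w) es' (map (map (gl w)) xb') (map (map (gl w)) ub')"
        "\<And>p z. p \<in> set (zip xb' ub') \<Longrightarrow> z \<in> bag_of p \<Longrightarrow> z < length (block_list w)"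
        "length ub' = length xb'" "length xb' \<le> nodes_of w"
        "\<And>t. t < length xb' \<Longrightarrow> set (ub' ! t) \<subseteq> set (xb' ! t)"
        using solution_good[OF w ys(2)] by blast
      have oa: "M2 OA 0 = length xb'" "seg (M2 OA) 1 (flat_edges es')"
        "seg (M2 OA) (Suc (length (flat_edges es'))) (flat_pairs (zip xb' ub'))"
        using ys(1) unfolding sol(2) by (simp_all add: seg_Cons seg_append)
      have N': "0 < length xb'" "length es' = length xb' - 1" using goodD(2,3)[OF sol(3)] by simp_all
      let ?fe = "flat_edges es'" and ?ps = "zip xb' ub'"
      have lfe: "2 * length xb' = 2 + length ?fe" unfolding length_flat_edges using N' by linarith
      have lys: "length ?fe + length (flat_pairs ?ps) \<le> time_of w + 10" using sol(1,2) by simp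
      have st2: "M2 xEN 0 = length (flat_edges es)" "seg (M2 EA) 0 (flat_edges es)" "M2 xNN 0 = length xb"
        "M2 xBN 0 = length (flat_pairs (zip xb ub))" "seg (M2 BA) 0 (flat_pairs (zip xb ub))"
        "M2 xW 0 = w" "M2 ORD = ord" "M2 MB = ?M1 MB" "M2 BS = M BS" "M2 xP 0 = ?q" "M2 xH 0 = M HOME (ord ?q)"
        "M2 HOME = (M HOME)(ord ?q := length xb)"
        using F2 p(1-5) W eqs by simp_all
      show ?thesis
        using c2
        apply -
        apply (rule wp_Set_Seq, simp, simp cong: wp_cong)
        apply (rule wp_Seq)
        apply (rule wp_call[OF wp_copy_edges[where zs = ?fe and ea = "flat_edges es"]])
               apply (use oa lfe st2 in simp_all)[5]
         apply (use lys in simp)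
        subgoal premises r for M3 c3
        proof -
          have F3: "M3 a = M2 a" if "a \<notin> {EA, xEN, xI}" for a using r(2) that by simp
          have I3: "M3 xI 0 = Suc (length ?fe)" "M3 xEN 0 = length (flat_edges es) + length ?fe"
            "seg (M3 EA) 0 (flat_edges es @ map (\<lambda>x. x + length xb) ?fe)"
            using r(2) st2 by simp_all
          have c3: "120 * length (flat_pairs ?ps) + 150 \<le> c3" using r(1,3) lys by simp
          have st3: "M3 OA = M2 OA" "M3 xNN 0 = length xb" "M3 xBN 0 = length (flat_pairs (zip xb ub))"
            "seg (M3 BA) 0 (flat_pairs (zip xb ub))" "M3 xW 0 = w" "M3 ORD = ord" "M3 MB = ?M1 MB" "M3 BS = M BS"
            using F3 st2 by simp_all
          have glM: "M3 ORD (M3 MB (M3 BS (M3 xW 0) + z)) = gl w z" if "pp \<in> set ?ps" "z \<in> bag_of pp" for pp z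
            using mb[OF sol(4)[OF that]] st3(5-8) eqs by simp
          show ?thesis
            using c3
            apply -
            apply (rule wp_Set_Seq, simp, simp add: st3 cong: wp_cong)
            apply (rule wp_Seq)
            apply (rule wp_call[OF wp_copy_bags[where ps = ?ps and bs = "flat_pairs (zip xb ub)" and gl = "gl w"]])
                  apply (use I3 st3 oa in simp)
                 apply (use st3 oa sol(5) in simp)
                apply (use st3 in simp)
               apply (use st3 in simp)
              apply (use st3 in simp)
             subgoal for pp z using glM[of pp z] by simp
             apply simp
            subgoal premises u for M4 c4
            proof -
              let ?out = "flat_pairs (map (\<lambda>(x, u). (map (gl w) x, map (gl w) u)) ?ps)"
              let ?ba = "flat_pairs (zip xb ub) @ ?out"
              have B4: "M4 xBN 0 = length ?ba" "seg (M4 BA) 0 ?ba" using u(2) by simp_all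
              have H4: "(\<exists>t<length xb'. v \<in> gl w ` bag_of (?ps ! t) \<and> M4 HOME v = length xb + t) \<or>
                (\<forall>p\<in>set ?ps. v \<notin> gl w ` bag_of p) \<and> M4 HOME v = (if v = ord ?q then length xb else M HOME v)" for v
              proof -
                have "M3 HOME v = (if v = ord ?q then length xb else M HOME v)" using F3[of HOME] st2(12) by simp
                then show ?thesis using conjunct1[OF conjunct2[OF conjunct2[OF u(2)]], rule_format, of v] st3(2) sol(5) by simp
              qed
              have F4: "M4 a = M3 a" if "a \<notin> {BA, HOME, xI, xBN, xL, xX, xT}" for a using u(2) that by simp
              have c4: "50 \<le> c4" using u(1,3) by simp
              have F: "M4 a = ?M1 a" if "a < DD" "a \<notin> {BA, HOME, xBN, xL, xT, EA, xEN, OA, TP, xK, xE, xX, xI, xU, xQ, xEC, xTC, xJ, xHI, xOP, xBASE}" for a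
                using F4[of a] F3[of a] F2[of a] that by simp
              have st4: "M4 xNN 0 = length xb" "M4 xEN 0 = length (flat_edges es) + length ?fe" "M4 xP 0 = ?q"
                "M4 xH 0 = M HOME (ord ?q)" "M4 ORD = ord" "M4 OA 0 = length xb'"
                "seg (M4 EA) 0 (flat_edges es @ map (\<lambda>x. x + length xb) ?fe)"
                using F4 F3 I3 st2 st3 oa by simp_all
              have static4: "static M4" by (rule static_cong[OF S1]) (use F in auto)
              have free4: "M4 (a + DD) = M2 (a + DD)" "M4 xBASE = M2 xBASE" for a
                using F4 F3 by simp_all
              let ?ea0 = "flat_edges es @ map (\<lambda>x. x + length xb) ?fe"
              have fin: "static N \<and> unused_free N \<and> N xW 0 = w \<and> (\<exists>es xb ub. progress (Suc w) N es xb ub)"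
                if N: "N xNN 0 = length xb + length xb'" "N xEN 0 = length ea" "seg (N EA) 0 ea"
                  "ea = ?ea0 @ (if length xb = 0 then [] else [M HOME (ord ?q), M4 HOME (ord ?q)])"
                  "\<And>a. a \<notin> {xNN, xEN, EA} \<Longrightarrow> N a = M4 a" for N ea
              proof -
                have "static N" by (rule static_cong[OF static4]) (use N(5) in auto)
                moreover have "unused_free N" using free2 N(5) free4 by (simp add: unused_free_def)
                moreover have "N xW 0 = w" using N(5) F W by simp
                moreover have "\<exists>es xb ub. progress (Suc w) N es xb ub"
                proof (rule progress_step[where M' = N and xb' = xb' and ub' = ub', OF P w sol(1-6) N(1)])
                  show "N xEN 0 = length ea" "seg (N EA) 0 ea" using N by simp_all
                  show "ea = flat_edges es @ map (\<lambda>x. x + length xb) ?fe @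
                    (if length xb = 0 then [] else [M HOME (ord ?q), N HOME (ord ?q)])"
                    using N(4) N(5)[of HOME] by simp
                  show "N xBN 0 = length ?ba" "seg (N BA) 0 ?ba" using B4 N(5) by simp_all
                  show "(\<exists>t<length xb'. v \<in> gl w ` bag_of (?ps ! t) \<and> N HOME v = length xb + t) \<or>
                    (\<forall>p\<in>set ?ps. v \<notin> gl w ` bag_of p) \<and> N HOME v = (if v = ord ?q then length xb else M HOME v)" for v
                    using H4[of v] N(5)[of HOME] by simp
                qed (use sol(7) in auto)
                ultimately show ?thesis by blast
              qed
              let ?L = "length (flat_edges es) + length ?fe"
              have s1: "seg ((M4 EA)(?L := M HOME (ord ?q), Suc ?L := M4 HOME (ord ?q))) 0 (?ea0 @ [M HOME (ord ?q), M4 HOME (ord ?q)])"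
              proof -
                have "seg ((M4 EA)(?L := M HOME (ord ?q))) 0 (?ea0 @ [M HOME (ord ?q)])"
                  by (rule seg_snoc[OF st4(7)]) simp
                from seg_snoc[OF this, of "Suc ?L"] show ?thesis by simp
              qed
              show ?thesis
                using c4
                apply -
                apply (rule wp_Seq)
                apply (rule wp_If, simp)
                subgoal premises y
                proof -
                  have ne: "length xb \<noteq> 0" using y(2) st4(1) by simp
                  show ?thesis
                    using y(1)
                    apply -
                    apply (rule wp_Set_Seq, simp, simp add: st4 cong: wp_cong)+
                    apply (rule wp_Set, simp)
                    apply (rule wp_Set, simp)
                    apply (rule fin[where ea = "?ea0 @ [M HOME (ord ?q), M4 HOME (ord ?q)]"])
                    using s1 s1[unfolded fun_upd_def] ne by (simp_all add: st4)
                qed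
                subgoal premises y
                proof -
                  have z: "xb = []" using y(2) st4(1) by simp
                  show ?thesis
                    apply (rule wp_Skip)
                    using y(1) apply simp
                    apply (rule wp_Set)
                    using y(1) apply simp
                    apply (rule fin[where ea = ?ea0])
                    using z st4 by simp_all
                qed
                done
            qed
            done
        qed
        done
    qed
    done
qed

lemma wp_main_loop:
  assumes S: "static M" and free: "unused_free M" and W: "M xW 0 = 1" and P: "progress 1 M [] [] []"
  shows "wp (main_loop p l) M (30 * n + (\<Sum>v\<in>heads. block_cost v) + 20) (\<lambda>M' _.
    \<exists>es xb ub. progress (Suc n) M' es xb ub)"
  unfolding main_loop_def
proof (rule wp_While[where I = "\<lambda>M' c. \<exists>w. 1 \<le> w \<and> w \<le> Suc n \<and> M' xW 0 = w \<and> static M' \<and> unused_free M' \<and>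
    (\<exists>es xb ub. progress w M' es xb ub) \<and> 30 * (Suc n - w) + (\<Sum>v | v \<in> heads \<and> w \<le> v. block_cost v) + 20 \<le> c"], goal_cases)
  case 1
  have "{v. v \<in> heads \<and> 1 \<le> v} = heads" by auto
  then have "30 * (Suc n - 1) + (\<Sum>v | v \<in> heads \<and> 1 \<le> v. block_cost v) + 20 \<le> 30 * n + (\<Sum>v\<in>heads. block_cost v) + 20"
    by simp
  then show ?case using S free W P by (intro exI[of _ 1]) auto
next
  case (2 M' c)
  then show ?case by auto
next
  case (3 M' c)
  then obtain w es xb ub where w: "1 \<le> w" "w \<le> Suc n" "M' xW 0 = w" and S': "static M'" and free': "unused_free M'"
    and P': "progress w M' es xb ub" and c: "30 * (Suc n - w) + (\<Sum>v | v \<in> heads \<and> w \<le> v. block_cost v) + 20 \<le> c"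
    by blast
  have n': "M' IN 0 = n" using staticD(1)[OF S'] A0 by simp
  have hd': "M' HD = hd" using staticD(5)[OF S'] .
  have wn: "w \<le> n" using 3(2) n' w by simp
  have c1: "30 * (Suc n - Suc w) + 30 + (\<Sum>v | v \<in> heads \<and> w \<le> v. block_cost v) + 20 \<le> c"
    using c wn by linarith
  have fin: "wp (Inc xW) N d (\<lambda>M' c. \<exists>w. 1 \<le> w \<and> w \<le> Suc n \<and> M' xW 0 = w \<and> static M' \<and> unused_free M' \<and>
    (\<exists>es xb ub. progress w M' es xb ub) \<and> 30 * (Suc n - w) + (\<Sum>v | v \<in> heads \<and> w \<le> v. block_cost v) + 20 \<le> c)"
    if N: "N xW 0 = w" "static N" "unused_free N" "\<exists>es xb ub. progress (Suc w) N es xb ub"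
      and d: "30 * (Suc n - Suc w) + (\<Sum>v | v \<in> heads \<and> Suc w \<le> v. block_cost v) + 20 + 6 \<le> d" for N d
  proof -
    let ?N = "N(xW := (N xW)(0 := Suc w))"
    have "static ?N" by (rule static_cong[OF N(2)]) auto
    moreover have "unused_free ?N" using N(3) by (simp add: unused_free_def)
    moreover have "\<exists>es xb ub. progress (Suc w) ?N es xb ub" using N(4) by (simp add: progress_def)
    ultimately show ?thesis
      apply -
      apply (rule wp_Set)
      using d apply simp
      apply (rule exI[of _ "Suc w"])
      using wn d N(1) by auto
  qed
  show ?case
  proof (cases "hd w = w")
    case False
    then have "w \<notin> heads" by simp
    then have "{v. v \<in> heads \<and> w \<le> v} = {v. v \<in> heads \<and> Suc w \<le> v}" by (auto simp: Suc_le_eq le_less)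
    then have c2: "30 * (Suc n - Suc w) + 30 + (\<Sum>v | v \<in> heads \<and> Suc w \<le> v. block_cost v) + 20 \<le> c"
      using c1 by simp
    have P2: "\<exists>es xb ub. progress (Suc w) M' es xb ub" using progress_skip[OF P' w(1) wn False] by blast
    show ?thesis
      apply (rule wp_Seq)
      apply (rule wp_If)
      using c2 apply simp
       apply (rule wp_Skip)
      using c2 apply simp
       apply (rule fin[OF w(3) S' free' P2])
      using c2 apply simp
      using False by (simp add: hd' w(3))
  next
    case True
    then have wh: "w \<in> heads" using w wn by simp
    then have "{v. v \<in> heads \<and> w \<le> v} = insert w {v. v \<in> heads \<and> Suc w \<le> v}" by auto
    then have c2: "30 * (Suc n - Suc w) + 30 + block_cost w + (\<Sum>v | v \<in> heads \<and> Suc w \<le> v. block_cost v) + 20 \<le> c"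
      using c1 by simp
    show ?thesis
      apply (rule wp_Seq)
      apply (rule wp_If)
      using c2 apply simp
       apply (use True in \<open>simp add: hd' w(3)\<close>)
      apply (rule wp_call[OF wp_process_block[OF wh S' free' w(3) P']])
      using c2 apply simp
      apply (rule fin)
      using c2 by auto
  qed
next
  case (4 M' c)
  then obtain w where w: "1 \<le> w" "w \<le> Suc n" "M' xW 0 = w" "static M'" "\<exists>es xb ub. progress w M' es xb ub" by blast
  have "M' IN 0 = n" using staticD(1)[OF w(4)] A0 by simp
  then have "w = Suc n" using 4(2) w by simp
  then show ?case using w(5) by simp
qed

end

section \<open>The complete program\<close>

definition out_loop :: "nat \<Rightarrow> nat \<Rightarrow> com" where
  "out_loop a b = (xI ::= Const 0 ;; While (Minus (V b) (V xI)) (Out (Get a (V xI)) ;; Inc xI))"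

text \<open>Printing is treated with \<open>exec\<close> directly, as \<open>wp\<close> describes
  only runs that leave the tape unchanged.\<close>

lemma exec_out_loop:
  assumes zs: "seg (M a) 0 zs" "M b 0 = length zs" and ab: "a \<noteq> xI" "b \<noteq> xI"
  shows "\<exists>t M'. exec (out_loop a b) (M, out) t (M', out @ zs) \<and> t \<le> 20 * length zs + 20 \<and> (\<forall>c. c \<noteq> xI \<longrightarrow> M' c = M c)"
proof -
  let ?body = "Out (Get a (V xI)) ;; Inc xI"
  let ?loop = "While (Minus (V b) (V xI)) ?body"
  have loop: "\<exists>t M'. exec ?loop (N, out) t (M', out @ drop j zs) \<and> t \<le> 20 * (length zs - j) + 10 \<and>
      (\<forall>c. c \<noteq> xI \<longrightarrow> M' c = M c)"
    if "j \<le> length zs" "N xI 0 = j" "\<forall>c. c \<noteq> xI \<longrightarrow> N c = M c" for j N out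
    using that
  proof (induction "length zs - j" arbitrary: j N out)
    case 0
    then have "val N (Minus (V b) (V xI)) = 0" using zs ab by simp
    then have "exec ?loop (N, out) (cost (Minus (V b) (V xI)) + 1) (N, out)"
      using exec.WhileFalse[of "(N, out)" "Minus (V b) (V xI)" ?body] by (simp only: fst_conv)
    then show ?case using 0 by (intro exI[of _ "cost (Minus (V b) (V xI)) + 1"] exI[of _ N]) simp
  next
    case (Suc d)
    then have j: "j < length zs" by simp
    let ?N = "N(xI := (N xI)(0 := Suc j))"
    have fr: "\<forall>c. c \<noteq> xI \<longrightarrow> ?N c = M c" using Suc.prems by simp
    have eqs: "N a j = zs ! j" "N b 0 = length zs" using Suc.prems(3) zs ab j by (simp_all add: seg_def)
    have "exec (Out (Get a (V xI))) (N, out) (cost (Get a (V xI)) + 1) (N, out @ [zs ! j])"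
      using exec.Out[of "Get a (V xI)" N out] eqs Suc.prems(2) by simp
    moreover have "exec (Inc xI) (N, out @ [zs ! j]) 6 (?N, out @ [zs ! j])"
      by (rule exec_SetI) (use Suc.prems in simp_all)
    ultimately have body: "exec ?body (N, out) (cost (Get a (V xI)) + 1 + 6) (?N, out @ [zs ! j])" by (rule exec.Seq)
    have "d = length zs - Suc j" using Suc.hyps(2) by simp
    from Suc.hyps(1)[OF this, of ?N "out @ [zs ! j]"] j fr
    obtain t M' where r: "exec ?loop (?N, out @ [zs ! j]) t (M', (out @ [zs ! j]) @ drop (Suc j) zs)"
      "t \<le> 20 * (length zs - Suc j) + 10" "\<forall>c. c \<noteq> xI \<longrightarrow> M' c = M c" by auto
    have dr: "(out @ [zs ! j]) @ drop (Suc j) zs = out @ drop j zs" using Cons_nth_drop_Suc[OF j] by simp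
    have "val N (Minus (V b) (V xI)) \<noteq> 0" using eqs Suc.prems(2) j by simp
    then have "exec ?loop (N, out) (cost (Minus (V b) (V xI)) + 1 + (cost (Get a (V xI)) + 1 + 6) + t) (M', out @ drop j zs)"
      using exec.WhileTrue[of "(N, out)" "Minus (V b) (V xI)", OF _ body r(1)] dr by simp
    then show ?case
      using r(2,3) j by (intro exI[of _ "cost (Minus (V b) (V xI)) + 1 + (cost (Get a (V xI)) + 1 + 6) + t"] exI[of _ M']) simp
  qed
  let ?M = "M(xI := (M xI)(0 := 0))"
  have 1: "exec (xI ::= Const 0) (M, out) 3 (?M, out)" by (rule exec_SetI) simp_all
  obtain t M' where 2: "exec ?loop (?M, out) t (M', out @ drop 0 zs)" "t \<le> 20 * (length zs - 0) + 10" "\<forall>c. c \<noteq> xI \<longrightarrow> M' c = M c"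
    using loop[of 0 ?M out] by auto
  show ?thesis
    unfolding out_loop_def using exec.Seq[OF 1 2(1)] 2(2,3) by (intro exI[of _ "3 + t"] exI[of _ M']) simp
qed

definition decompose :: "com \<Rightarrow> nat \<Rightarrow> com" where
  "decompose p l = ((analyse ;; Set ORD (Const 0) eN ;; xW ::= Const 1 ;; main_loop p l) ;;
     Out (V xNN) ;; out_loop EA xEN ;; out_loop BA xBN)"

definition finished :: "'a graph \<Rightarrow> 'a list \<Rightarrow> nat \<Rightarrow> int \<Rightarrow> nat \<Rightarrow> nat \<Rightarrow> mem \<Rightarrow> bool" where
  "finished G vs l r N L M \<longleftrightarrow> (\<exists>es xb ub. M xNN 0 = length xb \<and>
     M xEN 0 = length (flat_edges es) \<and> seg (M EA) 0 (flat_edges es) \<and>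
     M xBN 0 = length (flat_pairs (zip xb ub)) \<and> seg (M BA) 0 (flat_pairs (zip xb ub)) \<and>
     good G vs l r (verts G) es xb ub \<and> length xb \<le> N \<and>
     length (flat_edges es) + length (flat_pairs (zip xb ub)) \<le> L)"

lemma concat_nth:
  assumes "v < length adj" "d < length (adj ! v)"
  shows "length (concat (take v adj)) + d < length (concat adj) \<and> concat adj ! (length (concat (take v adj)) + d) = adj ! v ! d"
proof -
  have "concat adj = concat (take v adj) @ adj ! v @ concat (drop (Suc v) adj)"
    using id_take_nth_drop[OF assms(1)] by (metis concat.simps(2) concat_append)
  then show ?thesis using assms(2) by (simp add: nth_append)
qed

text \<open>The bound on the total length of the adjacency lists holds because an entry is
  determined by its edge and its direction.\<close>

lemma encoded_input:
  assumes E: "encodes_graph vs xs G" and G: "simple_graph G"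
  defines "A \<equiv> init_mem xs 0"
  shows "input A (length vs)"
    and "input.st A (length vs) \<le> 2 * card (edges G)"
    and "v < length vs \<Longrightarrow> u < length vs \<Longrightarrow> input.nbr A (length vs) v u \<longleftrightarrow> {vs ! v, vs ! u} \<in> edges G"
    and "v < length vs \<Longrightarrow> distinct (map (input.tgt A (length vs)) [input.st A v..<input.st A (Suc v)])"
proof -
  let ?n = "length vs"
  obtain adj where vs: "distinct vs" "set vs = verts G" and adj: "length adj = ?n"
    "\<And>i. i < ?n \<Longrightarrow> distinct (adj ! i) \<and> set (adj ! i) = {j. j < ?n \<and> {vs ! i, vs ! j} \<in> edges G}"
    and xs: "xs = [?n, card (edges G)] @ map (\<lambda>i. length (concat (take i adj))) [0..<Suc ?n] @ concat adj"
    using E unfolding encodes_graph_def by blast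
  have len: "length xs = 3 + ?n + length (concat adj)" unfolding xs by simp
  have A0: "A 0 = ?n" unfolding A_def init_mem_def xs by simp
  have Ast: "A (2 + v) = length (concat (take v adj))" if "v \<le> ?n" for v
  proof -
    have "xs ! (2 + v) = length (concat (take v adj))"
      unfolding xs using that by (simp add: nth_append del: upt_Suc)
    then show ?thesis unfolding A_def init_mem_def using len that by simp
  qed
  have Atgt: "A (3 + ?n + k) = concat adj ! k" if "k < length (concat adj)" for k
  proof -
    have "xs ! (3 + ?n + k) = concat adj ! k" unfolding xs by (simp add: nth_append numeral_3_eq_3 del: upt_Suc)
    then show ?thesis unfolding A_def init_mem_def using len that by simp
  qed
  have stS: "length (concat (take (Suc v) adj)) = length (concat (take v adj)) + length (adj ! v)" if "v < ?n" for v
    using that adj(1) by (simp add: take_Suc_conv_app_nth)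
  have cl: "length (concat (take ?n adj)) = length (concat adj)" using adj(1) by simp
  have elt: "x < ?n" if "x \<in> set (concat adj)" for x
  proof -
    obtain ys where "ys \<in> set adj" "x \<in> set ys" using \<open>x \<in> set (concat adj)\<close> by auto
    then show ?thesis using adj by (auto simp: in_set_conv_nth[of ys])
  qed
  show inp: "input A ?n"
  proof
    show "A 0 = ?n" by (rule A0)
    show "A 2 = 0" using Ast[of 0] by simp
    show "A (2 + v) \<le> A (3 + v)" if "v < ?n" for v
      using Ast[of v] Ast[of "Suc v"] stS[OF that] that by (simp add: numeral_3_eq_3)
    show "A (3 + ?n + k) < ?n" if "k < A (2 + ?n)" for k
    proof -
      have k: "k < length (concat adj)" using that Ast[of ?n] cl by simp
      then show ?thesis using Atgt[OF k] elt nth_mem[OF k] by simp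
    qed
  qed
  interpret input A ?n by (rule inp)
  have st: "st v = length (concat (take v adj))" if "v \<le> ?n" for v using Ast[OF that] by (simp add: st_def)
  have row: "map tgt [st v..<st (Suc v)] = adj ! v" if v: "v < ?n" for v
  proof (rule nth_equalityI)
    have s: "st v = length (concat (take v adj))" "st (Suc v) = st v + length (adj ! v)"
      using st[of v] st[of "Suc v"] stS[OF v] v by simp_all
    then show "length (map tgt [st v..<st (Suc v)]) = length (adj ! v)" by simp
    fix d assume "d < length (map tgt [st v..<st (Suc v)])"
    then have d: "d < length (adj ! v)" using s by simp
    then have "tgt (st v + d) = adj ! v ! d"
      using concat_nth[of v adj d] v adj(1) s(1) Atgt by (simp add: tgt_def)
    then show "map tgt [st v..<st (Suc v)] ! d = adj ! v ! d" using s d by simp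
  qed
  show "distinct (map tgt [st v..<st (Suc v)])" if "v < ?n" for v using row[OF that] adj(2)[OF that] by simp
  show "nbr v u \<longleftrightarrow> {vs ! v, vs ! u} \<in> edges G" if "v < ?n" "u < ?n" for v u
  proof -
    have "nbr v u \<longleftrightarrow> u \<in> set (map tgt [st v..<st (Suc v)])" by (auto simp: nbr_def)
    then show ?thesis using row[OF that(1)] adj(2)[OF that(1)] that(2) by simp
  qed
  let ?D = "SIGMA v:{..<?n}. set (adj ! v)"
  \<comment> \<open>The bit \<open>v < u\<close> separates the two entries of an edge, so
    \<open>?f\<close> is injective and each edge accounts for at most two entries.\<close>
  let ?f = "\<lambda>(v, u). ({vs ! v, vs ! u}, v < u)"
  have fin: "finite (edges G)" using G by (auto simp: simple_graph_def intro: finite_subset[of _ "Pow (verts G)"])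
  have "st ?n = length (concat adj)" using st[of ?n] cl by simp
  also have "\<dots> = (\<Sum>v<?n. length (adj ! v))"
    by (simp add: length_concat sum_list_sum_nth adj(1) lessThan_atLeast0)
  also have "\<dots> = (\<Sum>v<?n. card (set (adj ! v)))"
    by (rule sum.cong[OF refl], rule distinct_card[symmetric]) (use adj(2) in simp)
  also have "\<dots> = card ?D" by (rule card_SigmaI[symmetric]) auto
  also have "\<dots> = card (?f ` ?D)"
  proof (rule card_image[symmetric], rule inj_onI)
    fix x y assume "x \<in> ?D" "y \<in> ?D" and eq: "?f x = ?f y"
    then obtain a b c d where x: "x = (a, b)" "a < ?n" "b < ?n" and y: "y = (c, d)" "c < ?n" "d < ?n"
      using adj(2) by fastforce
    have "a = c \<and> b = d \<or> a = d \<and> b = c" "a < b \<longleftrightarrow> c < d"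
      using eq x y vs(1) by (auto simp: doubleton_eq_iff nth_eq_iff_index_eq)
    then show "x = y" using x y by auto
  qed
  also have "\<dots> \<le> card (edges G \<times> (UNIV :: bool set))"
    by (rule card_mono) (use fin adj(2) in auto)
  finally show "st ?n \<le> 2 * card (edges G)" by (simp add: card_cartesian_product)
qed

section \<open>Sums over all blocks\<close>

context block_algorithm begin

text \<open>Every number is a member of exactly one block, that of its head, so the double sum
  regroups a sum over all vertices.\<close>

lemma sum_over_members: "(\<Sum>w\<in>heads. \<Sum>i<size_of w. h (members hd n w ! i)) = (\<Sum>i\<in>{1..n}. h i)" for h :: "nat \<Rightarrow> nat"
proof -
  have "(\<Sum>i<size_of w. h (members hd n w ! i)) = (\<Sum>i\<in>{i \<in> {1..n}. hd i = w}. h i)" for w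
  proof -
    have "(\<Sum>i<size_of w. h (members hd n w ! i)) = sum_list (map h (members hd n w))"
      by (simp add: sum_list_sum_nth size_of_def lessThan_atLeast0)
    also have "\<dots> = (\<Sum>i\<in>set (members hd n w). h i)" by (rule sum_list_distinct_conv_sum_set[OF distinct_members])
    also have "set (members hd n w) = {i \<in> {1..n}. hd i = w}" by (auto simp: set_members)
    finally show ?thesis .
  qed
  then have "(\<Sum>w\<in>heads. \<Sum>i<size_of w. h (members hd n w ! i)) = (\<Sum>w\<in>heads. \<Sum>i\<in>{i \<in> {1..n}. hd i = w}. h i)" by simp
  also have "\<dots> = (\<Sum>i\<in>{1..n}. h i)"
  proof (rule sum.group)
    show "hd ` {1..n} \<subseteq> heads"
    proof
      fix w assume "w \<in> hd ` {1..n}"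
      then obtain i where "1 \<le> i" "i \<le> n" "w = hd i" by auto
      then show "w \<in> heads" using hd_bounds[of i] by simp
    qed
  qed auto
  finally show ?thesis .
qed

lemma card_heads: "card heads \<le> n"
  using card_mono[of "{1..n}" heads] by fastforce

lemma sum_superadditive_blocks:
  assumes "superadditive h"
  shows "(\<Sum>w\<in>heads. h (card (block w)) (card (edges (block_graph w)))) \<le> h (2 * n) (card (edges G))"
proof -
  have "(\<Sum>w\<in>heads. h (card (block w)) (card (edges (block_graph w)))) \<le>
      h (\<Sum>w\<in>heads. card (block w)) (\<Sum>w\<in>heads. card (edges (block_graph w)))"
    by (rule superadditive_sum[OF assms]) simp
  also have "\<dots> \<le> h (2 * n) (card (edges G))"
    by (rule superadditive_mono[OF assms sum_card_block]) (use sum_edges_block in \<open>simp add: block_graph_def\<close>)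
  finally show ?thesis .
qed

lemma sum_time_of: "(\<Sum>w\<in>heads. time_of w) \<le> f (2 * n) (card (edges G))"
  by (rule order_trans[OF sum_mono sum_superadditive_blocks[OF superadd_f]]) (simp add: time_of_def)

lemma sum_nodes_of: "(\<Sum>w\<in>heads. nodes_of w) \<le> n + g (2 * n) (card (edges G))"
proof -
  have "(\<Sum>w\<in>heads. nodes_of w) \<le> (\<Sum>w\<in>heads. 1 + g (card (block w)) (card (edges (block_graph w))))"
    by (rule sum_mono) (simp add: nodes_of_def)
  also have "\<dots> = card heads + (\<Sum>w\<in>heads. g (card (block w)) (card (edges (block_graph w))))"
    by (subst sum.distrib) simp
  also have "\<dots> \<le> n + g (2 * n) (card (edges G))"
    using card_heads sum_superadditive_blocks[OF superadd_g] by (rule add_mono)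
  finally show ?thesis .
qed

lemma sum_block_cost:
  "(\<Sum>w\<in>heads. block_cost w) \<le> 200 * f (2 * n) (card (edges G)) + 2600 * n + 200 * st n"
proof -
  have s: "(\<Sum>w\<in>heads. size_of w) = n" using sum_over_members[of "\<lambda>_. 1"] by simp
  have d: "(\<Sum>w\<in>heads. deg_of w) = st n"
    using sum_over_members[of "\<lambda>i. st (Suc (ord i)) - st (ord i)"] deg_upto_n[OF dfs_done]
    by (simp add: deg_of_def deg_upto_def)
  have "(\<Sum>w\<in>heads. block_cost w) = 200 * (\<Sum>w\<in>heads. time_of w) + 100 * (\<Sum>w\<in>heads. size_of w) +
      200 * (\<Sum>w\<in>heads. deg_of w) + 2500 * card heads"
    unfolding block_cost_def sum_distrib_left by (simp add: sum.distrib)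
  also have "\<dots> \<le> 200 * f (2 * n) (card (edges G)) + 100 * n + 200 * st n + 2500 * n"
    unfolding s d using sum_time_of card_heads by (intro add_mono mult_le_mono) simp_all
  finally show ?thesis by simp
qed

lemma heads_less_Suc: "{v. v \<in> heads \<and> v < Suc n} = heads"
  by auto

lemma sum_output: "(\<Sum>v | v \<in> heads \<and> v < Suc n. time_of v + 12) \<le> f (2 * n) (card (edges G)) + 12 * n"
  unfolding heads_less_Suc using sum_time_of card_heads by (simp add: sum.distrib)

lemma progress_finished:
  assumes P: "progress (Suc n) M es xb ub" and n: "1 \<le> n"
  shows "finished G vs l bound (n + g (2 * n) (card (edges G))) (f (2 * n) (card (edges G)) + 12 * n) M"
proof -
  have "vx ` before (Suc n) = verts G" using bij_vx unfolding before_all by (simp add: bij_betw_def)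
  then have "good G vs l bound (verts G) es xb ub" using progressD(7)[OF P] n by simp
  moreover have "length xb \<le> n + g (2 * n) (card (edges G))"
    using progressD(10)[OF P] sum_nodes_of unfolding heads_less_Suc by linarith
  moreover have "length (flat_edges es) + length (flat_pairs (zip xb ub)) \<le> f (2 * n) (card (edges G)) + 12 * n"
    using progressD(11)[OF P] sum_output by (rule order_trans)
  ultimately show ?thesis
    unfolding finished_def using progressD(1-5)[OF P] by blast
qed

end

lemma decompose_correct:
  assumes G: "simple_graph G" and n: "1 \<le> card (verts G)"
    and solver: "\<And>S. S \<subseteq> verts G \<Longrightarrow> two_connected (induced_subgraph G S) \<Longrightarrow>
      computes_refined_tree_decomposition p l (induced_subgraph G S)
        (f (card S) (card (edges (induced_subgraph G S)))) (g (card S) (card (edges (induced_subgraph G S)))) (int k)"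
    and sf: "superadditive f" and sg: "superadditive g"
  shows "computes_refined_tree_decomposition (decompose p l) l G
    (10000 * (card (verts G) + card (edges G) + f (2 * card (verts G)) (card (edges G))))
    (1 * (card (verts G) + g (2 * card (verts G)) (card (edges G)))) (max (2 - int l) (int k))"
  unfolding computes_refined_tree_decomposition_def
proof (intro allI impI)
  fix vs xs assume E: "encodes_graph vs xs G"
  define nn where "nn = length vs"
  define A where "A = init_mem xs 0"
  note inp = encoded_input[OF E G, folded A_def nn_def]
  interpret input A nn by (rule inp(1))
  have vs: "distinct vs" "set vs = verts G" using E by (simp_all add: encodes_graph_def)
  then have nc: "card (verts G) = nn" using distinct_card nn_def by metis
  let ?m = "card (edges G)"
  have stn: "st nn \<le> 2 * ?m" using inp(2) .
  let ?M = "init_mem xs"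
  have z: "?M a i = 0" if "a \<noteq> 0" for a i using that by (simp add: init_mem_def)
  let ?r = "max (2 - int l) (int k)"
  let ?Q = "finished G vs l ?r (nn + g (2 * nn) ?m) (f (2 * nn) ?m + 12 * nn)"
  have n1: "1 \<le> nn" using n nc by simp
  have "wp (analyse ;; Set ORD (Const 0) eN ;; xW ::= Const 1 ;; main_loop p l) ?M
    (430 * nn + 300 * st nn + 300 + (200 * f (2 * nn) ?m + 2600 * nn + 200 * st nn)) (\<lambda>M _. ?Q M)"
    apply (rule wp_Seq)
    apply (rule wp_call[OF wp_analyse])
       apply (simp add: A_def)
      apply (rule z, assumption)
     apply simp
    subgoal premises q for M c
    proof -
      have an: "analysed M" and MA: "M IN = A" and fr: "\<And>a. 13 \<le> a \<Longrightarrow> a \<notin> {20..28} \<Longrightarrow> M a = ?M a"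
        using q(1) by blast+
      let ?ord = "(M ORD)(0 := nn)"
      note D = an[unfolded analysed_def]
      have dd: "dfs_done (M NUM) (M ORD) (M PAR)" using D by blast
      \<comment> \<open>Cell 0 of \<open>ORD\<close> now names the dummy. The properties of the
        search speak only of numbers from 1 on, so they survive.\<close>
      have dd': "dfs_done (M NUM) ?ord (M PAR)"
        unfolding dfs_done_def
      proof (intro conjI)
        show "\<forall>v<nn. 1 \<le> M NUM v \<and> M NUM v \<le> nn \<and> ?ord (M NUM v) = v"
          using dfs_done_num[OF dd] by fastforce
        show "\<forall>i. 1 \<le> i \<and> i \<le> nn \<longrightarrow> ?ord i < nn \<and> M NUM (?ord i) = i \<and> M PAR i < i \<and>
            (M PAR i \<noteq> 0 \<longrightarrow> nbr (?ord (M PAR i)) (?ord i))"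
          using dfs_done_ord[OF dd] by auto
        show "\<forall>a i u. 1 \<le> a \<and> a < i \<and> i \<le> u \<and> u \<le> nn \<and> nbr (?ord a) (?ord u) \<longrightarrow> a \<le> M PAR i"
        proof (intro allI impI)
          fix a i u assume "1 \<le> a \<and> a < i \<and> i \<le> u \<and> u \<le> nn \<and> nbr (?ord a) (?ord u)"
          then have "1 \<le> a \<and> a < i \<and> i \<le> u \<and> u \<le> nn \<and> nbr (M ORD a) (M ORD u)" by auto
          then show "a \<le> M PAR i"
            using conjunct2[OF conjunct2[OF dd[unfolded dfs_done_def]], rule_format, of a i u] by blast
        qed
      qed
      interpret analysed_graph A nn "M NUM" ?ord "M PAR" "M HD" "M LOC" G vs
      proof
        show "distinct vs" "set vs = verts G" "length vs = nn" "simple_graph G" using vs nn_def G by simp_all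
        show "nbr v u \<longleftrightarrow> {vs ! v, vs ! u} \<in> edges G" if "v < nn" "u < nn" for v u using inp(3) that .
        show "distinct (map tgt [st v..<st (Suc v)])" if "v < nn" for v using inp(4) that .
        show "dfs_done (M NUM) ?ord (M PAR)" by (rule dd')
        have o: "(1 \<le> z \<and> z \<le> nn \<and> 1 \<le> a \<and> a \<le> nn \<and> nbr (M ORD z) (M ORD a)) \<longleftrightarrow>
            (1 \<le> z \<and> z \<le> nn \<and> 1 \<le> a \<and> a \<le> nn \<and> nbr (?ord z) (?ord a))" for z a by auto
        show "M HD i = (if \<exists>z a. (z, i) \<in> {(y, M PAR y) |y. 1 \<le> y \<and> y \<le> nn}\<^sup>* \<and>
            (1 \<le> z \<and> z \<le> nn \<and> 1 \<le> a \<and> a \<le> nn \<and> nbr (?ord z) (?ord a)) \<and> a < M PAR i then M HD (M PAR i) else i)"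
          if "1 \<le> i" "i \<le> nn" for i
          using conjunct1[OF conjunct2[OF D], rule_format, OF conjI[OF that]] unfolding o .
        show "M LOC i = length (members (M HD) (i - 1) (M HD i))" if "1 \<le> i" "i \<le> nn" for i
          using D that by blast
      qed
      interpret block_algorithm A nn "M NUM" ?ord "M PAR" "M HD" "M LOC" G vs p l k f g
        by unfold_locales (use solver sf sg in simp_all)
      let ?N = "M(ORD := ?ord, xW := (M xW)(0 := 1))"
      have c: "30 * nn + 50 + (200 * f (2 * nn) ?m + 2600 * nn + 200 * st nn) \<le> c" using q(2) by simp
      have static: "static ?N"
        using D MA unfolding static_def size_of_def by simp
      have free: "unused_free ?N" using fr z by (simp add: unused_free_def)
      have prog: "progress 1 ?N [] [] []"
        using fr z unfolding progress_def before_1 by (simp add: flat_edges_def)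
      show ?thesis
        using c
        apply -
        apply (rule wp_Set_Seq, simp, simp add: MA A0 cong: wp_cong)
        apply (rule wp_Set_Seq, simp, simp cong: wp_cong)
        apply (rule wp_call[OF wp_main_loop])
             apply (use static in simp)
            apply (use free in simp)
           apply simp
          apply (use prog in simp)
        using sum_block_cost apply simp
        using progress_finished n1 unfolding bound_def by blast
    qed
    done
  then obtain t M where 1: "exec (analyse ;; Set ORD (Const 0) eN ;; xW ::= Const 1 ;; main_loop p l) (?M, []) t (M, [])"
    "t \<le> 430 * nn + 300 * st nn + 300 + (200 * f (2 * nn) ?m + 2600 * nn + 200 * st nn)" "?Q M"
    unfolding wp_def by blast
  obtain es xb ub where P: "M xNN 0 = length xb" "M xEN 0 = length (flat_edges es)" "seg (M EA) 0 (flat_edges es)"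
    "M xBN 0 = length (flat_pairs (zip xb ub))" "seg (M BA) 0 (flat_pairs (zip xb ub))"
    and F: "good G vs l ?r (verts G) es xb ub" "length xb \<le> nn + g (2 * nn) ?m"
    and out_len: "length (flat_edges es) + length (flat_pairs (zip xb ub)) \<le> f (2 * nn) ?m + 12 * nn"
    using 1(3) unfolding finished_def by blast
  have 2: "exec (Out (V xNN)) (M, []) 3 (M, [length xb])"
    using exec.Out[of "V xNN" M "[]"] P(1) by (simp add: numeral_3_eq_3)
  obtain t3 M3 where 3: "exec (out_loop EA xEN) (M, [length xb]) t3 (M3, [length xb] @ flat_edges es)"
    "t3 \<le> 20 * length (flat_edges es) + 20" "\<forall>c. c \<noteq> xI \<longrightarrow> M3 c = M c"
    using exec_out_loop[of M EA "flat_edges es" xEN "[length xb]"] P(2,3) by auto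
  obtain t4 M4 where 4: "exec (out_loop BA xBN) (M3, [length xb] @ flat_edges es) t4 (M4, ([length xb] @ flat_edges es) @ flat_pairs (zip xb ub))"
    "t4 \<le> 20 * length (flat_pairs (zip xb ub)) + 20"
    using exec_out_loop[of M3 BA "flat_pairs (zip xb ub)" xBN "[length xb] @ flat_edges es"] P(4,5) 3(3) by auto
  let ?ys = "length xb # flat_edges es @ flat_pairs (zip xb ub)"
  have "exec (decompose p l) (?M, []) (t + (3 + (t3 + t4))) (M4, ?ys)"
    unfolding decompose_def using exec.Seq[OF 1(1) exec.Seq[OF 2 exec.Seq[OF 3(1) 4(1)]]] by simp
  then have h: "halts_with (decompose p l) xs (t + (3 + (t3 + t4))) ?ys" unfolding halts_with_def by blast
  \<comment> \<open>Having at least one vertex lets \<open>10000 * nn\<close> absorb the fixed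
    costs, and \<open>stn\<close> replaces adjacency entries by twice the number of edges.\<close>
  have "t + (3 + (t3 + t4)) \<le> 10000 * (nn + ?m + f (2 * nn) ?m)"
    using 1(2) 3(2) 4(2) out_len stn n1 by simp
  then show "\<exists>t' ys T X U. halts_with (decompose p l) xs t' ys \<and>
      t' \<le> 10000 * (card (verts G) + ?m + f (2 * card (verts G)) ?m) \<and>
      encodes_decomposition vs ys T X U \<and> refined_tree_decomposition l G T X U \<and>
      card (verts T) \<le> 1 * (card (verts G) + g (2 * card (verts G)) ?m) \<and>
      int (residual_independence_number G T X U) \<le> max (2 - int l) (int k)"
    unfolding nc using h good_encodes[OF F(1) G] F(2)
    by (intro exI conjI) (assumption | simp)+
qed

theorem proposition4p1:
  fixes \<G> :: "'a graph set" and k l :: nat and f g :: "nat \<Rightarrow> nat \<Rightarrow> nat"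
  assumes "\<forall>G\<in>\<G>. simple_graph G"
    and "hereditary \<G>"
    and "superadditive f" and "superadditive g"
    and "\<exists>p. \<forall>G\<in>\<G>. two_connected G \<longrightarrow>
           computes_refined_tree_decomposition p l G
             (f (card (verts G)) (card (edges G)))
             (g (card (verts G)) (card (edges G)))
             (int k)"
  shows "\<exists>p c d. \<forall>G\<in>\<G>. card (verts G) \<ge> 1 \<longrightarrow>
           computes_refined_tree_decomposition p l G
             (c * (card (verts G) + card (edges G) + f (2 * card (verts G)) (card (edges G))))
             (d * (card (verts G) + g (2 * card (verts G)) (card (edges G))))
             (max (2 - int l) (int k))"
proof -
  obtain p where p: "\<And>G. G \<in> \<G> \<Longrightarrow> two_connected G \<Longrightarrow>
      computes_refined_tree_decomposition p l G (f (card (verts G)) (card (edges G))) (g (card (verts G)) (card (edges G))) (int k)"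
    using assms(5) by blast
  have "computes_refined_tree_decomposition (decompose p l) l G
      (10000 * (card (verts G) + card (edges G) + f (2 * card (verts G)) (card (edges G))))
      (1 * (card (verts G) + g (2 * card (verts G)) (card (edges G)))) (max (2 - int l) (int k))"
    if "G \<in> \<G>" "1 \<le> card (verts G)" for G
  \<comment> \<open>Heredity turns the assumption on 2-connected members of the class into one on
    the 2-connected induced subgraphs of \<open>G\<close>.\<close>
  proof (rule decompose_correct[OF _ that(2) _ assms(3,4)])
    show "simple_graph G" using assms(1) that(1) by blast
    fix S assume "S \<subseteq> verts G" "two_connected (induced_subgraph G S)"
    then show "computes_refined_tree_decomposition p l (induced_subgraph G S)
        (f (card S) (card (edges (induced_subgraph G S)))) (g (card S) (card (edges (induced_subgraph G S)))) (int k)"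
      using p[of "induced_subgraph G S"] assms(2) that(1) by (simp add: hereditary_def)
  qed
  then show ?thesis by blast
qed

end
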